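(* (Focal Index Lemma) Let $(M,\langle\cdot,\cdot\rangle)$ be a weak Riemannian Hilbert manifold with a smooth Levi-Civita connection $\nabla$ and $\tau$-continuous curvature tensor $R$. Let $N\subset M$ be a submanifold and let $c:[0,b]\to M$ be a geodesic with $c(0)=p\in N$ and $\xi=\dot c(0)\in T_p^{\perp}N$; assume that $T_pN$ is a closed subspace of $(T_pM,\tau)$ and $T_pM=T_pN\oplus T_p^{\perp}N$. Suppose that $c$ has a finite number of pathological points on its interior. Then for every vector field $Z$ along $c$ with $Z(0)\in T_pN$, the index form relative to the submanifold $N\times M\hookrightarrow M\times M$ satisfies $$D^2E(c)(Z,Z)\ \ge\ D^2E(c)(J,J),$$ where $J$ is the $N$-Jacobi field along $c$ such that $J(b)=Z(b)$.
   Context: A weak Riemannian metric on a Hilbert manifold $M$ (modeled on an infinite dimensional Hilbert space) is a smooth assignment to each $p\in M$ of a continuous positive definite symmetric bilinear form $\langle\cdot,\cdot\rangle(p)$ on $T_pM$; $T_pM$ need not be complete for the induced norm $\|\cdot\|$. The Hilbert space topology of $T_pM$ coming from the charts is denoted $\tau$. Standing assumptions: $M$ admits a smooth Levi-Civita connection $\nabla$ (hence geodesics, parallel transport and a smooth exponential map), and the curvature tensor $R$ is a continuous trilinear operator with respect to $\tau$. $T_p^\perp N$ is the $\langle\cdot,\cdot\rangle$-orthogonal complement of $T_pN$. Weingarten operator: $A_\xi(X)=-P(\nabla_X\xi)$ for $X\in T_pN$, with $\xi$ extended to a normal field along $N$ and $P:T_pM\to T_pN$ the projection along $T_p^\perp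 N$. A Jacobi field along $c$ is a solution of $\nabla_{\partial_t}\nabla_{\partial_t}J+R(J,\dot c)\dot c=0$ (sign convention in which positive sectional curvature means $\langle R(X,Y)Y,X\rangle>0$). An $N$-Jacobi field is a Jacobi field $J$ along $c$ with $J(0)\in T_pN$ and $\nabla_{\partial_t}J(0)+A_\xi(J(0))\in T_p^\perp N$. Jacobi flow of $c$ relative to $N$: let $\tau_t^s:T_{c(t)}M\to T_{c(s)}M$ be parallel transport along $c$ and $R_t(X)=\tau_t^0\big(R(\tau_0^tX,\dot c(t))\dot c(t)\big)$ on $T_pM$. The Jacobi flow is the family of operators $T(t):T_pM\to T_pM$ solving $T''(t)+R_t\circ T(t)=0$, $T(0)(v,w)=(v,0)$, $T'(0)(v,w)=(-A_\xi(v),w)$ for $(v,w)\in T_pN\oplus T_p^\perp N$. The point $c(t_o)$ is monofocal (of $p$ along $c$) if $T(t_o)$ is not injective, epifocal if $T(t_o)$ is not surjective, and pathological if it is epifocal but not monofocal. Vector fields along $c$ are piecewise differentiable. Index form relative to $N\times M\hookrightarrow M\times M$: for a vector field $Z$ along $c$ with $Z(0)\in T_pN$, $$D^2E(c)(Z,Z)=\int_0^b\Big(\|\nabla_{\partial_t}Z\|^2-\langle R(Z,\dot c)\dot c,Z\rangle\Big)dt-\langle A_\xi(Z(0)),Z(0)\rangle .$$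
   Formalization: Added, as the claim fails without them: c has no monofocal points on its interior, and at each interior pathological point c(t) the range of T(t) is dense for the norm of the weak metric. Also assumed: ξ extends to a smooth normal field along N, so that A_ξ is defined. *)

theory Defs
  imports "HOL-Analysis.Analysis"
begin

text \<open>
  The iterated directional derivatives are required to exist and to be continuous for each fixed
  choice of directions.  For a single finite order this is slightly weaker than being of class
  C^k in the Frechet sense, but by the uniform boundedness principle the two notions of C^infinity
  coincide on open subsets of Banach spaces.
\<close>

primrec k_smooth_on :: "nat \<Rightarrow> 'a::real_normed_vector set \<Rightarrow> ('a \<Rightarrow> 'b::real_normed_vector) \<Rightarrow> bool" where
  "k_smooth_on 0 S f \<longleftrightarrow> continuous_on S f"
| "k_smooth_on (Suc k) S f \<longleftrightarrow>
     (\<forall>x\<in>S. f differentiable (at x)) \<and>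
     (\<forall>v. k_smooth_on k S (\<lambda>x. frechet_derivative f (at x) v))"

definition smooth_on :: "'a::real_normed_vector set \<Rightarrow> ('a \<Rightarrow> 'b::real_normed_vector) \<Rightarrow> bool" where
  "smooth_on S f \<longleftrightarrow> (\<forall>k. k_smooth_on k S f)"

text \<open>
  A chart is a pair of an open domain and a coordinate map; the values of the coordinate map
  outside the domain are irrelevant.
\<close>

type_synonym ('m, 'a) chart = "'m set \<times> ('m \<Rightarrow> 'a)"

definition chart_inv :: "('m, 'a) chart \<Rightarrow> 'a \<Rightarrow> 'm" where
  "chart_inv C = inv_into (fst C) (snd C)"

definition chart_image :: "('m, 'a) chart \<Rightarrow> 'a set" where
  "chart_image C = snd C ` fst C"

definition is_chart :: "('m::topological_space, 'a::real_normed_vector) chart \<Rightarrow> bool" where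
  "is_chart C \<longleftrightarrow>
     open (fst C) \<and> open (chart_image C) \<and>
     homeomorphism (fst C) (chart_image C) (snd C) (chart_inv C)"

definition transition :: "('m, 'a) chart \<Rightarrow> ('m, 'a) chart \<Rightarrow> 'a \<Rightarrow> 'a" where
  "transition C D = snd D \<circ> chart_inv C"

definition compatible :: "('m, 'a::real_normed_vector) chart \<Rightarrow> ('m, 'a) chart \<Rightarrow> bool" where
  "compatible C D \<longleftrightarrow>
     smooth_on (snd C ` (fst C \<inter> fst D)) (transition C D) \<and>
     smooth_on (snd D ` (fst C \<inter> fst D)) (transition D C)"

text \<open>
  The smooth structure is given by its maximal atlas.  Hausdorffness of the manifold is a class
  constraint.
\<close>

definition hilbert_manifold ::
    "('m::t2_space, 'a::{real_inner, complete_space}) chart set \<Rightarrow> bool" where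
  "hilbert_manifold A \<longleftrightarrow>
     (\<nexists>B::'a set. finite B \<and> span B = UNIV) \<and>
     (\<forall>C\<in>A. is_chart C) \<and>
     (\<Union>C\<in>A. fst C) = UNIV \<and>
     (\<forall>C\<in>A. \<forall>D\<in>A. compatible C D) \<and>
     (\<forall>C. is_chart C \<and> (\<forall>D\<in>A. compatible C D) \<longrightarrow> C \<in> A)"

text \<open>
  The tangent space at \<open>p\<close> is the model space, a tangent vector being identified with its
  principal part in a chart \<open>chart_at A p\<close> around \<open>p\<close> that is chosen once and for all.  Its norm
  topology is the Hilbert space topology tau.  Since the chosen chart depends on the point in an
  arbitrary way, continuity and differentiability of a vector field always have to be expressed
  through its components \<open>coord\<close> in one fixed chart.
\<close>

definition chart_at :: "('m, 'a) chart set \<Rightarrow> 'm \<Rightarrow> ('m, 'a) chart" where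
  "chart_at A p = (SOME C. C \<in> A \<and> p \<in> fst C)"

definition change_components ::
    "('m, 'a::real_normed_vector) chart \<Rightarrow> ('m, 'a) chart \<Rightarrow> 'm \<Rightarrow> 'a \<Rightarrow> 'a" where
  "change_components C D p u = frechet_derivative (transition C D) (at (snd C p)) u"

definition coord ::
    "('m, 'a::real_normed_vector) chart set \<Rightarrow> ('m, 'a) chart \<Rightarrow> 'm \<Rightarrow> 'a \<Rightarrow> 'a" where
  "coord A C p X = change_components (chart_at A p) C p X"

definition tangent_of_coord ::
    "('m, 'a::real_normed_vector) chart set \<Rightarrow> ('m, 'a) chart \<Rightarrow> 'm \<Rightarrow> 'a \<Rightarrow> 'a" where
  "tangent_of_coord A C p u = change_components C (chart_at A p) p u"

definition smooth_vector_field_on ::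
    "('m, 'a::real_normed_vector) chart set \<Rightarrow> 'm set \<Rightarrow> ('m \<Rightarrow> 'a) \<Rightarrow> bool" where
  "smooth_vector_field_on A W \<nu> \<longleftrightarrow>
     (\<forall>C\<in>A. smooth_on (snd C ` (fst C \<inter> W))
               (\<lambda>x. coord A C (chart_inv C x) (\<nu> (chart_inv C x))))"

definition local_metric ::
    "('m, 'a::real_normed_vector) chart set \<Rightarrow> ('m \<Rightarrow> 'a \<Rightarrow> 'a \<Rightarrow> real) \<Rightarrow>
     ('m, 'a) chart \<Rightarrow> 'a \<Rightarrow> 'a \<Rightarrow> 'a \<Rightarrow> real" where
  "local_metric A g C x u v =
     (let p = chart_inv C x in g p (tangent_of_coord A C p u) (tangent_of_coord A C p v))"

definition weak_riemannian_metric ::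
    "('m, 'a::real_normed_vector) chart set \<Rightarrow> ('m \<Rightarrow> 'a \<Rightarrow> 'a \<Rightarrow> real) \<Rightarrow> bool" where
  "weak_riemannian_metric A g \<longleftrightarrow>
     (\<forall>p. bounded_bilinear (g p) \<and> (\<forall>X Y. g p X Y = g p Y X) \<and> (\<forall>X. X \<noteq> 0 \<longrightarrow> g p X X > 0)) \<and>
     (\<forall>C\<in>A. smooth_on (chart_image C \<times> UNIV) (\<lambda>(x, u, v). local_metric A g C x u v))"

text \<open>
  A connection is a family of Christoffel symbols, one for every chart of the atlas, obeying the
  usual transformation law; in a chart, \<open>\<nabla>\<^sub>u v = Dv(u) + \<Gamma>(u, v)\<close>.
\<close>

definition connection ::
    "('m, 'a::real_normed_vector) chart set \<Rightarrow>
     (('m, 'a) chart \<Rightarrow> 'a \<Rightarrow> 'a \<Rightarrow> 'a \<Rightarrow> 'a) \<Rightarrow> bool" where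
  "connection A \<Gamma> \<longleftrightarrow>
     (\<forall>C\<in>A. smooth_on (chart_image C \<times> UNIV) (\<lambda>(x, u, v). \<Gamma> C x u v) \<and>
            (\<forall>x\<in>chart_image C. bounded_bilinear (\<Gamma> C x))) \<and>
     (\<forall>C\<in>A. \<forall>D\<in>A. \<forall>x\<in>snd C ` (fst C \<inter> fst D). \<forall>u v.
        (let h = transition C D; dh = (\<lambda>y. frechet_derivative h (at y)) in
           dh x (\<Gamma> C x u v) =
             frechet_derivative (\<lambda>y. dh y v) (at x) u + \<Gamma> D (h x) (dh x u) (dh x v)))"

definition levi_civita ::
    "('m, 'a::real_normed_vector) chart set \<Rightarrow> ('m \<Rightarrow> 'a \<Rightarrow> 'a \<Rightarrow> real) \<Rightarrow>
     (('m, 'a) chart \<Rightarrow> 'a \<Rightarrow> 'a \<Rightarrow> 'a \<Rightarrow> 'a) \<Rightarrow> bool" where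
  "levi_civita A g \<Gamma> \<longleftrightarrow>
     connection A \<Gamma> \<and>
     (\<forall>C\<in>A. \<forall>x\<in>chart_image C. \<forall>u v w.
        \<Gamma> C x u v = \<Gamma> C x v u \<and>
        frechet_derivative (\<lambda>y. local_metric A g C y u v) (at x) w =
          local_metric A g C x (\<Gamma> C x w u) v + local_metric A g C x u (\<Gamma> C x w v))"

text \<open>
  \<open>R(X, Y) Z = \<nabla>\<^sub>X \<nabla>\<^sub>Y Z - \<nabla>\<^sub>Y \<nabla>\<^sub>X Z - \<nabla>_[X, Y] Z\<close>, evaluated on fields that are constant in the
  chart.
\<close>

definition curvature ::
    "('m, 'a::real_normed_vector) chart set \<Rightarrow>
     (('m, 'a) chart \<Rightarrow> 'a \<Rightarrow> 'a \<Rightarrow> 'a \<Rightarrow> 'a) \<Rightarrow> 'm \<Rightarrow> 'a \<Rightarrow> 'a \<Rightarrow> 'a \<Rightarrow> 'a" where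
  "curvature A \<Gamma> p X Y Z =
     (let C = chart_at A p; x = snd C p in
        frechet_derivative (\<lambda>y. \<Gamma> C y Y Z) (at x) X - frechet_derivative (\<lambda>y. \<Gamma> C y X Z) (at x) Y
        + \<Gamma> C x X (\<Gamma> C x Y Z) - \<Gamma> C x Y (\<Gamma> C x X Z))"

definition curvature_continuous ::
    "('m, 'a::real_normed_vector) chart set \<Rightarrow>
     (('m, 'a) chart \<Rightarrow> 'a \<Rightarrow> 'a \<Rightarrow> 'a \<Rightarrow> 'a) \<Rightarrow> bool" where
  "curvature_continuous A \<Gamma> \<longleftrightarrow>
     (\<forall>p. continuous_on UNIV (\<lambda>(X, Y, Z). curvature A \<Gamma> p X Y Z))"

definition covariant_derivative ::
    "('m, 'a::real_normed_vector) chart set \<Rightarrow>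
     (('m, 'a) chart \<Rightarrow> 'a \<Rightarrow> 'a \<Rightarrow> 'a \<Rightarrow> 'a) \<Rightarrow> ('m \<Rightarrow> 'a) \<Rightarrow> 'm \<Rightarrow> 'a \<Rightarrow> 'a" where
  "covariant_derivative A \<Gamma> \<nu> p X =
     (let C = chart_at A p; x = snd C p in
        frechet_derivative (\<lambda>y. coord A C (chart_inv C y) (\<nu> (chart_inv C y))) (at x) X
        + \<Gamma> C x X (\<nu> p))"

text \<open>
  Derivatives are taken within the parameter interval, so they are one-sided at its end points.
  A vector field along \<open>c\<close> is a function \<open>Z\<close> with \<open>Z t\<close> in the tangent space at \<open>c t\<close>.
\<close>

definition has_velocity ::
    "('m::topological_space, 'a::real_normed_vector) chart set \<Rightarrow> (real \<Rightarrow> 'm) \<Rightarrow> 'a \<Rightarrow> real \<Rightarrow> real set \<Rightarrow> bool" where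
  "has_velocity A c X t I \<longleftrightarrow>
     continuous (at t within I) c \<and>
     ((snd (chart_at A (c t)) \<circ> c) has_vector_derivative X) (at t within I)"

definition velocity ::
    "('m, 'a::real_normed_vector) chart set \<Rightarrow> (real \<Rightarrow> 'm) \<Rightarrow> real set \<Rightarrow> real \<Rightarrow> 'a" where
  "velocity A c I t = vector_derivative (snd (chart_at A (c t)) \<circ> c) (at t within I)"

definition components_along ::
    "('m, 'a::real_normed_vector) chart set \<Rightarrow> ('m, 'a) chart \<Rightarrow> (real \<Rightarrow> 'm) \<Rightarrow>
     (real \<Rightarrow> 'a) \<Rightarrow> real \<Rightarrow> 'a" where
  "components_along A C c Z s = coord A C (c s) (Z s)"

definition field_differentiable_at ::
    "('m, 'a::real_normed_vector) chart set \<Rightarrow> (real \<Rightarrow> 'm) \<Rightarrow> real set \<Rightarrow>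
     (real \<Rightarrow> 'a) \<Rightarrow> real \<Rightarrow> bool" where
  "field_differentiable_at A c I Z t \<longleftrightarrow>
     components_along A (chart_at A (c t)) c Z differentiable (at t within I)"

definition cov_deriv ::
    "('m, 'a::real_normed_vector) chart set \<Rightarrow>
     (('m, 'a) chart \<Rightarrow> 'a \<Rightarrow> 'a \<Rightarrow> 'a \<Rightarrow> 'a) \<Rightarrow> (real \<Rightarrow> 'm) \<Rightarrow> real set \<Rightarrow>
     (real \<Rightarrow> 'a) \<Rightarrow> real \<Rightarrow> 'a" where
  "cov_deriv A \<Gamma> c I Z t =
     (let C = chart_at A (c t) in
        vector_derivative (components_along A C c Z) (at t within I)
        + \<Gamma> C (snd C (c t)) (velocity A c I t) (Z t))"

definition C1_field_along ::
    "('m, 'a::real_normed_vector) chart set \<Rightarrow> (real \<Rightarrow> 'm) \<Rightarrow> real set \<Rightarrow> (real \<Rightarrow> 'a) \<Rightarrow> bool" where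
  "C1_field_along A c I Z \<longleftrightarrow>
     (\<forall>C\<in>A. \<exists>D. continuous_on (I \<inter> c -` fst C) D \<and>
        (\<forall>t\<in>I \<inter> c -` fst C.
           (components_along A C c Z has_vector_derivative D t) (at t within I)))"

text \<open>
  Continuous, and continuously differentiable on the closed intervals of a subdivision.  The
  one-sided derivatives at the subdivision points are included in the condition, so that the
  covariant derivative is bounded, unlike for the library's notion
  \<open>piecewise_C1_differentiable_on\<close>.
\<close>

definition piecewise_differentiable_field ::
    "('m, 'a::real_normed_vector) chart set \<Rightarrow> (real \<Rightarrow> 'm) \<Rightarrow> real \<Rightarrow> (real \<Rightarrow> 'a) \<Rightarrow> bool" where
  "piecewise_differentiable_field A c b Z \<longleftrightarrow>
     (\<exists>(n::nat) s. s 0 = 0 \<and> s n = b \<and>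
        (\<forall>i<n. s i < s (Suc i) \<and> C1_field_along A c {s i .. s (Suc i)} Z))"

definition geodesic ::
    "('m::topological_space, 'a::real_normed_vector) chart set \<Rightarrow>
     (('m, 'a) chart \<Rightarrow> 'a \<Rightarrow> 'a \<Rightarrow> 'a \<Rightarrow> 'a) \<Rightarrow> (real \<Rightarrow> 'm) \<Rightarrow> real \<Rightarrow> bool" where
  "geodesic A \<Gamma> c b \<longleftrightarrow>
     (\<forall>t\<in>{0..b}.
        (\<exists>X. has_velocity A c X t {0..b}) \<and>
        field_differentiable_at A c {0..b} (velocity A c {0..b}) t \<and>
        cov_deriv A \<Gamma> c {0..b} (velocity A c {0..b}) t = 0)"

definition parallel_field ::
    "('m, 'a::real_normed_vector) chart set \<Rightarrow>
     (('m, 'a) chart \<Rightarrow> 'a \<Rightarrow> 'a \<Rightarrow> 'a \<Rightarrow> 'a) \<Rightarrow> (real \<Rightarrow> 'm) \<Rightarrow> real \<Rightarrow> (real \<Rightarrow> 'a) \<Rightarrow> bool" where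
  "parallel_field A \<Gamma> c b Y \<longleftrightarrow>
     (\<forall>t\<in>{0..b}. field_differentiable_at A c {0..b} Y t \<and> cov_deriv A \<Gamma> c {0..b} Y t = 0)"

text \<open>Parallel transport from the tangent space at \<open>c t\<close> to the one at \<open>c s\<close>.\<close>

definition parallel_transport ::
    "('m, 'a::real_normed_vector) chart set \<Rightarrow>
     (('m, 'a) chart \<Rightarrow> 'a \<Rightarrow> 'a \<Rightarrow> 'a \<Rightarrow> 'a) \<Rightarrow> (real \<Rightarrow> 'm) \<Rightarrow> real \<Rightarrow>
     real \<Rightarrow> real \<Rightarrow> 'a \<Rightarrow> 'a" where
  "parallel_transport A \<Gamma> c b t s X =
     (THE V. \<exists>Y. parallel_field A \<Gamma> c b Y \<and> Y t = X \<and> Y s = V)"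

definition jacobi_field ::
    "('m, 'a::real_normed_vector) chart set \<Rightarrow>
     (('m, 'a) chart \<Rightarrow> 'a \<Rightarrow> 'a \<Rightarrow> 'a \<Rightarrow> 'a) \<Rightarrow> (real \<Rightarrow> 'm) \<Rightarrow> real \<Rightarrow> (real \<Rightarrow> 'a) \<Rightarrow> bool" where
  "jacobi_field A \<Gamma> c b J \<longleftrightarrow>
     (let D = cov_deriv A \<Gamma> c {0..b}; dc = velocity A c {0..b} in
        \<forall>t\<in>{0..b}.
          field_differentiable_at A c {0..b} J t \<and>
          field_differentiable_at A c {0..b} (D J) t \<and>
          D (D J) t + curvature A \<Gamma> (c t) (J t) (dc t) (dc t) = 0)"

text \<open>Since the atlas is maximal, submanifold charts can be taken from it.\<close>

definition submanifold :: "('m, 'a::real_normed_vector) chart set \<Rightarrow> 'm set \<Rightarrow> bool" where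
  "submanifold A N \<longleftrightarrow>
     (\<forall>q\<in>N. \<exists>C\<in>A. \<exists>F. q \<in> fst C \<and> subspace F \<and> closed F \<and>
        snd C ` (fst C \<inter> N) = chart_image C \<inter> F)"

definition tangent_sub ::
    "('m::topological_space, 'a::real_normed_vector) chart set \<Rightarrow> 'm set \<Rightarrow> 'm \<Rightarrow> 'a set" where
  "tangent_sub A N p =
     {X. \<exists>\<gamma>. (\<forall>t. \<gamma> t \<in> N) \<and> \<gamma> 0 = p \<and> has_velocity A \<gamma> X 0 UNIV}"

definition normal_sub ::
    "('m::topological_space, 'a::real_normed_vector) chart set \<Rightarrow> ('m \<Rightarrow> 'a \<Rightarrow> 'a \<Rightarrow> real) \<Rightarrow>
     'm set \<Rightarrow> 'm \<Rightarrow> 'a set" where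
  "normal_sub A g N p = {w. \<forall>v\<in>tangent_sub A N p. g p v w = 0}"

definition tangent_proj ::
    "('m::topological_space, 'a::real_normed_vector) chart set \<Rightarrow> ('m \<Rightarrow> 'a \<Rightarrow> 'a \<Rightarrow> real) \<Rightarrow>
     'm set \<Rightarrow> 'm \<Rightarrow> 'a \<Rightarrow> 'a" where
  "tangent_proj A g N p X = (THE v. v \<in> tangent_sub A N p \<and> X - v \<in> normal_sub A g N p)"

definition normal_extension ::
    "('m::topological_space, 'a::real_normed_vector) chart set \<Rightarrow> ('m \<Rightarrow> 'a \<Rightarrow> 'a \<Rightarrow> real) \<Rightarrow>
     'm set \<Rightarrow> 'm \<Rightarrow> 'a \<Rightarrow> ('m \<Rightarrow> 'a) \<Rightarrow> bool" where
  "normal_extension A g N p \<xi> \<nu> \<longleftrightarrow>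
     \<nu> p = \<xi> \<and>
     (\<exists>W. open W \<and> p \<in> W \<and> smooth_vector_field_on A W \<nu> \<and>
        (\<forall>q\<in>N \<inter> W. \<nu> q \<in> normal_sub A g N q))"

text \<open>
  \<open>A\<^sub>\<xi>(X)\<close> for \<open>X\<close> tangent to \<open>N\<close> does not depend on the extension of \<open>\<xi>\<close>, but for a weak metric
  an extension need not exist.
\<close>

definition weingarten ::
    "('m::topological_space, 'a::real_normed_vector) chart set \<Rightarrow> ('m \<Rightarrow> 'a \<Rightarrow> 'a \<Rightarrow> real) \<Rightarrow>
     (('m, 'a) chart \<Rightarrow> 'a \<Rightarrow> 'a \<Rightarrow> 'a \<Rightarrow> 'a) \<Rightarrow> 'm set \<Rightarrow> 'm \<Rightarrow> 'a \<Rightarrow> 'a \<Rightarrow> 'a" where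
  "weingarten A g \<Gamma> N p \<xi> X =
     (THE V. \<exists>\<nu>. normal_extension A g N p \<xi> \<nu> \<and>
                 V = - tangent_proj A g N p (covariant_derivative A \<Gamma> \<nu> p X))"

definition N_jacobi_field ::
    "('m::topological_space, 'a::real_normed_vector) chart set \<Rightarrow> ('m \<Rightarrow> 'a \<Rightarrow> 'a \<Rightarrow> real) \<Rightarrow>
     (('m, 'a) chart \<Rightarrow> 'a \<Rightarrow> 'a \<Rightarrow> 'a \<Rightarrow> 'a) \<Rightarrow> 'm set \<Rightarrow> (real \<Rightarrow> 'm) \<Rightarrow> real \<Rightarrow>
     (real \<Rightarrow> 'a) \<Rightarrow> bool" where
  "N_jacobi_field A g \<Gamma> N c b J \<longleftrightarrow>
     jacobi_field A \<Gamma> c b J \<and>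
     J 0 \<in> tangent_sub A N (c 0) \<and>
     cov_deriv A \<Gamma> c {0..b} J 0 + weingarten A g \<Gamma> N (c 0) (velocity A c {0..b} 0) (J 0)
       \<in> normal_sub A g N (c 0)"

definition jacobi_operator ::
    "('m, 'a::real_normed_vector) chart set \<Rightarrow>
     (('m, 'a) chart \<Rightarrow> 'a \<Rightarrow> 'a \<Rightarrow> 'a \<Rightarrow> 'a) \<Rightarrow> (real \<Rightarrow> 'm) \<Rightarrow> real \<Rightarrow> real \<Rightarrow> 'a \<Rightarrow> 'a" where
  "jacobi_operator A \<Gamma> c b t X =
     parallel_transport A \<Gamma> c b t 0
       (curvature A \<Gamma> (c t) (parallel_transport A \<Gamma> c b 0 t X)
          (velocity A c {0..b} t) (velocity A c {0..b} t))"

definition jacobi_flow ::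
    "('m::topological_space, 'a::real_normed_vector) chart set \<Rightarrow> ('m \<Rightarrow> 'a \<Rightarrow> 'a \<Rightarrow> real) \<Rightarrow>
     (('m, 'a) chart \<Rightarrow> 'a \<Rightarrow> 'a \<Rightarrow> 'a \<Rightarrow> 'a) \<Rightarrow> 'm set \<Rightarrow> (real \<Rightarrow> 'm) \<Rightarrow> real \<Rightarrow>
     (real \<Rightarrow> 'a \<Rightarrow>\<^sub>L 'a) \<Rightarrow> bool" where
  "jacobi_flow A g \<Gamma> N c b T \<longleftrightarrow>
     (\<exists>T' T''.
        (\<forall>t\<in>{0..b}.
           (T has_vector_derivative T' t) (at t within {0..b}) \<and>
           (T' has_vector_derivative T'' t) (at t within {0..b}) \<and>
           (\<forall>X. blinfun_apply (T'' t) X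
                + jacobi_operator A \<Gamma> c b t (blinfun_apply (T t) X) = 0)) \<and>
        (\<forall>v\<in>tangent_sub A N (c 0). \<forall>w\<in>normal_sub A g N (c 0).
           blinfun_apply (T 0) (v + w) = v \<and>
           blinfun_apply (T' 0) (v + w) =
             - weingarten A g \<Gamma> N (c 0) (velocity A c {0..b} 0) v + w))"

definition monofocal :: "(real \<Rightarrow> 'a::real_normed_vector \<Rightarrow>\<^sub>L 'a) \<Rightarrow> real \<Rightarrow> bool" where
  "monofocal T t \<longleftrightarrow> \<not> inj (blinfun_apply (T t))"

definition epifocal :: "(real \<Rightarrow> 'a::real_normed_vector \<Rightarrow>\<^sub>L 'a) \<Rightarrow> real \<Rightarrow> bool" where
  "epifocal T t \<longleftrightarrow> \<not> surj (blinfun_apply (T t))"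

definition pathological :: "(real \<Rightarrow> 'a::real_normed_vector \<Rightarrow>\<^sub>L 'a) \<Rightarrow> real \<Rightarrow> bool" where
  "pathological T t \<longleftrightarrow> epifocal T t \<and> \<not> monofocal T t"

definition index_form ::
    "('m::topological_space, 'a::real_normed_vector) chart set \<Rightarrow> ('m \<Rightarrow> 'a \<Rightarrow> 'a \<Rightarrow> real) \<Rightarrow>
     (('m, 'a) chart \<Rightarrow> 'a \<Rightarrow> 'a \<Rightarrow> 'a \<Rightarrow> 'a) \<Rightarrow> 'm set \<Rightarrow> (real \<Rightarrow> 'm) \<Rightarrow> real \<Rightarrow>
     (real \<Rightarrow> 'a) \<Rightarrow> real" where
  "index_form A g \<Gamma> N c b Z =
     (let D = cov_deriv A \<Gamma> c {0..b}; dc = velocity A c {0..b} in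
        integral {0..b} (\<lambda>t. g (c t) (D Z t) (D Z t)
                              - g (c t) (curvature A \<Gamma> (c t) (Z t) (dc t) (dc t)) (Z t))
        - g (c 0) (weingarten A g \<Gamma> N (c 0) (dc 0) (Z 0)) (Z 0))"

end

theory Submission
  imports Defs
begin

text \<open>
  Parallel transport along \<open>c\<close> turns fields into paths in the fixed space \<open>T_pM\<close>.  Since \<open>J\<close> is an
  \<open>N\<close>-Jacobi field, it is orthogonal to \<open>W = Z - J\<close> for the index form, so that it remains to see that
  the index form is nonnegative at \<open>W\<close>, which vanishes at \<open>b\<close>.  This follows from the inequality
  \<open>I[s,t](W) \<ge> \<langle>T'(t)Y, T(t)Y\<rangle> - \<langle>T'(s)X, T(s)X\<rangle>\<close> for all paths \<open>W\<close> on \<open>[s,t]\<close> with end points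
  \<open>W(s) = T(s)X\<close> and \<open>W(t) = T(t)Y\<close>.  Near a time where \<open>T\<close> is invertible it is a Poincare inequality,
  as the symmetric operators \<open>T' T^(-1)\<close> and \<open>R\<close>, bounded for the Hilbert topology, are by a theorem of
  Lax also bounded for the weak norm.  Two such inequalities compose at an intermediate time \<open>m\<close> as soon
  as \<open>T(m)\<close> has a dense range, and the inequality is stable under limits of the end points.  The latter
  gives access to the pathological points, to \<open>b\<close>, where \<open>T(b)\<close> may be arbitrary, and to \<open>0\<close>, where the
  boundary term is \<open>-\<langle>A_\<xi> W(0), W(0)\<rangle>\<close>.
\<close>

section \<open>Baire category and weak inner products\<close>

text \<open>The classical proof writes a field as \<open>T r (X r)\<close> and completes a square,
  which needs every value in the range of \<open>T r\<close>; at a pathological point this may fail.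
  So the inequality prescribes only the two end values, and to pass through such a point one
  corrects the single value \<open>W m\<close> by a field \<open>f r *\<^sub>R E\<close>. Density
  makes \<open>E\<close> small in the weak norm, perhaps not in the Hilbert norm, so the energy has
  to be continuous for this weak size: this is why the mixed term is integrated by parts until
  \<open>W'\<close> disappears from it, and why the curvature operators must be bounded for the weak
  norm. The same correction at the end points gives the stability under limits. Tangent vectors are
  principal parts in charts that change arbitrarily from point to point, and smoothness is given one
  direction at a time. Most operator families are therefore handled as strongly continuous and
  locally bounded ones, and Baire category supplies the local bounds.\<close>

lemma absorbing_closed_sequence:
  fixes S :: "nat \<Rightarrow> 'a::{real_normed_vector, complete_space} set"
  assumes cl: "\<And>n. closed (S n)" and un: "(\<Union>n. S n) = UNIV"
  obtains n x r where "0 < r" "ball x r \<subseteq> S n"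
proof -
  have "\<exists>n. interior (S n) \<noteq> {}"
  proof (rule ccontr)
    assume "\<not> ?thesis"
    then have "Met_TC.mtopology interior_of \<Union>(range S) = {}"
      by (intro Met_TC.metric_Baire_category_alt)
         (auto simp: cl complete_UNIV)
    then show False using un by simp
  qed
  then obtain n x where "x \<in> interior (S n)" by blast
  then show thesis using that by (meson mem_interior)
qed

text \<open>Banach-Steinhaus. It converts the strong continuity of the curvature operators, and the
  continuity of Frechet derivatives in each fixed direction, into locally uniform operator
  bounds.\<close>

lemma uniform_boundedness:
  fixes \<F> :: "('a::{real_normed_vector, complete_space} \<Rightarrow> 'b::real_normed_vector) set"
  assumes lin: "\<And>f. f \<in> \<F> \<Longrightarrow> bounded_linear f"
    and pt: "\<And>x. \<exists>K. \<forall>f\<in>\<F>. norm (f x) \<le> K"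
  obtains K where "0 \<le> K" "\<And>f x. f \<in> \<F> \<Longrightarrow> norm (f x) \<le> K * norm x"
proof -
  define S where "S n = (\<Inter>f\<in>\<F>. {x. norm (f x) \<le> real n})" for n
  have cl: "closed (S n)" for n
    unfolding S_def
    by (intro closed_INT ballI closed_Collect_le continuous_on_norm continuous_on_const
        linear_continuous_on lin)
  have "\<exists>n. x \<in> S n" for x
  proof -
    obtain K where K: "\<forall>f\<in>\<F>. norm (f x) \<le> K" using pt by blast
    obtain n where "K \<le> real n" using real_arch_simple by blast
    then show ?thesis using K by (auto simp: S_def intro: order_trans)
  qed
  then have "(\<Union>n. S n) = UNIV" by blast
  from absorbing_closed_sequence[OF cl this]
  obtain n x r where r: "0 < r" "ball x r \<subseteq> S n" .
  have bd: "norm (f y) \<le> (4 * n / r) * norm y" if f: "f \<in> \<F>" for f y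
  proof (cases "y = 0")
    case True
    interpret bounded_linear f by (rule lin[OF f])
    show ?thesis using True by (simp add: zero)
  next
    case False
    interpret bounded_linear f by (rule lin[OF f])
    \<comment> \<open>\<open>z\<close> has norm \<open>r / 2\<close>, so \<open>x\<close> and
      \<open>x + z\<close> both lie in the ball inside \<open>S n\<close>. Bounding
      \<open>f z\<close> as a difference gives \<open>2 * n\<close>, whence the constant
      \<open>4 * n / r\<close>.\<close>
    define z where "z = (r / (2 * norm y)) *\<^sub>R y"
    have "norm z = r / 2" using False r by (simp add: z_def)
    then have "x + z \<in> ball x r" "x \<in> ball x r" using r by (auto simp: dist_norm)
    then have "x + z \<in> S n" "x \<in> S n" using r by blast+
    then have "norm (f (x + z)) \<le> n" "norm (f x) \<le> n"
      using f by (auto simp: S_def)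
    then have "norm (f z) \<le> 2 * n"
      using norm_triangle_ineq4[of "f (x + z)" "f x"] by (simp add: add)
    moreover have "f z = (r / (2 * norm y)) *\<^sub>R f y" by (simp add: z_def scaleR)
    ultimately have "r / (2 * norm y) * norm (f y) \<le> 2 * n" using r by simp
    then show ?thesis using r False by (simp add: field_simps)
  qed
  show thesis by (rule that[of "4 * n / r"]) (use r bd in auto)
qed

text \<open>The bounded inverse theorem as a lower bound for \<open>norm (f x)\<close>, a form that
  survives small perturbations in operator norm; it is later applied to \<open>T s0\<close>.\<close>

lemma bounded_inverse:
  fixes f :: "'a::{real_normed_vector, complete_space} \<Rightarrow> 'b::{real_normed_vector, complete_space}"
  assumes lin: "bounded_linear f" and "bij f"
  obtains m where "0 < m" "\<And>x. m * norm x \<le> norm (f x)"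
proof -
  interpret bounded_linear f by (rule lin)
  define S where "S n = closure (f ` cball 0 (real n))" for n
  have "\<exists>n. y \<in> S n" for y
  proof -
    obtain x where "y = f x" using \<open>bij f\<close> by (metis bij_pointE)
    moreover obtain n where "norm x \<le> real n" using real_arch_simple by blast
    ultimately show ?thesis unfolding S_def using closure_subset by fastforce
  qed
  then have "(\<Union>n. S n) = UNIV" by blast
  moreover have "closed (S n)" for n by (simp add: S_def)
  ultimately obtain n y r where r: "0 < r" "ball y r \<subseteq> S n"
    using absorbing_closed_sequence[of S] by metis
  \<comment> \<open>Vectors of norm \<open>r / 2\<close> are approximated within
    \<open>r / 4\<close> by images of differences of norm at most \<open>2 * n\<close>. Rescaling
    gives \<open>4 * n / r\<close>, and the \<open>+ 1\<close> keeps \<open>a\<close> positive when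
    \<open>n = 0\<close>.\<close>
  define a where "a = 4 * (real n + 1) / r"
  have a0: "a > 0" using r by (simp add: a_def)
  have approx: "\<exists>x. norm x \<le> a * norm z \<and> norm (z - f x) \<le> norm z / 2" for z
  proof (cases "z = 0")
    case True then show ?thesis by (intro exI[of _ 0]) (simp add: zero)
  next
    case False
    define w where "w = (r / (2 * norm z)) *\<^sub>R z"
    have nw: "norm w = r / 2" using False r by (simp add: w_def)
    then have "y + w \<in> S n" "y \<in> S n" using r by (auto simp: dist_norm subset_iff)
    then obtain u v where uv: "norm u \<le> n" "norm v \<le> n"
        "dist (f u) (y + w) < r/8" "dist (f v) y < r/8"
      unfolding S_def closure_approachable using r
    proof -
      have r8: "0 < r/8" using r by simp
      obtain p where p: "p \<in> f ` cball 0 (real n)" "dist p (y + w) < r/8"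
        using \<open>y + w \<in> S n\<close> r8 unfolding S_def closure_approachable by blast
      obtain p' where p': "p' \<in> f ` cball 0 (real n)" "dist p' y < r/8"
        using \<open>y \<in> S n\<close> r8 unfolding S_def closure_approachable by blast
      show ?thesis using p p' that by auto
    qed
    have "norm (w - f (u - v)) \<le> norm (f u - (y + w)) + norm (f v - y)"
      using norm_triangle_ineq4[of "f v - y" "f u - (y + w)"] by (simp add: diff algebra_simps)
    also have "\<dots> \<le> r / 4" using uv by (simp add: dist_norm)
    finally have 1: "norm (w - f (u - v)) \<le> r/4" .
    define x where "x = (2 * norm z / r) *\<^sub>R (u - v)"
    have zw: "z = (2 * norm z / r) *\<^sub>R w" using r False by (simp add: w_def)
    have "z - f x = (2 * norm z / r) *\<^sub>R (w - f (u - v))"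
      by (subst (1) zw) (simp only: x_def scaleR scaleR_diff_right[of "2 * norm z / r" w])
    then have "norm (z - f x) = (2 * norm z / r) * norm (w - f (u - v))" using r by simp
    also have "\<dots> \<le> (2 * norm z / r) * (r/4)" using 1 r by (intro mult_left_mono) auto
    finally have "norm (z - f x) \<le> norm z / 2" using r by simp
    moreover have "norm x \<le> a * norm z"
    proof -
      have "norm (u - v) \<le> 2 * n" using uv norm_triangle_ineq4[of u v] by simp
      then have "norm x \<le> (2 * norm z / r) * (2 * n)"
        unfolding x_def norm_scaleR using r by (intro mult_mono) auto
      also have "\<dots> \<le> a * norm z" using r by (simp add: a_def field_simps)
      finally show ?thesis .
    qed
    ultimately show ?thesis by blast
  qed
  then obtain q where q: "\<And>z. norm (q z) \<le> a * norm z" "\<And>z. norm (z - f (q z)) \<le> norm z / 2"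
    by metis
  have main: "norm x \<le> 2 * a * norm (f x)" for x
  proof -
    \<comment> \<open>Successive approximation: the residual \<open>z k\<close> halves at each step,
      the corrections \<open>q (z i)\<close> sum to some \<open>l\<close> with
      \<open>f l = f x\<close>, and injectivity gives \<open>l = x\<close>. The geometric series
      accounts for the factor 2.\<close>
    define z where "z = rec_nat (f x) (\<lambda>_ z. z - f (q z))"
    define s where "s k = (\<Sum>i<k. q (z i))" for k
    have z0: "z 0 = f x" and zS: "\<And>k. z (Suc k) = z k - f (q (z k))" by (auto simp: z_def)
    have nz: "norm (z k) \<le> norm (f x) * (1/2)^k" for k
    proof (induction k)
      case (Suc k)
      have "norm (z (Suc k)) \<le> norm (z k) / 2" using q(2) by (simp add: zS)
      then show ?case using Suc by simp
    qed (simp add: z0)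
    have fs: "f (s k) = f x - z k" for k
      by (induction k) (auto simp: s_def z0 zS zero add)
    have nq: "norm (q (z k)) \<le> a * norm (f x) * (1/2)^k" for k
      using order_trans[OF q(1) mult_left_mono[OF nz]] a0 by (simp add: mult.assoc)
    have sm: "summable (\<lambda>k. a * norm (f x) * (1/2::real)^k)"
      by (intro summable_mult summable_geometric) auto
    have geo: "(\<Sum>k. a * norm (f x) * (1/2::real)^k) = 2 * a * norm (f x)"
      by (subst suminf_mult) (auto simp: suminf_geometric summable_geometric)
    have dif: "norm (s k - s j) \<le> (\<Sum>i\<in>{j..<k}. a * norm (f x) * (1/2)^i)" if "j \<le> k" for j k
    proof -
      have "s k - s j = (\<Sum>i\<in>{j..<k}. q (z i))"
        unfolding s_def using that by (simp add: sum_diff_nat_ivl lessThan_atLeast0)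
      then show ?thesis using sum_norm_le[OF nq] by simp
    qed
    have "Cauchy s"
    proof (rule metric_CauchyI)
      fix e :: real assume "0 < e"
      have "Cauchy (\<lambda>k. \<Sum>i<k. a * norm (f x) * (1/2::real)^i)"
        using sm unfolding summable_iff_convergent by (rule convergent_Cauchy)
      then obtain M where M: "\<And>m n. m \<ge> M \<Longrightarrow> n \<ge> M \<Longrightarrow>
          dist (\<Sum>i<m. a * norm (f x) * (1/2::real)^i) (\<Sum>i<n. a * norm (f x) * (1/2::real)^i) < e"
        using \<open>0 < e\<close> unfolding Cauchy_def by blast
      have *: "dist (s k) (s j) < e" if "M \<le> j" "j \<le> k" for j k
      proof -
        have "norm (s k - s j) \<le> (\<Sum>i<k. a * norm (f x) * (1/2)^i) - (\<Sum>i<j. a * norm (f x) * (1/2)^i)"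
          using dif[OF that(2)] that by (simp add: sum_diff_nat_ivl lessThan_atLeast0)
        also have "\<dots> < e" using M[of k j] that by (simp add: dist_real_def)
        finally show ?thesis by (simp add: dist_norm)
      qed
      show "\<exists>M. \<forall>m\<ge>M. \<forall>n\<ge>M. dist (s m) (s n) < e"
        by (rule exI[of _ M]) (metis * dist_commute nle_le)
    qed
    then obtain l where l: "s \<longlonglongrightarrow> l" using Cauchy_convergent convergent_def by blast
    have "z \<longlonglongrightarrow> 0"
    proof (rule Lim_null_comparison)
      show "\<forall>\<^sub>F k in sequentially. norm (z k) \<le> norm (f x) * (1/2)^k" using nz by simp
      show "(\<lambda>k. norm (f x) * (1/2)^k) \<longlonglongrightarrow> 0" by (intro tendsto_mult_right_zero LIMSEQ_realpow_zero) auto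
    qed
    then have "(\<lambda>k. f (s k)) \<longlonglongrightarrow> f x" unfolding fs using tendsto_diff[OF tendsto_const, of z 0] by simp
    moreover have "(\<lambda>k. f (s k)) \<longlonglongrightarrow> f l" using l by (rule tendsto)
    ultimately have "f l = f x" using LIMSEQ_unique by blast
    then have "l = x" using \<open>bij f\<close> by (metis bij_pointE)
    have "norm (s k) \<le> 2 * a * norm (f x)" for k
    proof -
      have "norm (s k) \<le> (\<Sum>i<k. a * norm (f x) * (1/2)^i)"
        using dif[of 0 k] by (simp add: s_def lessThan_atLeast0)
      also have "\<dots> \<le> (\<Sum>i. a * norm (f x) * (1/2)^i)"
        using a0 by (intro sum_le_suminf sm) auto
      finally show ?thesis using geo by simp
    qed
    then show ?thesis using l \<open>l = x\<close> by (metis LIMSEQ_le_const2 tendsto_norm)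
  qed
  show thesis
  proof (rule that[of "1 / (2 * a)"])
    show "0 < 1 / (2 * a)" using a0 by simp
    show "1 / (2 * a) * norm x \<le> norm (f x)" for x using main[of x] a0 by (simp add: field_simps)
  qed
qed

section \<open>Bounded positive definite forms and Lax's theorem\<close>

locale weak_inner = bounded_bilinear B
  for B :: "'a::real_normed_vector \<Rightarrow> 'a \<Rightarrow> real" +
  assumes sym: "B x y = B y x"
    and posdef: "x \<noteq> 0 \<Longrightarrow> 0 < B x x"
begin

lemma nonneg: "0 \<le> B x x"
  using posdef[of x] by (cases "x = 0") (auto simp: zero_left)

lemma eq_zero: "B x x = 0 \<Longrightarrow> x = 0"
  using posdef[of x] by fastforce

lemma cauchy_schwarz: "(B x y)\<^sup>2 \<le> B x x * B y y"
proof (cases "y = 0")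
  case False
  have y: "0 < B y y" using posdef False by blast
  define t where "t = B x y / B y y"
  have "0 \<le> B (x - t *\<^sub>R y) (x - t *\<^sub>R y)" by (rule nonneg)
  also have "\<dots> = B x x - 2 * t * B x y + t * t * B y y"
    by (simp add: diff_left diff_right scaleR_left scaleR_right sym[of y x] algebra_simps)
  also have "\<dots> = B x x - (B x y)\<^sup>2 / B y y"
    using y by (simp add: t_def power2_eq_square field_simps)
  finally show ?thesis using y by (simp add: field_simps)
qed (simp add: zero_right)

lemma abs_le: "\<bar>B x y\<bar> \<le> sqrt (B x x) * sqrt (B y y)"
  using cauchy_schwarz[of x y] by (metis real_sqrt_abs real_sqrt_le_iff real_sqrt_mult)

lemma young: "0 < l \<Longrightarrow> 2 * \<bar>B x y\<bar> \<le> l * B x x + B y y / l"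
proof -
  assume l: "0 < l"
  have "0 \<le> B (l *\<^sub>R x - y) (l *\<^sub>R x - y)" "0 \<le> B (l *\<^sub>R x + y) (l *\<^sub>R x + y)"
    by (rule nonneg)+
  then have "2 * l * \<bar>B x y\<bar> \<le> l * l * B x x + B y y"
    by (simp add: diff_left diff_right add_left add_right scaleR_left scaleR_right sym[of y x]
        algebra_simps abs_if)
  then show ?thesis using l by (simp add: field_simps)
qed

text \<open>Lax's argument: \<open>n \<mapsto> B (R^n x) (R^n x)\<close> is log-convex and grows at most like \<open>K^(2n)\<close>, so its
  first ratio is at most \<open>K^2\<close>.\<close>

lemma lax_bound:
  assumes lin: "bounded_linear R" and symR: "\<And>x y. B (R x) y = B x (R y)"
    and bd: "\<And>x. norm (R x) \<le> K * norm x"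
  shows "B (R x) (R x) \<le> K\<^sup>2 * B x x"
proof -
  interpret R: bounded_linear R by (rule lin)
  define q where "q n = B ((R^^n) x) ((R^^n) x)" for n
  show ?thesis
  proof (cases "x = 0 \<or> R x = 0")
    case True then show ?thesis using nonneg[of x] by (auto simp: R.zero zero_left)
  next
    case False
    have K: "0 < K"
    proof -
      have "0 < norm (R x)" using False by simp
      also have "\<dots> \<le> K * norm x" by (rule bd)
      finally show ?thesis by (simp add: zero_less_mult_iff)
    qed
    obtain \<beta> where \<beta>: "0 < \<beta>" "\<And>a b. norm (B a b) \<le> norm a * norm b * \<beta>"
      using pos_bounded by blast
    have q0: "0 < q 0" using False posdef by (simp add: q_def)
    define \<rho> where "\<rho> = q 1 / q 0"
    have q1: "0 < q 1" using False posdef by (simp add: q_def)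
    have \<rho>: "0 < \<rho>" using q0 q1 by (simp add: \<rho>_def)
    have qnn: "0 \<le> q n" for n by (simp add: q_def nonneg)
    have lc: "(q (Suc n))\<^sup>2 \<le> q n * q (Suc (Suc n))" for n
    proof -
      have "q (Suc n) = B ((R^^n) x) ((R^^(Suc (Suc n))) x)" by (simp add: q_def symR)
      then show ?thesis unfolding q_def using cauchy_schwarz by metis
    qed
    have pos: "0 < q n \<and> \<rho> * q n \<le> q (Suc n)" for n
    proof (induction n)
      case 0 then show ?case using q0 by (simp add: \<rho>_def)
    next
      case (Suc n)
      have p: "0 < q (Suc n)" using Suc \<rho> by (smt (verit) mult_pos_pos)
      have "\<rho> * q (Suc n) * q n \<le> (q (Suc n))\<^sup>2"
        using Suc p by (simp add: power2_eq_square mult_mono)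
      also have "\<dots> \<le> q n * q (Suc (Suc n))" by (rule lc)
      finally have "\<rho> * q (Suc n) \<le> q (Suc (Suc n))" using Suc by simp
      then show ?case using p by blast
    qed
    have lower: "\<rho>^n * q 0 \<le> q n" for n
    proof (induction n)
      case (Suc n)
      have "\<rho>^(Suc n) * q 0 \<le> \<rho> * q n" using Suc \<rho> by (simp add: mult.assoc)
      then show ?case using pos[of n] by linarith
    qed simp
    have itn: "norm ((R^^n) x) \<le> K^n * norm x" for n
    proof (induction n)
      case (Suc n)
      have "norm ((R^^(Suc n)) x) \<le> K * norm ((R^^n) x)" using bd by simp
      also have "\<dots> \<le> K * (K^n * norm x)" using Suc K by (intro mult_left_mono) auto
      finally show ?case by (simp add: mult.assoc)
    qed simp
    have upper: "q n \<le> \<beta> * (norm x)\<^sup>2 * (K\<^sup>2)^n" for n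
    proof -
      have "q n \<le> norm ((R^^n) x) * norm ((R^^n) x) * \<beta>"
        using \<beta>(2)[of "(R^^n) x" "(R^^n) x"] by (simp add: q_def)
      also have "\<dots> \<le> (K^n * norm x) * (K^n * norm x) * \<beta>"
        using itn \<beta>(1) K by (intro mult_right_mono mult_mono) auto
      finally show ?thesis by (simp add: power2_eq_square power_mult_distrib algebra_simps)
    qed
    have "\<rho> \<le> K\<^sup>2"
    proof (rule ccontr)
      assume "\<not> \<rho> \<le> K\<^sup>2"
      then have r: "1 < \<rho> / K\<^sup>2" using K by (simp add: field_simps)
      obtain n where n: "\<beta> * (norm x)\<^sup>2 / q 0 < (\<rho> / K\<^sup>2)^n"
        using real_arch_pow[OF r] by blast
      have "\<beta> * (norm x)\<^sup>2 * (K\<^sup>2)^n < \<rho>^n * q 0"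
        using n q0 K by (simp add: power_divide field_simps)
      then show False using lower[of n] upper[of n] by linarith
    qed
    then show ?thesis using q0 by (simp add: \<rho>_def q_def field_simps)
  qed
qed

text \<open>\<open>lax_bound\<close> controls \<open>R x\<close> in the weak norm, and
  Cauchy-Schwarz turns this into the quadratic form bound by which both the curvature term and the
  boundary term are estimated.\<close>

lemma lax_form_bound:
  assumes "bounded_linear R" and "\<And>x y. B (R x) y = B x (R y)"
    and "\<And>x. norm (R x) \<le> K * norm x" and "0 \<le> K"
  shows "\<bar>B (R x) x\<bar> \<le> K * B x x"
proof -
  have "(B (R x) x)\<^sup>2 \<le> B (R x) (R x) * B x x" by (rule cauchy_schwarz)
  also have "\<dots> \<le> K\<^sup>2 * B x x * B x x"
    using lax_bound[OF assms(1-3)] nonneg by (intro mult_right_mono) auto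
  finally have "(B (R x) x)\<^sup>2 \<le> (K * B x x)\<^sup>2" by (simp add: power2_eq_square algebra_simps)
  then show ?thesis using assms(4) nonneg[of x] by (metis abs_le_square_iff abs_of_nonneg mult_nonneg_nonneg)
qed

end

text \<open>Strong convergence suffices when the operators are eventually bounded by one constant:
  split \<open>A s (y s)\<close> as \<open>A s (y s - w) + A s w\<close>.\<close>

lemma tendsto_apply_family:
  fixes A :: "'i \<Rightarrow> 'a::real_normed_vector \<Rightarrow> 'b::real_normed_vector"
  assumes lin: "\<forall>\<^sub>F s in F. linear (A s) \<and> (\<forall>v. norm (A s v) \<le> K * norm v)"
    and A: "((\<lambda>s. A s w) \<longlongrightarrow> L) F" and y: "(y \<longlongrightarrow> w) F"
  shows "((\<lambda>s. A s (y s)) \<longlongrightarrow> L) F"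
proof -
  have "((\<lambda>s. A s (y s - w)) \<longlongrightarrow> 0) F"
  proof (rule Lim_null_comparison)
    show "\<forall>\<^sub>F s in F. norm (A s (y s - w)) \<le> K * norm (y s - w)"
      using lin by eventually_elim blast
    show "((\<lambda>s. K * norm (y s - w)) \<longlongrightarrow> 0) F"
      using y by (intro tendsto_mult_right_zero tendsto_norm_zero) (simp add: LIM_zero)
  qed
  from tendsto_add[OF this A] have "((\<lambda>s. A s (y s - w) + A s w) \<longlongrightarrow> L) F" by simp
  then show ?thesis
    by (rule Lim_transform_eventually)
       (use lin in \<open>eventually_elim, simp add: linear_diff\<close>)
qed

text \<open>Stating the derivative as a limit allows functions that agree only eventually, such as
  components of a field inside the domain of a chart, to be exchanged, also for one-sided
  derivatives.\<close>

lemma has_vector_derivative_iff_quotient: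
  "(f has_vector_derivative f') (at t within I) \<longleftrightarrow>
   ((\<lambda>s. (f s - f t) /\<^sub>R (s - t)) \<longlongrightarrow> f') (at t within I)"
proof -
  have "(f has_vector_derivative f') (at t within I) \<longleftrightarrow>
    ((\<lambda>s. norm (f s - f t - (s - t) *\<^sub>R f') / norm (s - t)) \<longlongrightarrow> 0) (at t within I)"
    unfolding has_vector_derivative_def has_derivative_iff_norm
    by (simp add: bounded_linear_scaleR_left)
  also have "\<dots> \<longleftrightarrow> ((\<lambda>s. norm ((f s - f t) /\<^sub>R (s - t) - f')) \<longlongrightarrow> 0) (at t within I)"
  proof (rule filterlim_cong[OF refl refl])
    have "norm (f s - f t - (s - t) *\<^sub>R f') / norm (s - t) = norm ((f s - f t) /\<^sub>R (s - t) - f')"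
      if "s \<noteq> t" for s
    proof -
      have "(f s - f t) /\<^sub>R (s - t) - f' = (f s - f t - (s - t) *\<^sub>R f') /\<^sub>R (s - t)"
        using that by (simp add: scaleR_diff_right)
      then show ?thesis by (simp add: divide_inverse mult.commute)
    qed
    then show "\<forall>\<^sub>F s in at t within I. norm (f s - f t - (s - t) *\<^sub>R f') / norm (s - t)
        = norm ((f s - f t) /\<^sub>R (s - t) - f')"
      by (auto simp: eventually_at_filter)
  qed
  also have "\<dots> \<longleftrightarrow> ((\<lambda>s. (f s - f t) /\<^sub>R (s - t)) \<longlongrightarrow> f') (at t within I)"
    by (simp add: tendsto_norm_zero_iff LIM_zero_iff)
  finally show ?thesis .
qed

text \<open>Product rule for operators known only strongly: the increment is
  \<open>(A s (y t) - A t (y t)) + A s (y s - y t)\<close>, so \<open>A\<close> has to be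
  differentiable on the single vector \<open>y t\<close>.\<close>

lemma has_vector_derivative_apply_family:
  fixes A :: "real \<Rightarrow> 'a::real_normed_vector \<Rightarrow> 'b::real_normed_vector"
  assumes lin: "\<forall>\<^sub>F s in at t within I. linear (A s) \<and> (\<forall>v. norm (A s v) \<le> K * norm v)"
    and A: "\<And>v. ((\<lambda>s. A s v) \<longlongrightarrow> A t v) (at t within I)"
    and a: "((\<lambda>s. A s (y t)) has_vector_derivative a) (at t within I)"
    and y: "(y has_vector_derivative y') (at t within I)"
  shows "((\<lambda>s. A s (y s)) has_vector_derivative (a + A t y')) (at t within I)"
proof -
  have "((\<lambda>s. A s ((y s - y t) /\<^sub>R (s - t))) \<longlongrightarrow> A t y') (at t within I)"
    by (rule tendsto_apply_family[OF lin A]) (use y in \<open>simp add: has_vector_derivative_iff_quotient\<close>)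
  from tendsto_add[OF a[unfolded has_vector_derivative_iff_quotient] this]
  show ?thesis unfolding has_vector_derivative_iff_quotient
    by (rule Lim_transform_eventually)
       (use lin in \<open>eventually_elim, simp add: linear_diff linear_cmul scaleR_diff_right\<close>)
qed

text \<open>Smoothness provides continuity of the derivative in each direction only. Without a bound
  near \<open>x\<close> there would be points \<open>y n\<close> tending to \<open>x\<close> whose
  derivatives have unbounded norms, although these derivatives converge on every vector; this
  contradicts Banach-Steinhaus.\<close>

lemma frechet_derivative_locally_bounded:
  fixes f :: "'a::{real_normed_vector, complete_space} \<Rightarrow> 'b::real_normed_vector"
  assumes "open S" "x \<in> S" and dif: "\<And>y. y \<in> S \<Longrightarrow> f differentiable (at y)"
    and cont: "\<And>v. continuous_on S (\<lambda>y. frechet_derivative f (at y) v)"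
  shows "\<exists>\<delta>>0. \<exists>K. ball x \<delta> \<subseteq> S \<and>
    (\<forall>y\<in>ball x \<delta>. \<forall>v. norm (frechet_derivative f (at y) v) \<le> K * norm v)"
proof (rule ccontr)
  assume no: "\<not> ?thesis"
  obtain r where r: "0 < r" "ball x r \<subseteq> S" using assms openE by blast
  have "\<exists>y v. y \<in> ball x (min r (1 / real (Suc n))) \<and>
      real n * norm v < norm (frechet_derivative f (at y) v)" for n
  proof (rule ccontr)
    assume "\<not> ?thesis"
    then have "norm (frechet_derivative f (at y) v) \<le> real n * norm v"
      if "y \<in> ball x (min r (1 / real (Suc n)))" for y v using that by (meson not_le)
    moreover have "0 < min r (1 / real (Suc n))" "ball x (min r (1 / real (Suc n))) \<subseteq> S"
      using r by (auto simp: subset_iff)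
    ultimately show False using no by blast
  qed
  then obtain y v where yv: "\<And>n. y n \<in> ball x (min r (1 / real (Suc n)))"
    "\<And>n. real n * norm (v n) < norm (frechet_derivative f (at (y n)) (v n))" by metis
  have yS: "y n \<in> S" for n using yv(1)[of n] r by (auto simp: subset_iff)
  have lim: "y \<longlonglongrightarrow> x"
  proof (rule metric_LIMSEQ_I)
    fix e :: real assume "0 < e"
    then obtain N where N: "1 / real (Suc N) < e" using nat_approx_posE by blast
    have "dist (y n) x < e" if "N \<le> n" for n
    proof -
      have "dist (y n) x < 1 / real (Suc n)" using yv(1)[of n] by (simp add: dist_commute)
      also have "\<dots> \<le> 1 / real (Suc N)" using that by (simp add: field_simps)
      finally show ?thesis using N by simp
    qed
    then show "\<exists>N. \<forall>n\<ge>N. dist (y n) x < e" by blast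
  qed
  define \<F> where "\<F> = range (\<lambda>n. frechet_derivative f (at (y n)))"
  have "bounded_linear h" if "h \<in> \<F>" for h
    using that dif yS has_derivative_bounded_linear frechet_derivative_works
    unfolding \<F>_def by blast
  moreover have "\<exists>K. \<forall>h\<in>\<F>. norm (h w) \<le> K" for w
  proof -
    have "(\<lambda>n. frechet_derivative f (at (y n)) w) \<longlonglongrightarrow> frechet_derivative f (at x) w"
      using continuous_on_tendsto_compose[OF cont lim \<open>x \<in> S\<close>] yS by simp
    then have "Bseq (\<lambda>n. frechet_derivative f (at (y n)) w)"
      using convergent_imp_Bseq convergent_def by blast
    then show ?thesis unfolding Bseq_def \<F>_def by auto
  qed
  ultimately obtain K where K: "0 \<le> K" "\<And>h w. h \<in> \<F> \<Longrightarrow> norm (h w) \<le> K * norm w"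
    using uniform_boundedness[of \<F>] by metis
  obtain n where "K \<le> real n" using real_arch_simple by blast
  then have "norm (frechet_derivative f (at (y n)) (v n)) \<le> real n * norm (v n)"
    using K(2)[of "frechet_derivative f (at (y n))" "v n"] mult_right_mono[of K "real n" "norm (v n)"]
    by (force simp: \<F>_def)
  then show False using yv(2)[of n] by simp
qed

lemma frechet_derivative_jointly_tendsto:
  fixes f :: "'a::{real_normed_vector, complete_space} \<Rightarrow> 'b::real_normed_vector"
  assumes "open S" "x \<in> S" and dif: "\<And>y. y \<in> S \<Longrightarrow> f differentiable (at y)"
    and cont: "\<And>v. continuous_on S (\<lambda>y. frechet_derivative f (at y) v)"
    and y: "(y \<longlongrightarrow> x) F" and w: "(w \<longlongrightarrow> w0) F"
  shows "((\<lambda>s. frechet_derivative f (at (y s)) (w s)) \<longlongrightarrow> frechet_derivative f (at x) w0) F"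
proof -
  obtain \<delta> K where K: "0 < \<delta>" "ball x \<delta> \<subseteq> S"
    "\<And>y v. y \<in> ball x \<delta> \<Longrightarrow> norm (frechet_derivative f (at y) v) \<le> K * norm v"
    using frechet_derivative_locally_bounded[OF assms(1-4)] by blast
  have ev: "\<forall>\<^sub>F s in F. y s \<in> ball x \<delta>"
    using topological_tendstoD[OF y open_ball, of x \<delta>] K by simp
  show ?thesis
  proof (rule tendsto_apply_family[OF _ _ w])
    show "\<forall>\<^sub>F s in F. linear (frechet_derivative f (at (y s))) \<and>
        (\<forall>v. norm (frechet_derivative f (at (y s)) v) \<le> K * norm v)"
      using ev by eventually_elim (use K dif linear_frechet_derivative in blast)
    have "isCont (\<lambda>y. frechet_derivative f (at y) w0) x"
      using cont[of w0] assms(1,2) continuous_on_eq_continuous_at by blast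
    then show "((\<lambda>s. frechet_derivative f (at (y s)) w0) \<longlongrightarrow> frechet_derivative f (at x) w0) F"
      using isCont_tendsto_compose y by blast
  qed
qed

section \<open>Second derivatives, trilinear maps, linear differential equations\<close>

text \<open>The mean value theorem in direction \<open>a\<close> turns the second difference into
  \<open>h\<close> times a difference of two values of the derivative in direction \<open>a\<close>.
  Expanding both values at \<open>x\<close> uses differentiability of that derivative at
  \<open>x\<close> alone.\<close>

lemma second_difference_estimate:
  fixes f :: "'a::real_normed_vector \<Rightarrow> real"
  assumes S: "open S" "x \<in> S" and dif: "\<And>y. y \<in> S \<Longrightarrow> f differentiable (at y)"
    and D: "((\<lambda>y. frechet_derivative f (at y) a) has_derivative L) (at x)"
    and e: "0 < e"
  shows "\<exists>d>0. \<forall>h. 0 < h \<and> h < d \<longrightarrow>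
    \<bar>f (x + h *\<^sub>R a + h *\<^sub>R b) - f (x + h *\<^sub>R a) - f (x + h *\<^sub>R b) + f x - h * h * L b\<bar>
      \<le> e * (h * h * (2 * norm a + norm b))"
proof -
  define g where "g y = frechet_derivative f (at y) a" for y
  obtain r where r: "0 < r" "ball x r \<subseteq> S" using S openE by blast
  obtain d0 where d0: "0 < d0"
    "\<And>y. norm (y - x) < d0 \<Longrightarrow> \<bar>g y - g x - L (y - x)\<bar> \<le> e * norm (y - x)"
    using D e unfolding has_derivative_at_alt g_def by (metis real_norm_def)
  \<comment> \<open>Steps below \<open>min r d0 / M\<close> keep all points
    \<open>x + s *\<^sub>R a + k *\<^sub>R b\<close> with \<open>s\<close> and \<open>k\<close>
    between 0 and \<open>h\<close> inside both balls around \<open>x\<close>.\<close>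
  define M where "M = norm a + norm b + 1"
  have M: "0 < M" unfolding M_def by (smt (verit) norm_ge_zero)
  interpret L: bounded_linear L using D has_derivative_bounded_linear by blast
  have "\<bar>f (x + h *\<^sub>R a + h *\<^sub>R b) - f (x + h *\<^sub>R a) - f (x + h *\<^sub>R b) + f x - h * h * L b\<bar>
      \<le> e * (h * h * (2 * norm a + norm b))" if h: "0 < h" "h < min r d0 / M" for h
  proof -
    have hM: "h * M < r" "h * M < d0" using h M by (auto simp: field_simps)
    have nb: "norm (s *\<^sub>R a + k *\<^sub>R b) \<le> h * (norm a + norm b)" "norm (s *\<^sub>R a + k *\<^sub>R b) < h * M"
      if "0 \<le> s" "s \<le> h" "0 \<le> k" "k \<le> h" for s k
    proof -
      have "norm (s *\<^sub>R a + k *\<^sub>R b) \<le> s * norm a + k * norm b"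
        using norm_triangle_ineq[of "s *\<^sub>R a" "k *\<^sub>R b"] that by simp
      also have "\<dots> \<le> h * norm a + h * norm b"
        using that by (intro add_mono mult_right_mono) auto
      finally show 1: "norm (s *\<^sub>R a + k *\<^sub>R b) \<le> h * (norm a + norm b)" by (simp add: algebra_simps)
      then show "norm (s *\<^sub>R a + k *\<^sub>R b) < h * M" using h(1) by (simp add: M_def algebra_simps)
    qed
    have inS: "x + s *\<^sub>R a + k *\<^sub>R b \<in> S" if "0 \<le> s" "s \<le> h" "0 \<le> k" "k \<le> h" for s k
    proof -
      have "dist x (x + s *\<^sub>R a + k *\<^sub>R b) = norm (s *\<^sub>R a + k *\<^sub>R b)"
        unfolding dist_norm using norm_minus_cancel[of "s *\<^sub>R a + k *\<^sub>R b"] by (simp add: add.assoc)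
      then show ?thesis using nb(2)[OF that] hM r by (auto simp: subset_iff)
    qed
    define \<phi> where "\<phi> s = f (x + s *\<^sub>R a + h *\<^sub>R b) - f (x + s *\<^sub>R a)" for s
    have der: "(\<phi> has_real_derivative (g (x + s *\<^sub>R a + h *\<^sub>R b) - g (x + s *\<^sub>R a))) (at s)"
      if "0 \<le> s" "s \<le> h" for s
    proof -
      have fd: "(f has_derivative frechet_derivative f (at y)) (at y)" if "y \<in> S" for y
        using dif[OF that] frechet_derivative_works by blast
      have lin: "linear (frechet_derivative f (at y))" if "y \<in> S" for y
        using dif[OF that] linear_frechet_derivative by blast
      have c: "((\<lambda>s. f (x + s *\<^sub>R a + k *\<^sub>R b)) has_real_derivative g (x + s *\<^sub>R a + k *\<^sub>R b)) (at s)"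
        if "0 \<le> k" "k \<le> h" for k
      proof -
        have y: "x + s *\<^sub>R a + k *\<^sub>R b \<in> S" using inS \<open>0 \<le> s\<close> \<open>s \<le> h\<close> that by blast
        have 1: "((\<lambda>s. x + s *\<^sub>R a + k *\<^sub>R b) has_derivative (\<lambda>s. s *\<^sub>R a)) (at s)"
          by (auto intro!: derivative_eq_intros)
        have "((\<lambda>s. f (x + s *\<^sub>R a + k *\<^sub>R b)) has_derivative
            (\<lambda>s'. frechet_derivative f (at (x + s *\<^sub>R a + k *\<^sub>R b)) (s' *\<^sub>R a))) (at s)"
          using has_derivative_compose[OF 1 fd[OF y]] by simp
        then show ?thesis
          unfolding has_field_derivative_def g_def
          by (rule has_derivative_eq_rhs) (auto simp: linear_cmul[OF lin[OF y]] fun_eq_iff)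
      qed
      show ?thesis unfolding \<phi>_def
        using DERIV_diff[OF c[of h] c[of 0]] h by simp
    qed
    obtain \<theta> where \<theta>: "0 < \<theta>" "\<theta> < h"
      "\<phi> h - \<phi> 0 = (h - 0) * (g (x + \<theta> *\<^sub>R a + h *\<^sub>R b) - g (x + \<theta> *\<^sub>R a))"
      using MVT2[of 0 h \<phi> "\<lambda>s. g (x + s *\<^sub>R a + h *\<^sub>R b) - g (x + s *\<^sub>R a)"] der h by auto
    have e1: "\<bar>g (x + \<theta> *\<^sub>R a + h *\<^sub>R b) - g x - L (\<theta> *\<^sub>R a + h *\<^sub>R b)\<bar> \<le> e * (h * (norm a + norm b))"
    proof -
      have "\<bar>g (x + (\<theta> *\<^sub>R a + h *\<^sub>R b)) - g x - L (\<theta> *\<^sub>R a + h *\<^sub>R b)\<bar> \<le> e * norm (\<theta> *\<^sub>R a + h *\<^sub>R b)"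
        using d0(2)[of "x + (\<theta> *\<^sub>R a + h *\<^sub>R b)"] nb(2)[of \<theta> h] \<theta> h hM by simp
      also have "\<dots> \<le> e * (h * (norm a + norm b))"
        using nb(1)[of \<theta> h] \<theta> h e by (intro mult_left_mono) auto
      finally show ?thesis by (simp add: add.assoc)
    qed
    have e2: "\<bar>g (x + \<theta> *\<^sub>R a) - g x - L (\<theta> *\<^sub>R a)\<bar> \<le> e * (h * norm a)"
    proof -
      have "\<bar>g (x + \<theta> *\<^sub>R a) - g x - L (\<theta> *\<^sub>R a)\<bar> \<le> e * norm (\<theta> *\<^sub>R a)"
        using d0(2)[of "x + \<theta> *\<^sub>R a"] nb(2)[of \<theta> 0] \<theta> h hM by simp
      also have "\<dots> \<le> e * (h * norm a)"
        using \<theta> e by (intro mult_left_mono) (auto intro: mult_right_mono)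
      finally show ?thesis .
    qed
    have "\<bar>g (x + \<theta> *\<^sub>R a + h *\<^sub>R b) - g (x + \<theta> *\<^sub>R a) - h * L b\<bar> \<le> e * (h * (2 * norm a + norm b))"
      using e1 e2 by (simp add: L.add L.scaleR algebra_simps)
    then have "h * \<bar>g (x + \<theta> *\<^sub>R a + h *\<^sub>R b) - g (x + \<theta> *\<^sub>R a) - h * L b\<bar>
        \<le> h * (e * (h * (2 * norm a + norm b)))"
      using h by (intro mult_left_mono) auto
    moreover have "f (x + h *\<^sub>R a + h *\<^sub>R b) - f (x + h *\<^sub>R a) - f (x + h *\<^sub>R b) + f x - h * h * L b
        = h * (g (x + \<theta> *\<^sub>R a + h *\<^sub>R b) - g (x + \<theta> *\<^sub>R a) - h * L b)"
      using \<theta>(3) by (simp add: \<phi>_def algebra_simps)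
    ultimately have "\<bar>f (x + h *\<^sub>R a + h *\<^sub>R b) - f (x + h *\<^sub>R a) - f (x + h *\<^sub>R b) + f x - h * h * L b\<bar>
        \<le> h * (e * (h * (2 * norm a + norm b)))"
      using h by (simp only: abs_mult abs_of_pos)
    then show ?thesis by (simp only: mult.assoc mult.left_commute)
  qed
  moreover have "0 < min r d0 / M" using r d0 M by simp
  ultimately show ?thesis by blast
qed

text \<open>The second difference is symmetric in \<open>a\<close> and \<open>b\<close>, and both
  iterated derivatives are its limit after division by \<open>h * h\<close>.\<close>

lemma second_derivative_symmetric_real:
  fixes f :: "'a::real_normed_vector \<Rightarrow> real"
  assumes S: "open S" "x \<in> S" and dif: "\<And>y. y \<in> S \<Longrightarrow> f differentiable (at y)"
    and Da: "(\<lambda>y. frechet_derivative f (at y) a) differentiable (at x)"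
    and Db: "(\<lambda>y. frechet_derivative f (at y) b) differentiable (at x)"
  shows "frechet_derivative (\<lambda>y. frechet_derivative f (at y) a) (at x) b =
         frechet_derivative (\<lambda>y. frechet_derivative f (at y) b) (at x) a" (is "?p = ?q")
proof -
  define M where "M = 3 * norm a + 3 * norm b"
  have "\<bar>?p - ?q\<bar> \<le> e * M" if e: "0 < e" for e
  proof -
    obtain d1 where d1: "0 < d1" "\<And>h. 0 < h \<Longrightarrow> h < d1 \<Longrightarrow>
      \<bar>f (x + h *\<^sub>R a + h *\<^sub>R b) - f (x + h *\<^sub>R a) - f (x + h *\<^sub>R b) + f x - h * h * ?p\<bar>
      \<le> e * (h * h * (2 * norm a + norm b))"
      using second_difference_estimate[OF S dif Da[unfolded frechet_derivative_works] e] by blast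
    obtain d2 where d2: "0 < d2" "\<And>h. 0 < h \<Longrightarrow> h < d2 \<Longrightarrow>
      \<bar>f (x + h *\<^sub>R b + h *\<^sub>R a) - f (x + h *\<^sub>R b) - f (x + h *\<^sub>R a) + f x - h * h * ?q\<bar>
      \<le> e * (h * h * (2 * norm b + norm a))"
      using second_difference_estimate[OF S dif Db[unfolded frechet_derivative_works] e] by blast
    define h where "h = min d1 d2 / 2"
    have h: "0 < h" "h < d1" "h < d2" using d1(1) d2(1) by (auto simp: h_def)
    have c: "x + h *\<^sub>R b + h *\<^sub>R a = x + h *\<^sub>R a + h *\<^sub>R b" by simp
    have "\<bar>h * h * ?p - h * h * ?q\<bar> \<le> e * (h * h * (2 * norm a + norm b)) + e * (h * h * (2 * norm b + norm a))"
      using d1(2)[OF h(1,2)] d2(2)[OF h(1,3)] unfolding c by linarith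
    also have "\<dots> = h * h * (e * M)" by (simp add: M_def algebra_simps)
    finally have "h * h * \<bar>?p - ?q\<bar> \<le> h * h * (e * M)"
      using h(1) by (simp add: abs_mult right_diff_distrib[symmetric])
    then show ?thesis using h(1) by simp
  qed
  note * = this
  have "\<bar>?p - ?q\<bar> \<le> 0 + e" if "0 < e" for e
  proof -
    have M: "0 \<le> M" by (simp add: M_def)
    have "\<bar>?p - ?q\<bar> \<le> e / (M + 1) * M" using *[of "e / (M+1)"] that M by simp
    also have "\<dots> \<le> e" using that M by (simp add: field_simps)
    finally show ?thesis by simp
  qed
  then have "\<bar>?p - ?q\<bar> \<le> 0" by (rule field_le_epsilon)
  then show ?thesis by simp
qed

lemma frechet_derivative_inner_left:
  assumes "f differentiable (at y)"
  shows "frechet_derivative (\<lambda>y. f y \<bullet> w) (at y) v = frechet_derivative f (at y) v \<bullet> w"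
  using frechet_derivative_at[OF bounded_linear.has_derivative[OF bounded_linear_inner_left
      assms[unfolded frechet_derivative_works]], of w] by metis

text \<open>Reduction to real values by pairing with an arbitrary vector \<open>w\<close>.\<close>

lemma second_derivative_symmetric:
  fixes f :: "'a::real_normed_vector \<Rightarrow> 'b::real_inner"
  assumes S: "open S" "x \<in> S" and dif: "\<And>y. y \<in> S \<Longrightarrow> f differentiable (at y)"
    and Da: "(\<lambda>y. frechet_derivative f (at y) a) differentiable (at x)"
    and Db: "(\<lambda>y. frechet_derivative f (at y) b) differentiable (at x)"
  shows "frechet_derivative (\<lambda>y. frechet_derivative f (at y) a) (at x) b =
         frechet_derivative (\<lambda>y. frechet_derivative f (at y) b) (at x) a"
proof -
  have eq: "frechet_derivative (\<lambda>y. frechet_derivative (\<lambda>y. f y \<bullet> w) (at y) a) (at x) b =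
      frechet_derivative (\<lambda>y. frechet_derivative f (at y) a) (at x) b \<bullet> w \<and>
      (\<lambda>y. frechet_derivative (\<lambda>y. f y \<bullet> w) (at y) a) differentiable (at x)"
    if Da: "(\<lambda>y. frechet_derivative f (at y) a) differentiable (at x)" for a b w
  proof -
    have "((\<lambda>y. frechet_derivative f (at y) a \<bullet> w) has_derivative
        (\<lambda>b. frechet_derivative (\<lambda>y. frechet_derivative f (at y) a) (at x) b \<bullet> w)) (at x)"
      using bounded_linear.has_derivative[OF bounded_linear_inner_left Da[unfolded frechet_derivative_works]] .
    then have "((\<lambda>y. frechet_derivative (\<lambda>y. f y \<bullet> w) (at y) a) has_derivative
        (\<lambda>b. frechet_derivative (\<lambda>y. frechet_derivative f (at y) a) (at x) b \<bullet> w)) (at x)"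
      by (rule has_derivative_transform_within_open[OF _ S])
         (simp add: frechet_derivative_inner_left dif)
    then show ?thesis using frechet_derivative_at differentiable_def by metis
  qed
  have "frechet_derivative (\<lambda>y. frechet_derivative f (at y) a) (at x) b \<bullet> w =
        frechet_derivative (\<lambda>y. frechet_derivative f (at y) b) (at x) a \<bullet> w" for w
    using second_derivative_symmetric_real[OF S, of "\<lambda>y. f y \<bullet> w" a b] eq[OF Da] eq[OF Db] dif
    by (auto intro!: derivative_intros)
  then show ?thesis by (metis vector_eq_rdot)
qed

section \<open>Maps depending on a base point and bilinearly on two vectors\<close>

lemma trilinear_partial:
  fixes F :: "'a::real_normed_vector \<Rightarrow> 'a \<Rightarrow> 'a \<Rightarrow> 'b::real_normed_vector"
  assumes dif: "(\<lambda>(x, u, v). F x u v) differentiable (at (x, u, v))"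
  shows "(\<lambda>y. F y u v) differentiable (at x)"
    and "frechet_derivative (\<lambda>y. F y u v) (at x) w =
         frechet_derivative (\<lambda>(x, u, v). F x u v) (at (x, u, v)) (w, 0, 0)"
proof -
  have 1: "((\<lambda>y. (y, u, v)) has_derivative (\<lambda>w. (w, 0, 0))) (at x)"
    by (auto intro!: derivative_eq_intros simp: zero_prod_def)
  have "((\<lambda>y. F y u v) has_derivative
      (\<lambda>w. frechet_derivative (\<lambda>(x, u, v). F x u v) (at (x, u, v)) (w, 0, 0))) (at x)"
    using has_derivative_compose[OF 1 dif[unfolded frechet_derivative_works]] by simp
  then show "(\<lambda>y. F y u v) differentiable (at x)"
    "frechet_derivative (\<lambda>y. F y u v) (at x) w =
         frechet_derivative (\<lambda>(x, u, v). F x u v) (at (x, u, v)) (w, 0, 0)"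
    using frechet_derivative_at differentiable_def by metis+
qed

text \<open>\<open>F\<close> models the Christoffel symbols and the local metric. It is linear in
  \<open>u\<close> and in \<open>v\<close>, so that the partial derivatives there are
  \<open>F\<close> itself, but its dependence on the base point is arbitrary.\<close>

lemma trilinear_frechet_derivative:
  fixes F :: "'a::real_normed_vector \<Rightarrow> 'a \<Rightarrow> 'a \<Rightarrow> 'b::real_normed_vector"
  assumes dif: "(\<lambda>(x, u, v). F x u v) differentiable (at (x, u, v))"
    and bil: "bounded_bilinear (F x)"
  shows "frechet_derivative (\<lambda>(x, u, v). F x u v) (at (x, u, v)) (x', u', v') =
    frechet_derivative (\<lambda>y. F y u v) (at x) x' + F x u' v + F x u v'"
proof -
  let ?D = "frechet_derivative (\<lambda>(x, u, v). F x u v) (at (x, u, v))"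
  interpret F: bounded_bilinear "F x" by (rule bil)
  have lin: "linear ?D" using dif linear_frechet_derivative by blast
  have 1: "((\<lambda>u. (x, u, v)) has_derivative (\<lambda>w. (0, w, 0))) (at u)"
    by (auto intro!: derivative_eq_intros)
  have "((\<lambda>u. F x u v) has_derivative (\<lambda>w. ?D (0, w, 0))) (at u)"
    using has_derivative_compose[OF 1 dif[unfolded frechet_derivative_works]] by simp
  moreover have "((\<lambda>u. F x u v) has_derivative (\<lambda>w. F x w v)) (at u)"
    using F.bounded_linear_left bounded_linear_imp_has_derivative by blast
  ultimately have 2: "?D (0, u', 0) = F x u' v" using has_derivative_unique by metis
  have 1: "((\<lambda>v. (x, u, v)) has_derivative (\<lambda>w. (0, 0, w))) (at v)"
    by (auto intro!: derivative_eq_intros)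
  have "((\<lambda>v. F x u v) has_derivative (\<lambda>w. ?D (0, 0, w))) (at v)"
    using has_derivative_compose[OF 1 dif[unfolded frechet_derivative_works]] by simp
  moreover have "((\<lambda>v. F x u v) has_derivative (\<lambda>w. F x u w)) (at v)"
    using F.bounded_linear_right bounded_linear_imp_has_derivative by blast
  ultimately have 3: "?D (0, 0, v') = F x u v'" using has_derivative_unique by metis
  have "(x', u', v') = (x', 0, 0) + (0, u', 0) + (0, 0, v')" by simp
  then have "?D (x', u', v') = ?D (x', 0, 0) + ?D (0, u', 0) + ?D (0, 0, v')"
    using linear_add[OF lin] by metis
  then show ?thesis using 2 3 trilinear_partial(2)[OF dif] by simp
qed

lemma has_derivative_compose_curve:
  assumes f: "f differentiable (at (x t))" and x: "(x has_vector_derivative x') (at t within I)"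
  shows "((\<lambda>s. f (x s)) has_vector_derivative frechet_derivative f (at (x t)) x') (at t within I)"
proof -
  have "((\<lambda>s. f (x s)) has_derivative (\<lambda>h. frechet_derivative f (at (x t)) (h *\<^sub>R x'))) (at t within I)"
    using has_derivative_compose[OF x[unfolded has_vector_derivative_def] f[unfolded frechet_derivative_works]] .
  then show ?thesis
    unfolding has_vector_derivative_def
    by (simp add: linear_cmul[OF linear_frechet_derivative[OF f]])
qed

lemma trilinear_curve:
  fixes F :: "'a::real_normed_vector \<Rightarrow> 'a \<Rightarrow> 'a \<Rightarrow> 'b::real_normed_vector"
  assumes dif: "(\<lambda>(x, u, v). F x u v) differentiable (at (x t, u t, v t))"
    and bil: "bounded_bilinear (F (x t))"
    and x: "(x has_vector_derivative x') (at t within I)"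
    and u: "(u has_vector_derivative u') (at t within I)"
    and v: "(v has_vector_derivative v') (at t within I)"
  shows "((\<lambda>s. F (x s) (u s) (v s)) has_vector_derivative
    (frechet_derivative (\<lambda>y. F y (u t) (v t)) (at (x t)) x' + F (x t) u' (v t) + F (x t) (u t) v'))
    (at t within I)"
  using has_derivative_compose_curve[of "\<lambda>(x, u, v). F x u v" "\<lambda>s. (x s, u s, v s)" t "(x', u', v')" I]
    has_vector_derivative_Pair[OF x has_vector_derivative_Pair[OF u v]] dif
  by (simp add: trilinear_frechet_derivative[OF dif bil])

text \<open>Continuity at \<open>(x, 0, 0)\<close> bounds \<open>F\<close> by 1 for small arguments,
  and homogeneity in the two vectors extends the bound to all of them.\<close>

lemma trilinear_locally_bounded:
  fixes F :: "'a::real_normed_vector \<Rightarrow> 'a \<Rightarrow> 'a \<Rightarrow> 'b::real_normed_vector"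
  assumes cont: "continuous_on (S \<times> UNIV) (\<lambda>(x, u, v). F x u v)"
    and bil: "\<And>x. x \<in> S \<Longrightarrow> bounded_bilinear (F x)" and S: "open S" "x \<in> S"
  shows "\<exists>\<delta>>0. \<exists>K\<ge>0. ball x \<delta> \<subseteq> S \<and> (\<forall>y\<in>ball x \<delta>. \<forall>u v. norm (F y u v) \<le> K * norm u * norm v)"
proof -
  obtain r where r: "0 < r" "ball x r \<subseteq> S" using S openE by blast
  have "isCont (\<lambda>(x, u, v). F x u v) (x, 0, 0)"
    using cont S continuous_on_eq_continuous_at[of "S \<times> (UNIV::('a\<times>'a) set)"] by (auto simp: open_Times)
  moreover have "F x 0 0 = 0" using bounded_bilinear.zero_left[OF bil[OF S(2)]] .
  ultimately have "\<exists>d>0. \<forall>p. dist p (x, 0, 0) < d \<longrightarrow> norm ((\<lambda>(x, u, v). F x u v) p) < 1"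
    unfolding continuous_at_eps_delta by (drule_tac x=1 in spec) (simp del: split_paired_All)
  then obtain d where d: "0 < d" "\<And>p. dist p (x, 0, 0) < d \<Longrightarrow> norm ((\<lambda>(x, u, v). F x u v) p) < 1"
    by blast
  define \<delta> where "\<delta> = min r (d / 3)"
  define c where "c = d / 3"
  have c: "0 < c" using d by (simp add: c_def)
  have small: "norm (F y u v) \<le> 1" if "y \<in> ball x \<delta>" "norm u \<le> c" "norm v < c" for y u v
  proof -
    have "dist (y, u, v) (x, 0, 0) \<le> dist y x + (norm u + norm v)"
      unfolding dist_Pair_Pair
      by (rule order_trans[OF sqrt_sum_squares_le_sum])
         (auto simp: intro!: add_mono order_trans[OF sqrt_sum_squares_le_sum])
    also have "\<dots> < d" using that by (auto simp: \<delta>_def c_def dist_commute)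
    finally show ?thesis using d(2)[of "(y, u, v)"] by simp
  qed
  have "norm (F y u v) \<le> (4 / (c * c)) * norm u * norm v" if y: "y \<in> ball x \<delta>" for y u v
  proof -
    interpret F: bounded_bilinear "F y" using bil y r by (auto simp: \<delta>_def subset_iff)
    show ?thesis
    proof (cases "u = 0 \<or> v = 0")
      case True then show ?thesis by (auto simp: F.zero_left F.zero_right)
    next
      case False
      have "norm (F y ((c / (2 * norm u)) *\<^sub>R u) ((c / (2 * norm v)) *\<^sub>R v)) \<le> 1"
        by (rule small[OF y]) (use False c in \<open>auto simp: field_simps\<close>)
      then have "(c / (2 * norm u)) * (c / (2 * norm v)) * norm (F y u v) \<le> 1"
        using c by (simp add: F.scaleR_left F.scaleR_right mult_ac)
      moreover have "n \<le> 4 / (c * c) * p * q" if "c / (2 * p) * (c / (2 * q)) * n \<le> 1" "0 < p" "0 < q" for n p q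
        using that c by (simp add: field_simps)
      ultimately show ?thesis using False by simp
    qed
  qed
  moreover have "0 < \<delta>" "0 \<le> 4 / (c * c)" "ball x \<delta> \<subseteq> S" using r d c by (auto simp: \<delta>_def)
  ultimately show ?thesis by blast
qed

text \<open>The sort \<open>{real_normed_vector, complete_space}\<close> is not below the class \<open>banach\<close>; pairing
  with the reals leads into a type of class \<open>banach\<close>, where the library's integral is available.\<close>

instance prod :: ("{real_normed_vector, complete_space}", "{real_normed_vector, complete_space}") banach ..

lemma antiderivative_complete_space:
  fixes f :: "real \<Rightarrow> 'a::{real_normed_vector, complete_space}"
  assumes "continuous_on {a..b} f"
  obtains g where "\<And>x. x \<in> {a..b} \<Longrightarrow> (g has_vector_derivative f x) (at x within {a..b})"
proof -
  have "continuous_on {a..b} (\<lambda>x. (f x, 0::real))" using assms by (intro continuous_intros)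
  then obtain g where g: "\<And>x. x \<in> {a..b} \<Longrightarrow> (g has_vector_derivative (f x, 0::real)) (at x within {a..b})"
    by (rule antiderivative_continuous) blast
  have "((\<lambda>x. fst (g x)) has_vector_derivative f x) (at x within {a..b})" if "x \<in> {a..b}" for x
    using bounded_linear.has_vector_derivative[OF bounded_linear_fst g[OF that]] by simp
  then show thesis using that by blast
qed

text \<open>Picard iteration. The interval is short enough for the integral operator to contract by
  \<open>1 / 2\<close> at once; longer intervals are reached later by gluing.\<close>

lemma linear_ode_exists:
  fixes a :: "real \<Rightarrow> 'a::{real_normed_vector, complete_space} \<Rightarrow> 'a"
  assumes st: "s \<le> t" and r0: "r0 \<in> {s..t}"
    and cont: "continuous_on ({s..t} \<times> UNIV) (\<lambda>(r, y). a r y)"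
    and lip: "\<And>r x y. r \<in> {s..t} \<Longrightarrow> norm (a r x - a r y) \<le> K * norm (x - y)"
    and K: "0 \<le> K" "K * (t - s) \<le> 1 / 2"
  shows "\<exists>y. y r0 = y0 \<and> (\<forall>r\<in>{s..t}. (y has_vector_derivative a r (y r)) (at r within {s..t}))"
proof -
  \<comment> \<open>Clamping to \<open>{s..t}\<close> turns a function on the interval into a
    bounded continuous function on the line, so that the complete metric space of type
    \<open>real \<Rightarrow>\<^sub>C 'a\<close> can carry the iteration.\<close>
  define cl where "cl r = max s (min t r)" for r
  have cl: "cl r \<in> {s..t}" for r using st by (auto simp: cl_def)
  have cl_id: "cl r = r" if "r \<in> {s..t}" for r using that by (auto simp: cl_def)
  have ccl: "continuous_on UNIV cl" unfolding cl_def by (intro continuous_intros)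
  define P where "P f G \<longleftrightarrow> G r0 = y0 \<and> (\<forall>r\<in>{s..t}. (G has_vector_derivative a r (f r)) (at r within {s..t}))"
    for f G :: "real \<Rightarrow> 'a"
  have ex: "\<exists>G. P f G" if "continuous_on {s..t} f" for f
  proof -
    have "continuous_on {s..t} (\<lambda>r. (\<lambda>(r, y). a r y) (r, f r))"
      by (rule continuous_on_compose2[OF cont]) (auto intro!: continuous_intros that)
    then obtain g where g: "\<And>r. r \<in> {s..t} \<Longrightarrow> (g has_vector_derivative a r (f r)) (at r within {s..t})"
      using antiderivative_complete_space[of s t "\<lambda>r. a r (f r)"] by auto
    have "P f (\<lambda>r. g r - g r0 + y0)" unfolding P_def
      using has_vector_derivative_add[OF has_vector_derivative_diff[OF g has_vector_derivative_const]
          has_vector_derivative_const] by simp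
    then show ?thesis by blast
  qed
  \<comment> \<open>\<open>G f\<close> is a primitive of \<open>a r (f r)\<close> on
    \<open>{s..t}\<close> with value \<open>y0\<close> at \<open>r0\<close>. Outside the interval it
    is an arbitrary choice, hence the clamp in \<open>\<Phi>\<close>.\<close>
  define G where "G f = (SOME G. P (apply_bcontfun f) G)" for f :: "real \<Rightarrow>\<^sub>C 'a"
  have G: "P (apply_bcontfun f) (G f)" for f
    unfolding G_def by (rule someI_ex[OF ex]) simp
  have Gc: "continuous_on {s..t} (G f)" for f
    by (rule continuous_on_vector_derivative[of _ _ "\<lambda>r. a r (f r)"])
       (use G[of f] in \<open>simp add: P_def\<close>)
  define \<Phi> where "\<Phi> f = Bcontfun (\<lambda>r. G f (cl r))" for f
  have ap: "apply_bcontfun (\<Phi> f) r = G f (cl r)" for f r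
  proof -
    have c: "continuous_on UNIV (\<lambda>r. G f (cl r))"
      by (rule continuous_on_compose2[OF Gc ccl]) (use cl in auto)
    have "compact (G f ` {s..t})" by (intro compact_continuous_image Gc compact_Icc)
    then obtain M where "\<And>x. x \<in> G f ` {s..t} \<Longrightarrow> norm x \<le> M"
      using compact_imp_bounded bounded_iff by metis
    then have "(\<lambda>r. G f (cl r)) \<in> bcontfun" using cl by (intro bcontfun_normI[OF c]) blast
    then show ?thesis unfolding \<Phi>_def by (simp add: Bcontfun_inverse)
  qed
  have contr: "dist (\<Phi> f) (\<Phi> h) \<le> 1/2 * dist f h" for f h
  proof (rule dist_bound)
    fix r
    have "norm ((G f (cl r) - G h (cl r)) - (G f r0 - G h r0)) \<le> (K * dist f h) * norm (cl r - r0)"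
    proof (rule differentiable_bound[of "{s..t}" "\<lambda>r. G f r - G h r" "\<lambda>r d. d *\<^sub>R (a r (f r) - a r (h r))"])
      show "((\<lambda>r. G f r - G h r) has_derivative (\<lambda>d. d *\<^sub>R (a x (f x) - a x (h x)))) (at x within {s..t})"
        if "x \<in> {s..t}" for x
        using has_vector_derivative_diff[of "G f" "a x (f x)" "at x within {s..t}" "G h" "a x (h x)"]
          G[of f] G[of h] that
        unfolding P_def has_vector_derivative_def by blast
      show "onorm (\<lambda>d. d *\<^sub>R (a x (f x) - a x (h x))) \<le> K * dist f h" if "x \<in> {s..t}" for x
      proof (rule onorm_le)
        fix d :: real
        have "norm (a x (f x) - a x (h x)) \<le> K * norm (f x - h x)" by (rule lip[OF that])
        also have "\<dots> \<le> K * dist f h"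
          using dist_bounded[of f x h] K by (intro mult_left_mono) (simp_all only: dist_norm[symmetric])
        finally show "norm (d *\<^sub>R (a x (f x) - a x (h x))) \<le> K * dist f h * norm d"
          by (simp add: mult.commute mult_left_mono)
      qed
    qed (use cl r0 in auto)
    also have "\<dots> \<le> (K * dist f h) * (t - s)"
      using cl[of r] r0 K by (intro mult_left_mono) auto
    also have "\<dots> = (K * (t - s)) * dist f h" by simp
    also have "\<dots> \<le> 1/2 * dist f h" using K by (intro mult_right_mono) auto
    finally show "dist (\<Phi> f r) (\<Phi> h r) \<le> 1/2 * dist f h"
      using G[of f] G[of h] unfolding P_def by (simp add: ap dist_norm)
  qed
  obtain f where f: "\<Phi> f = f"
    using banach_fix_type[of "1/2" \<Phi>] contr by auto
  have fG: "f r = G f r" if "r \<in> {s..t}" for r using ap[of f r] f that by (simp add: cl_id)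
  show ?thesis
    using G[of f] r0 unfolding P_def by (intro exI[of _ "G f"]) (simp add: fG)
qed

section \<open>Jacobi systems in a space with a weak inner product\<close>

text \<open>What remains of the geometry after transport to the start: \<open>B\<close> is the
  metric at \<open>p\<close>, and \<open>R t\<close> is the transported curvature, continuous in
  \<open>t\<close> only strongly. \<open>initial_sym\<close> makes the initial data isotropic for
  the Wronskian form; it encodes the symmetry of the Weingarten operator and the orthogonality of
  the tangent and normal spaces.\<close>

locale jacobi_system = weak_inner B
  for B :: "'a::{real_normed_vector, complete_space} \<Rightarrow> 'a \<Rightarrow> real" +
  fixes R :: "real \<Rightarrow> 'a \<Rightarrow> 'a" and b :: real
    and T T' T'' :: "real \<Rightarrow> 'a \<Rightarrow>\<^sub>L 'a"
  assumes b: "0 < b"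
    and R_linear: "t \<in> {0..b} \<Longrightarrow> bounded_linear (R t)"
    and R_sym: "t \<in> {0..b} \<Longrightarrow> B (R t x) y = B x (R t y)"
    and R_cont: "continuous_on {0..b} (\<lambda>t. R t x)"
    and T: "t \<in> {0..b} \<Longrightarrow> (T has_vector_derivative T' t) (at t within {0..b})"
    and T': "t \<in> {0..b} \<Longrightarrow> (T' has_vector_derivative T'' t) (at t within {0..b})"
    and T'': "t \<in> {0..b} \<Longrightarrow> T'' t X = - R t (T t X)"
    and initial_sym: "B (T' 0 X) (T 0 Y) = B (T 0 X) (T' 0 Y)"
begin

text \<open>\<open>W'\<close> is a separate argument because its values at the finitely many break
  points may be anything. Of the integrals containing \<open>W'\<close> only that of
  \<open>B (W' r) (W' r)\<close> is demanded; the mixed ones are obtained by integration by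
  parts.\<close>

definition admissible :: "real \<Rightarrow> real \<Rightarrow> (real \<Rightarrow> 'a) \<Rightarrow> (real \<Rightarrow> 'a) \<Rightarrow> bool" where
  "admissible s t W W' \<longleftrightarrow> continuous_on {s..t} W \<and>
     (\<exists>S. finite S \<and> (\<forall>r\<in>{s<..<t} - S. (W has_vector_derivative W' r) (at r))) \<and>
     (\<lambda>r. B (W' r) (W' r)) integrable_on {s..t}"

definition energy :: "real \<Rightarrow> real \<Rightarrow> (real \<Rightarrow> 'a) \<Rightarrow> (real \<Rightarrow> 'a) \<Rightarrow> real" where
  "energy s t W W' = integral {s..t} (\<lambda>r. B (W' r) (W' r) - B (R r (W r)) (W r))"

text \<open>By \<open>wronskian\<close> this depends on \<open>X\<close> only through
  \<open>T t X\<close>. Its increment over an interval is the energy of the Jacobi field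
  \<open>T r X\<close> there, so \<open>index_bound\<close> is an equality for that field.\<close>

definition boundary :: "real \<Rightarrow> 'a \<Rightarrow> real" where
  "boundary t X = B (T' t X) (T t X)"

definition index_bound :: "real \<Rightarrow> real \<Rightarrow> bool" where
  "index_bound s t \<longleftrightarrow> (\<forall>W W' X Y. admissible s t W W' \<and> W s = T s X \<and> W t = T t Y \<longrightarrow>
     boundary t Y - boundary s X \<le> energy s t W W')"

definition C2_on :: "real \<Rightarrow> real \<Rightarrow> (real \<Rightarrow> 'a) \<Rightarrow> (real \<Rightarrow> 'a) \<Rightarrow> (real \<Rightarrow> 'a) \<Rightarrow> bool" where
  "C2_on s t V V' V'' \<longleftrightarrow>
     continuous_on {s..t} V \<and> continuous_on {s..t} V' \<and> continuous_on {s..t} V'' \<and>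
     (\<forall>r\<in>{s<..<t}. (V has_vector_derivative V' r) (at r) \<and> (V' has_vector_derivative V'' r) (at r))"

text \<open>Strong continuity on the compact interval bounds each orbit \<open>R t x\<close>, and
  Banach-Steinhaus makes the bound uniform in \<open>x\<close>.\<close>

lemma R_bound_exists: "\<exists>K\<ge>0. \<forall>t\<in>{0..b}. \<forall>x. norm (R t x) \<le> K * norm x"
proof -
  have "\<exists>K. \<forall>f\<in>R ` {0..b}. norm (f x) \<le> K" for x
  proof -
    have "bounded ((\<lambda>t. R t x) ` {0..b})"
      by (intro compact_imp_bounded compact_continuous_image R_cont compact_Icc)
    then show ?thesis by (auto simp: bounded_iff)
  qed
  then obtain K where "0 \<le> K" "\<And>f x. f \<in> R ` {0..b} \<Longrightarrow> norm (f x) \<le> K * norm x"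
    using uniform_boundedness[of "R ` {0..b}"] R_linear by (metis (no_types, lifting) imageE)
  then show ?thesis by blast
qed

definition R_bound where "R_bound = (SOME K. 0 \<le> K \<and> (\<forall>t\<in>{0..b}. \<forall>x. norm (R t x) \<le> K * norm x))"

lemma R_bound: "0 \<le> R_bound" "t \<in> {0..b} \<Longrightarrow> norm (R t x) \<le> R_bound * norm x"
  using someI_ex[OF R_bound_exists[unfolded Bex_def conj_assoc]] unfolding R_bound_def by auto

lemma R_form_bound: "t \<in> {0..b} \<Longrightarrow> \<bar>B (R t x) x\<bar> \<le> R_bound * B x x"
  using lax_form_bound R_linear R_sym R_bound by blast

lemma R_weak_bound: "t \<in> {0..b} \<Longrightarrow> B (R t x) (R t x) \<le> R_bound\<^sup>2 * B x x"
  using lax_bound R_linear R_sym R_bound by blast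

lemma R_continuous:
  assumes "continuous_on S W" "S \<subseteq> {0..b}"
  shows "continuous_on S (\<lambda>t. R t (W t))"
  unfolding continuous_on_def
proof
  fix t assume t: "t \<in> S"
  show "((\<lambda>t. R t (W t)) \<longlongrightarrow> R t (W t)) (at t within S)"
  proof (rule tendsto_apply_family[where A = R and y = W and w = "W t" and K = R_bound])
    show "\<forall>\<^sub>F s in at t within S. linear (R s) \<and> (\<forall>v. norm (R s v) \<le> R_bound * norm v)"
    proof -
      have "linear (R s) \<and> (\<forall>v. norm (R s v) \<le> R_bound * norm v)" if "s \<in> S" for s
        using that assms(2) R_bound R_linear bounded_linear.linear by blast
      then show ?thesis by (simp add: eventually_at_filter)
    qed
    show "((\<lambda>s. R s (W t)) \<longlongrightarrow> R t (W t)) (at t within S)"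
      using continuous_on_subset[OF R_cont assms(2)] t by (simp add: continuous_on_def)
    show "(W \<longlongrightarrow> W t) (at t within S)" using assms(1) t by (simp add: continuous_on_def)
  qed
qed

lemma B_continuous:
  "continuous_on S f \<Longrightarrow> continuous_on S g \<Longrightarrow> continuous_on S (\<lambda>r. B (f r) (g r))"
  by (rule continuous_on)

lemma T_deriv:
  assumes "t \<in> {0..b}"
  shows "((\<lambda>r. T r Y) has_vector_derivative T' t Y) (at t within {0..b})"
    "((\<lambda>r. T' r Y) has_vector_derivative - R t (T t Y)) (at t within {0..b})"
  using bounded_linear.has_vector_derivative[OF blinfun.bounded_linear_left T[OF assms]]
    bounded_linear.has_vector_derivative[OF blinfun.bounded_linear_left T'[OF assms]] T''[OF assms]
  by metis+

lemma T_cont: "continuous_on {0..b} (\<lambda>r. T r Y)" "continuous_on {0..b} (\<lambda>r. T' r Y)"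
  by (rule continuous_on_vector_derivative, erule T_deriv)+

lemma T_C2:
  assumes "0 \<le> s" "t \<le> b"
  shows "C2_on s t (\<lambda>r. T r Y) (\<lambda>r. T' r Y) (\<lambda>r. - R r (T r Y))"
proof -
  have sub: "{s..t} \<subseteq> {0..b}" using assms by auto
  have d: "((\<lambda>r. T r Y) has_vector_derivative T' r Y) (at r) \<and>
      ((\<lambda>r. T' r Y) has_vector_derivative - R r (T r Y)) (at r)" if r: "r \<in> {s<..<t}" for r
  proof -
    have "at r within {0..b} = at r" using r assms by (intro at_within_Icc_at) auto
    moreover have "r \<in> {0..b}" using r assms by auto
    ultimately show ?thesis using T_deriv by metis
  qed
  show ?thesis unfolding C2_on_def
    by (intro conjI ballI d continuous_on_subset[OF T_cont(1) sub] continuous_on_subset[OF T_cont(2) sub]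
        continuous_on_minus R_continuous[OF continuous_on_subset[OF T_cont(1) sub] sub])
qed

text \<open>The derivative of the difference vanishes because \<open>R t\<close> is symmetric, and
  its value at 0 is given by \<open>initial_sym\<close>. Where \<open>T t\<close> is invertible,
  this says that \<open>T' t\<close> composed with the inverse of \<open>T t\<close> is symmetric
  for \<open>B\<close>.\<close>

lemma wronskian: "t \<in> {0..b} \<Longrightarrow> B (T' t X) (T t Y) = B (T t X) (T' t Y)"
proof -
  assume t: "t \<in> {0..b}"
  define w where "w r = B (T' r X) (T r Y) - B (T r X) (T' r Y)" for r
  have "(w has_vector_derivative 0) (at r within {0..b})" if r: "r \<in> {0..b}" for r
  proof -
    have "(w has_vector_derivative (B (T' r X) (T' r Y) + B (- R r (T r X)) (T r Y)
        - (B (T r X) (- R r (T r Y)) + B (T' r X) (T' r Y)))) (at r within {0..b})"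
      unfolding w_def
      by (intro has_vector_derivative_diff has_vector_derivative T_deriv r)
    then show ?thesis by (simp add: minus_left minus_right R_sym[OF r])
  qed
  then have "w t = w 0"
    using t b has_derivative_zero_unique[of "{0..b}" w 0 t]
    unfolding has_vector_derivative_def by auto
  then show ?thesis using initial_sym by (simp add: w_def)
qed

section \<open>Energy of admissible paths and its polar form\<close>

lemma admissible_subset:
  "admissible s t W W' \<Longrightarrow> s \<le> s1 \<Longrightarrow> t1 \<le> t \<Longrightarrow> admissible s1 t1 W W'"
  unfolding admissible_def
  by (auto elim!: continuous_on_subset integrable_on_subinterval intro!: exI)

lemma C2_admissible: "C2_on s t V V' V'' \<Longrightarrow> admissible s t V V'"
  unfolding C2_on_def admissible_def
  by (auto intro!: integrable_continuous_real B_continuous exI[of _ "{}"])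

lemma R_term_integrable:
  assumes "continuous_on {s..t} W" "continuous_on {s..t} V" "0 \<le> s" "t \<le> b"
  shows "(\<lambda>r. B (R r (W r)) (V r)) integrable_on {s..t}"
  by (intro integrable_continuous_real B_continuous R_continuous assms) (use assms in auto)

text \<open>The polar form of the energy at \<open>W\<close> and \<open>V\<close>, integrated by
  parts so that the derivative of \<open>W\<close> no longer occurs. For a Jacobi field
  \<open>V\<close> only the end-point terms survive.\<close>

definition cross where
  "cross s t W V V' V'' = B (W t) (V' t) - B (W s) (V' s) - integral {s..t} (\<lambda>r. B (W r) (V'' r + R r (V r)))"

text \<open>The fundamental theorem of calculus, which tolerates the finite exceptional set, yields
  integrability of the mixed integrand along with its value.\<close>

lemma pairing:
  assumes W: "admissible s t W W'" and V: "C2_on s t V V' V''" and st: "0 \<le> s" "s \<le> t" "t \<le> b"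
  shows "((\<lambda>r. B (W' r) (V' r) - B (R r (W r)) (V r)) has_integral cross s t W V V' V'') {s..t}"
proof -
  obtain S where S: "finite S" "\<And>r. r \<in> {s<..<t} - S \<Longrightarrow> (W has_vector_derivative W' r) (at r)"
    using W unfolding admissible_def by blast
  have cW: "continuous_on {s..t} W" using W by (simp add: admissible_def)
  have cV: "continuous_on {s..t} V" "continuous_on {s..t} V'" "continuous_on {s..t} V''"
    using V by (simp_all add: C2_on_def)
  have 1: "((\<lambda>r. B (W r) (V'' r) + B (W' r) (V' r)) has_integral B (W t) (V' t) - B (W s) (V' s)) {s..t}"
  proof (rule fundamental_theorem_of_calculus_interior_strong[OF S(1) st(2)])
    show "((\<lambda>r. B (W r) (V' r)) has_vector_derivative B (W r) (V'' r) + B (W' r) (V' r)) (at r)"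
      if "r \<in> {s<..<t} - S" for r
      using has_vector_derivative[OF S(2)[OF that]] V that unfolding C2_on_def by blast
    show "continuous_on {s..t} (\<lambda>r. B (W r) (V' r))" by (rule B_continuous[OF cW cV(2)])
  qed
  have "(\<lambda>r. B (W r) (V'' r + R r (V r))) integrable_on {s..t}"
    by (intro integrable_continuous_real B_continuous continuous_on_add R_continuous cW cV) (use st in auto)
  then have 2: "((\<lambda>r. B (W r) (V'' r + R r (V r))) has_integral integral {s..t} (\<lambda>r. B (W r) (V'' r + R r (V r)))) {s..t}"
    by (rule integrable_integral)
  show ?thesis unfolding cross_def
    by (rule has_integral_eq[OF _ has_integral_diff[OF 1 2]])
       (use st in \<open>auto simp: add_right R_sym\<close>)
qed

lemma energy_integrable:
  assumes "admissible s t W W'" "0 \<le> s" "t \<le> b"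
  shows "(\<lambda>r. B (W' r) (W' r) - B (R r (W r)) (W r)) integrable_on {s..t}"
  using assms unfolding admissible_def by (intro integrable_diff R_term_integrable) auto

lemma energy_C2:
  assumes "C2_on s t V V' V''" "0 \<le> s" "s \<le> t" "t \<le> b"
  shows "energy s t V V' = cross s t V V V' V''"
  unfolding energy_def using pairing[OF C2_admissible assms] assms(1) by (metis integral_unique)

lemma add_C2:
  assumes W: "admissible s t W W'" and V: "C2_on s t V V' V''" and st: "0 \<le> s" "s \<le> t" "t \<le> b"
  shows "admissible s t (\<lambda>r. W r + V r) (\<lambda>r. W' r + V' r)"
    and "energy s t (\<lambda>r. W r + V r) (\<lambda>r. W' r + V' r) =
         energy s t W W' + 2 * cross s t W V V' V'' + cross s t V V V' V''"
proof -
  have cW: "continuous_on {s..t} W" using W by (simp add: admissible_def)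
  have cV: "continuous_on {s..t} V" using V by (simp_all add: C2_on_def)
  have h: "((\<lambda>r. (B (W' r) (W' r) - B (R r (W r)) (W r)) + 2 * (B (W' r) (V' r) - B (R r (W r)) (V r))
      + (B (V' r) (V' r) - B (R r (V r)) (V r)))
      has_integral energy s t W W' + 2 * cross s t W V V' V'' + cross s t V V V' V'') {s..t}"
    by (intro has_integral_add has_integral_mult_right pairing[OF W V st] pairing[OF C2_admissible[OF V] V st])
       (use energy_integrable[OF W] st in \<open>auto simp: energy_def\<close>)
  have eq: "(B (W' r) (W' r) - B (R r (W r)) (W r)) + 2 * (B (W' r) (V' r) - B (R r (W r)) (V r))
      + (B (V' r) (V' r) - B (R r (V r)) (V r)) =
      B (W' r + V' r) (W' r + V' r) - B (R r (W r + V r)) (W r + V r)" if "r \<in> {s..t}" for r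
  proof -
    have r: "r \<in> {0..b}" using that st by auto
    interpret Rr: bounded_linear "R r" by (rule R_linear[OF r])
    have "B (R r (V r)) (W r) = B (R r (W r)) (V r)" by (simp add: R_sym[OF r] sym[of "V r"])
    then show ?thesis by (simp add: add_left add_right Rr.add sym[of "V' r" "W' r"])
  qed
  have e: "((\<lambda>r. B (W' r + V' r) (W' r + V' r) - B (R r (W r + V r)) (W r + V r)) has_integral
      energy s t W W' + 2 * cross s t W V V' V'' + cross s t V V V' V'') {s..t}"
    by (rule has_integral_eq[OF eq h])
  then show "energy s t (\<lambda>r. W r + V r) (\<lambda>r. W' r + V' r) =
         energy s t W W' + 2 * cross s t W V V' V'' + cross s t V V V' V''"
    unfolding energy_def by (rule integral_unique)
  have c: "continuous_on {s..t} (\<lambda>r. W r + V r)" by (intro continuous_on_add cW cV)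
  \<comment> \<open>Integrability of the squared derivative of the sum is recovered from the energy
    density by adding back the continuous curvature term.\<close>
  have "(\<lambda>r. B (W' r + V' r) (W' r + V' r)) integrable_on {s..t}"
    using integrable_add[OF has_integral_integrable[OF e] R_term_integrable[OF c c]] st by simp
  moreover obtain S where "finite S" "\<And>r. r \<in> {s<..<t} - S \<Longrightarrow> (W has_vector_derivative W' r) (at r)"
    using W unfolding admissible_def by blast
  ultimately show "admissible s t (\<lambda>r. W r + V r) (\<lambda>r. W' r + V' r)"
    using c V unfolding admissible_def C2_on_def
    by (intro conjI exI[of _ S]) (auto intro!: has_vector_derivative_add)
qed

lemma cross_jacobi:
  assumes "0 \<le> s" "s \<le> t" "t \<le> b"
  shows "cross s t W (\<lambda>r. T r Y) (\<lambda>r. T' r Y) (\<lambda>r. - R r (T r Y)) = B (W t) (T' t Y) - B (W s) (T' s Y)"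
  by (simp add: cross_def zero_right)

text \<open>It suffices to treat \<open>Y = 0\<close>: subtracting the Jacobi field
  \<open>T r Y\<close> changes both sides of the inequality equally, by \<open>cross_jacobi\<close>
  and the Wronskian identity.\<close>

lemma index_boundI:
  assumes st: "0 \<le> s" "s \<le> t" "t \<le> b"
    and 1: "\<And>V V' X. admissible s t V V' \<Longrightarrow> V s = T s X \<Longrightarrow> V t = 0 \<Longrightarrow> - boundary s X \<le> energy s t V V'"
  shows "index_bound s t"
  unfolding index_bound_def
proof (intro allI impI, elim conjE)
  fix W W' X Y assume W: "admissible s t W W'" "W s = T s X" "W t = T t Y"
  note J = T_C2[OF st(1,3), of "- Y"] T_C2[OF st(1,3), of Y]
  define V V' where "V = (\<lambda>r. W r + T r (- Y))" and "V' = (\<lambda>r. W' r + T' r (- Y))"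
  have V: "admissible s t V V'" "V s = T s (X - Y)" "V t = 0"
    using add_C2(1)[OF W(1) J(1) st] W by (auto simp: V_def V'_def blinfun.bilinear_simps)
  have "energy s t (\<lambda>r. V r + T r Y) (\<lambda>r. V' r + T' r Y) =
      energy s t V V' + 2 * (B (V t) (T' t Y) - B (V s) (T' s Y)) + (B (T t Y) (T' t Y) - B (T s Y) (T' s Y))"
    using add_C2(2)[OF V(1) J(2) st] cross_jacobi[OF st] by simp
  moreover have "(\<lambda>r. V r + T r Y) = W" "(\<lambda>r. V' r + T' r Y) = W'"
    by (auto simp: V_def V'_def blinfun.bilinear_simps)
  ultimately have "energy s t W W' = energy s t V V' - 2 * B (T s (X - Y)) (T' s Y)
      + boundary t Y - boundary s Y"
    using V by (simp add: zero_left boundary_def sym)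
  moreover have "boundary s X = boundary s (X - Y) + 2 * B (T s (X - Y)) (T' s Y) + boundary s Y"
  proof -
    have "boundary s (Z + Y) = boundary s Z + 2 * B (T s Z) (T' s Y) + boundary s Y" for Z
      using wronskian[of s Z Y] st unfolding boundary_def
      by (simp add: blinfun.add_right add_left add_right sym[of "T' s Y"])
    from this[of "X - Y"] show ?thesis by simp
  qed
  ultimately show "boundary t Y - boundary s X \<le> energy s t W W'"
    using 1[OF V] by simp
qed

text \<open>Pairing \<open>V'\<close> with the fixed vector \<open>V r\<close> reduces everything to
  scalar integrals, so that \<open>V'\<close> itself never has to be integrated; Young's inequality
  then produces the squared derivative.\<close>

lemma poincare:
  assumes V: "admissible s t V V'" "V t = 0" and r: "s \<le> r" "r \<le> t"
  shows "B (V r) (V r) \<le> (t - s) * integral {s..t} (\<lambda>r. B (V' r) (V' r))"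
proof -
  obtain S where S: "finite S" "\<And>r. r \<in> {s<..<t} - S \<Longrightarrow> (V has_vector_derivative V' r) (at r)"
    using V unfolding admissible_def by blast
  have cV: "continuous_on {s..t} V" using V by (simp add: admissible_def)
  have int: "(\<lambda>r. B (V' r) (V' r)) integrable_on {s..t}" using V by (simp add: admissible_def)
  have Dpos: "0 \<le> integral {s..t} (\<lambda>r. B (V' r) (V' r))" by (intro integral_nonneg int nonneg)
  show ?thesis
  proof (cases "r = t")
    case True then show ?thesis using V(2) Dpos r by (simp add: zero_left)
  next
    case False
    then have rt: "r < t" using r by simp
    define e where "e = V r"
    have sub: "{r..t} \<subseteq> {s..t}" using r by auto
    have int': "(\<lambda>r. B (V' r) (V' r)) integrable_on {r..t}"
      using int sub integrable_on_subinterval by blast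
    have 1: "((\<lambda>q. B e (V' q)) has_integral B e (V t) - B e (V r)) {r..t}"
    proof (rule fundamental_theorem_of_calculus_interior_strong[OF S(1) r(2)])
      show "((\<lambda>q. B e (V q)) has_vector_derivative B e (V' q)) (at q)" if "q \<in> {r<..<t} - S" for q
        using bounded_linear.has_vector_derivative[OF bounded_linear_right S(2)] that r by auto
      show "continuous_on {r..t} (\<lambda>q. B e (V q))"
        by (intro B_continuous continuous_on_const continuous_on_subset[OF cV sub])
    qed
    \<comment> \<open>With this \<open>l\<close> the integral of \<open>l * B e e\<close> over
      \<open>{r..t}\<close> is exactly \<open>B e e\<close>, which is absorbed by the
      \<open>2 * B e e\<close> on the left.\<close>
    define l where "l = 1 / (t - r)"
    have l: "0 < l" using rt by (simp add: l_def)
    have "2 * (B e (V r) - B e (V t)) \<le> integral {r..t} (\<lambda>q. l * B e e + B (V' q) (V' q) / l)"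
    proof (rule has_integral_le)
      show "((\<lambda>q. - 2 * B e (V' q)) has_integral 2 * (B e (V r) - B e (V t))) {r..t}"
        using has_integral_mult_right[OF 1, of "-2"] by (simp add: algebra_simps)
      show "((\<lambda>q. l * B e e + B (V' q) (V' q) / l) has_integral
          integral {r..t} (\<lambda>q. l * B e e + B (V' q) (V' q) / l)) {r..t}"
        by (intro integrable_integral integrable_add integrable_on_divide int' integrable_const_ivl)
      show "- 2 * B e (V' q) \<le> l * B e e + B (V' q) (V' q) / l" for q
        using young[OF l, of e "V' q"] by linarith
    qed
    also have "integral {r..t} (\<lambda>q. l * B e e + B (V' q) (V' q) / l) =
        B e e + (t - r) * integral {r..t} (\<lambda>q. B (V' q) (V' q))"
      using rt by (subst integral_add) (auto simp: l_def int' integrable_on_divide integral_divide)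
    finally have "B e e \<le> (t - r) * integral {r..t} (\<lambda>q. B (V' q) (V' q))"
      using V(2) by (simp add: zero_right e_def)
    also have "\<dots> \<le> (t - s) * integral {s..t} (\<lambda>q. B (V' q) (V' q))"
      using r rt int int' sub Dpos
      by (intro mult_mono integral_subset_le integral_nonneg) (auto simp: nonneg)
    finally show ?thesis by (simp add: e_def)
  qed
qed

text \<open>The boundary form is \<open>B (U y) y\<close> at \<open>y = T s X\<close>, where
  \<open>U\<close> is \<open>T' s\<close> composed with the inverse of \<open>T s\<close>. The norm
  of \<open>U\<close> is bounded uniformly near \<open>s0\<close>, \<open>U\<close> is symmetric by
  the Wronskian identity, and Lax's theorem replaces the Hilbert norm by the weak one.\<close>

lemma boundary_locally_bounded:
  assumes s0: "s0 \<in> {0<..<b}" and bij: "bij (blinfun_apply (T s0))"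
  shows "\<exists>\<delta>>0. \<exists>K\<ge>0. \<forall>s. \<bar>s - s0\<bar> < \<delta> \<and> s \<in> {0..b} \<and> bij (blinfun_apply (T s)) \<longrightarrow>
    (\<forall>X. \<bar>boundary s X\<bar> \<le> K * B (T s X) (T s X))"
proof -
  obtain m where m: "0 < m" "\<And>x. m * norm x \<le> norm (T s0 x)"
    using bounded_inverse[OF blinfun.bounded_linear_right bij] by blast
  have s0b: "s0 \<in> {0..b}" using s0 by simp
  have "continuous_on {0..b} T" "continuous_on {0..b} T'"
    by (rule continuous_on_vector_derivative, erule T, rule continuous_on_vector_derivative, erule T')
  then have c: "(T \<longlongrightarrow> T s0) (at s0 within {0..b})" "(T' \<longlongrightarrow> T' s0) (at s0 within {0..b})"
    using s0b by (auto simp: continuous_on_def)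
  obtain d1 where d1: "0 < d1" "\<And>s. s \<in> {0..b} \<Longrightarrow> \<bar>s - s0\<bar> < d1 \<Longrightarrow> norm (T s - T s0) < m / 2"
  proof -
    have "\<forall>\<^sub>F s in at s0 within {0..b}. dist (T s) (T s0) < m / 2" by (rule tendstoD[OF c(1)]) (use m in simp)
    then obtain d where "0 < d" "\<forall>s\<in>{0..b}. s \<noteq> s0 \<and> dist s s0 < d \<longrightarrow> dist (T s) (T s0) < m/2"
      unfolding eventually_at by blast
    then show thesis using that[of d] m by (metis dist_norm dist_self half_gt_zero real_norm_def)
  qed
  obtain d2 where d2: "0 < d2" "\<And>s. s \<in> {0..b} \<Longrightarrow> \<bar>s - s0\<bar> < d2 \<Longrightarrow> norm (T' s - T' s0) < 1"
  proof -
    have "\<forall>\<^sub>F s in at s0 within {0..b}. dist (T' s) (T' s0) < 1" by (rule tendstoD[OF c(2)]) simp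
    then obtain d where "0 < d" "\<forall>s\<in>{0..b}. s \<noteq> s0 \<and> dist s s0 < d \<longrightarrow> dist (T' s) (T' s0) < 1"
      unfolding eventually_at by blast
    then show thesis using that[of d] by (metis dist_norm dist_self zero_less_one real_norm_def)
  qed
  \<comment> \<open>The first factor bounds \<open>T' s\<close> and the second one the inverse of
    \<open>T s\<close> for \<open>s\<close> near \<open>s0\<close>, where half of the lower bound
    \<open>m\<close> of \<open>T s0\<close> persists.\<close>
  define K where "K = (norm (T' s0) + 1) * (2 / m)"
  have "\<bar>boundary s X\<bar> \<le> K * B (T s X) (T s X)"
    if s: "\<bar>s - s0\<bar> < min d1 d2" "s \<in> {0..b}" "bij (blinfun_apply (T s))" for s X
  proof -
    have low: "m / 2 * norm x \<le> norm (T s x)" for x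
    proof -
      have "norm ((T s - T s0) x) \<le> m / 2 * norm x"
        using norm_blinfun[of "T s - T s0" x] d1(2)[of s] s
        by (smt (verit, best) min_less_iff_conj mult_right_mono norm_ge_zero)
      moreover have "T s x = T s0 x + (T s - T s0) x" by (simp add: blinfun.diff_left)
      ultimately show ?thesis using m(2)[of x] norm_diff_ineq[of "T s0 x" "(T s - T s0) x"] by simp
    qed
    define inv where "inv = inv_into UNIV (blinfun_apply (T s))"
    have inv: "T s (inv y) = y" "inv (T s x) = x" for x y
      unfolding inv_def using s(3) by (auto simp: bij_def surj_f_inv_f)
    define U where "U y = T' s (inv y)" for y
    have inv_lin: "inv (x + y) = inv x + inv y" "inv (c *\<^sub>R x) = c *\<^sub>R inv x" for x y c
      by (metis inv blinfun.add_right) (metis inv blinfun.scaleR_right)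
    have nT': "norm (T' s) \<le> norm (T' s0) + 1"
      using d2(2)[of s] s norm_triangle_sub[of "T' s" "T' s0"] by simp
    have bd: "norm (U y) \<le> K * norm y" for y
    proof -
      have "norm (U y) \<le> norm (T' s) * norm (inv y)" unfolding U_def by (rule norm_blinfun)
      also have "\<dots> \<le> (norm (T' s0) + 1) * (2 / m * norm y)"
        using low[of "inv y"] m nT' by (intro mult_mono) (auto simp: inv field_simps)
      finally show ?thesis by (simp only: K_def mult.assoc)
    qed
    have "bounded_linear U"
      by (rule bounded_linear_intro[where K = K])
         (use bd in \<open>auto simp: U_def inv_lin blinfun.bilinear_simps mult.commute\<close>)
    moreover have "B (U x) y = B x (U y)" for x y
      using wronskian[OF s(2), of "inv x" "inv y"] by (simp add: U_def inv)
    moreover have "0 \<le> K" using m by (simp add: K_def)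
    ultimately have "\<bar>B (U (T s X)) (T s X)\<bar> \<le> K * B (T s X) (T s X)"
      using lax_form_bound bd by blast
    then show ?thesis by (simp add: U_def inv boundary_def)
  qed
  moreover have "0 \<le> K" using m by (simp add: K_def)
  moreover have "0 < min d1 d2" using d1 d2 by simp
  ultimately show ?thesis by blast
qed

text \<open>For \<open>V t = 0\<close> the Poincare inequality bounds both the curvature integral
  and the boundary term at \<open>s\<close> by a multiple of the interval length times the integral
  of \<open>B (V' r) (V' r)\<close>. On short intervals they cannot exceed that integral.\<close>

lemma index_bound_local:
  assumes s0: "s0 \<in> {0<..<b}" and bij: "bij (blinfun_apply (T s0))"
  shows "\<exists>\<delta>>0. \<forall>s t. s \<le> s0 \<and> s0 \<le> t \<and> t - s < \<delta> \<and> 0 \<le> s \<and> t \<le> b \<and> bij (blinfun_apply (T s))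
    \<longrightarrow> index_bound s t"
proof -
  obtain \<delta> K where \<delta>: "0 < \<delta>" "0 \<le> K"
    "\<And>s X. \<bar>s - s0\<bar> < \<delta> \<Longrightarrow> s \<in> {0..b} \<Longrightarrow> bij (blinfun_apply (T s)) \<Longrightarrow>
      \<bar>boundary s X\<bar> \<le> K * B (T s X) (T s X)"
    using boundary_locally_bounded[OF assms] by blast
  \<comment> \<open>Length at most 1 allows the square of the length in the curvature term to be
    replaced by the length itself; the last bound then makes both terms together at most
    \<open>D\<close>.\<close>
  define d where "d = min \<delta> (min 1 (1 / (R_bound + K + 1)))"
  have CK: "0 < R_bound + K + 1" using R_bound(1) \<delta>(2) by linarith
  have d: "0 < d" using \<delta>(1) CK by (simp add: d_def)
  have "index_bound s t" if st: "s \<le> s0" "s0 \<le> t" "t - s < d" "0 \<le> s" "t \<le> b" "bij (blinfun_apply (T s))" for s t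
  proof (rule index_boundI)
    fix V V' X assume V: "admissible s t V V'" "V s = T s X" "V t = 0"
    define D where "D = integral {s..t} (\<lambda>r. B (V' r) (V' r))"
    have int: "(\<lambda>r. B (V' r) (V' r)) integrable_on {s..t}" using V by (simp add: admissible_def)
    have D: "0 \<le> D" unfolding D_def by (intro integral_nonneg int nonneg)
    have cV: "continuous_on {s..t} V" using V by (simp add: admissible_def)
    define a where "a = t - s"
    have a: "0 \<le> a" "a \<le> 1" "(R_bound + K + 1) * a \<le> 1" using st CK by (auto simp: a_def d_def field_simps)
    have P: "B (V r) (V r) \<le> a * D" if "r \<in> {s..t}" for r
      using poincare[OF V(1,3), of r] that by (simp add: D_def a_def)
    have RI: "(\<lambda>r. B (R r (V r)) (V r)) integrable_on {s..t}"
      by (intro R_term_integrable cV) (use st in auto)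
    have "integral {s..t} (\<lambda>r. B (R r (V r)) (V r)) \<le> integral {s..t} (\<lambda>r. R_bound * (a * D))"
    proof (rule integral_le[OF RI])
      fix r assume r: "r \<in> {s..t}"
      have "B (R r (V r)) (V r) \<le> R_bound * B (V r) (V r)"
        using R_form_bound[of r "V r"] r st by auto
      also have "\<dots> \<le> R_bound * (a * D)" using P[OF r] R_bound(1) by (intro mult_left_mono)
      finally show "B (R r (V r)) (V r) \<le> R_bound * (a * D)" .
    qed auto
    also have "\<dots> = R_bound * (a * D) * a" using a by (simp add: a_def)
    finally have 1: "integral {s..t} (\<lambda>r. B (R r (V r)) (V r)) \<le> R_bound * (a * D) * a" .
    have "energy s t V V' = D - integral {s..t} (\<lambda>r. B (R r (V r)) (V r))"
      unfolding energy_def D_def by (rule integral_diff[OF int RI])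
    moreover have "\<bar>boundary s X\<bar> \<le> K * (a * D)"
    proof -
      have "\<bar>boundary s X\<bar> \<le> K * B (V s) (V s)"
        unfolding V(2) by (rule \<delta>(3)) (use st in \<open>auto simp: d_def\<close>)
      also have "\<dots> \<le> K * (a * D)" using P[of s] \<delta>(2) st by (intro mult_left_mono) auto
      finally show ?thesis .
    qed
    moreover have "R_bound * (a * D) * a + K * (a * D) \<le> D"
    proof -
      have "R_bound * (a * D) * a \<le> R_bound * (a * D) * 1" using a R_bound(1) D by (intro mult_left_mono) auto
      then have "R_bound * (a * D) * a + K * (a * D) \<le> ((R_bound + K) * a) * D" by (simp add: algebra_simps)
      also have "\<dots> \<le> 1 * D" using a D by (intro mult_right_mono) (auto simp: algebra_simps)
      finally show ?thesis by simp
    qed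
    ultimately show "- boundary s X \<le> energy s t V V'" using 1 by linarith
  qed (use st in auto)
  then show ?thesis using d by blast
qed

section \<open>Perturbations that are small in the weak norm\<close>

definition cross_constant where "cross_constant = 2 + b * (1 + R_bound)"

text \<open>The bound involves \<open>W\<close> and \<open>E\<close> only through their weak norms:
  \<open>cross\<close> contains no derivative of \<open>W\<close>, and \<open>R_weak_bound\<close>
  handles the curvature.\<close>

lemma cross_bound:
  assumes W: "continuous_on {s..t} W" and st: "0 \<le> s" "s \<le> t" "t \<le> b"
    and bd: "\<And>r. r \<in> {s..t} \<Longrightarrow> sqrt (B (W r) (W r)) \<le> w"
    and c: "continuous_on {s..t} f" "continuous_on {s..t} f''"
    and f: "\<And>r. r \<in> {s..t} \<Longrightarrow> \<bar>f r\<bar> \<le> M \<and> \<bar>f' r\<bar> \<le> M \<and> \<bar>f'' r\<bar> \<le> M"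
  shows "\<bar>cross s t W (\<lambda>r. f r *\<^sub>R E) (\<lambda>r. f' r *\<^sub>R E) (\<lambda>r. f'' r *\<^sub>R E)\<bar> \<le> cross_constant * (w * (M * sqrt (B E E)))"
proof -
  define e where "e = sqrt (B E E)"
  have e: "0 \<le> e" by (simp add: e_def nonneg)
  have w: "0 \<le> w" using bd[of s] st nonneg by (smt (verit) atLeastAtMost_iff real_sqrt_ge_zero)
  have M: "0 \<le> M" using f[of s] st by auto
  have 1: "\<bar>B (W r) (k *\<^sub>R E)\<bar> \<le> w * (M * e)" if "r \<in> {s..t}" "\<bar>k\<bar> \<le> M" for r k
  proof -
    have "\<bar>B (W r) E\<bar> \<le> w * e"
      using abs_le[of "W r" E] mult_right_mono[OF bd[OF that(1)] e] by (simp add: e_def)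
    then have "\<bar>k\<bar> * \<bar>B (W r) E\<bar> \<le> M * (w * e)" using that(2) M by (intro mult_mono) auto
    moreover have "\<bar>B (W r) (k *\<^sub>R E)\<bar> = \<bar>k\<bar> * \<bar>B (W r) E\<bar>" by (simp add: scaleR_right abs_mult)
    ultimately have "\<bar>B (W r) (k *\<^sub>R E)\<bar> \<le> M * (w * e)" by simp
    then show ?thesis by (simp add: mult.left_commute)
  qed
  have 2: "\<bar>B (W r) (R r (k *\<^sub>R E))\<bar> \<le> R_bound * (w * (M * e))" if r: "r \<in> {s..t}" "\<bar>k\<bar> \<le> M" for r k
  proof -
    have rb: "r \<in> {0..b}" using r st by auto
    interpret Rr: bounded_linear "R r" by (rule R_linear[OF rb])
    have RE: "sqrt (B (R r E) (R r E)) \<le> R_bound * e"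
      using real_sqrt_le_mono[OF R_weak_bound[OF rb, of E]] R_bound(1)
      by (simp add: real_sqrt_mult e_def)
    have "\<bar>B (W r) (R r (k *\<^sub>R E))\<bar> = \<bar>k\<bar> * \<bar>B (W r) (R r E)\<bar>"
      by (simp add: Rr.scaleR scaleR_right abs_mult)
    also have "\<bar>B (W r) (R r E)\<bar> \<le> w * (R_bound * e)"
      using abs_le[of "W r" "R r E"] mult_mono[OF bd[OF r(1)] RE w] by (simp add: nonneg)
    then have "\<bar>k\<bar> * \<bar>B (W r) (R r E)\<bar> \<le> M * (w * (R_bound * e))"
      using r(2) M by (intro mult_mono) auto
    finally show ?thesis by (simp add: algebra_simps)
  qed
  have ci: "(\<lambda>r. B (W r) (f'' r *\<^sub>R E + R r (f r *\<^sub>R E))) integrable_on {s..t}"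
    by (intro integrable_continuous_real B_continuous W continuous_on_add R_continuous
        continuous_on_scaleR continuous_on_const c) (use st in auto)
  have "norm (integral {s..t} (\<lambda>r. B (W r) (f'' r *\<^sub>R E + R r (f r *\<^sub>R E)))) \<le>
      ((1 + R_bound) * (w * (M * e))) * measure lborel (cbox s t)"
    unfolding cbox_interval[symmetric]
  proof (rule has_integral_bound)
    show "0 \<le> (1 + R_bound) * (w * (M * e))" using R_bound(1) w M e by simp
    show "((\<lambda>r. B (W r) (f'' r *\<^sub>R E + R r (f r *\<^sub>R E))) has_integral
        integral (cbox s t) (\<lambda>r. B (W r) (f'' r *\<^sub>R E + R r (f r *\<^sub>R E)))) (cbox s t)"
      using ci by (simp add: integrable_integral)
    fix r assume "r \<in> cbox s t"
    then have r: "r \<in> {s..t}" by simp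
    show "norm (B (W r) (f'' r *\<^sub>R E + R r (f r *\<^sub>R E))) \<le> (1 + R_bound) * (w * (M * e))"
      using 1[OF r, of "f'' r"] 2[OF r, of "f r"] f[OF r] by (simp add: add_right algebra_simps)
  qed
  also have "\<dots> \<le> ((1 + R_bound) * (w * (M * e))) * b"
    using st R_bound(1) w M e by (intro mult_left_mono) auto
  finally have 3: "\<bar>integral {s..t} (\<lambda>r. B (W r) (f'' r *\<^sub>R E + R r (f r *\<^sub>R E)))\<bar> \<le> ((1 + R_bound) * (w * (M * e))) * b"
    by simp
  \<comment> \<open>The 2 in \<open>cross_constant\<close> counts the end-point terms of
    \<open>cross\<close>, and \<open>b * (1 + R_bound)\<close> comes from its integral.\<close>
  have "\<bar>cross s t W (\<lambda>r. f r *\<^sub>R E) (\<lambda>r. f' r *\<^sub>R E) (\<lambda>r. f'' r *\<^sub>R E)\<bar>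
      \<le> 2 * (w * (M * e)) + ((1 + R_bound) * (w * (M * e))) * b"
    using 1[of t "f' t"] 1[of s "f' s"] f[of s] f[of t] st 3 unfolding cross_def by auto
  then show ?thesis by (simp add: cross_constant_def e_def algebra_simps)
qed

text \<open>Adding \<open>f r *\<^sub>R E\<close> costs little energy when \<open>E\<close> is small
  for \<open>B\<close>, however large its Hilbert norm: the mixed and the quadratic terms of
  \<open>add_C2\<close> both have the form estimated in \<open>cross_bound\<close>.\<close>

lemma perturb:
  fixes E :: 'a
  assumes W: "admissible s t W W'" and st: "0 \<le> s" "s \<le> t" "t \<le> b"
    and bd: "\<And>r. r \<in> {s..t} \<Longrightarrow> sqrt (B (W r) (W r)) \<le> w"
    and c: "continuous_on {s..t} f''"
    and d: "\<And>r. (f has_real_derivative f' r) (at r)" "\<And>r. (f' has_real_derivative f'' r) (at r)"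
    and f: "\<And>r. r \<in> {s..t} \<Longrightarrow> \<bar>f r\<bar> \<le> M \<and> \<bar>f' r\<bar> \<le> M \<and> \<bar>f'' r\<bar> \<le> M"
  defines "m \<equiv> M * sqrt (B E E)"
  shows "admissible s t (\<lambda>r. W r + f r *\<^sub>R E) (\<lambda>r. W' r + f' r *\<^sub>R E)"
    and "energy s t (\<lambda>r. W r + f r *\<^sub>R E) (\<lambda>r. W' r + f' r *\<^sub>R E) \<le> energy s t W W' + cross_constant * (2 * (w * m) + m * m)"
    and "\<And>r. r \<in> {s..t} \<Longrightarrow> sqrt (B (W r + f r *\<^sub>R E) (W r + f r *\<^sub>R E)) \<le> w + m"
proof -
  have cf: "continuous_on {s..t} f" "continuous_on {s..t} f'"
    using d by (auto intro!: continuous_at_imp_continuous_on DERIV_isCont)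
  have V: "C2_on s t (\<lambda>r. f r *\<^sub>R E) (\<lambda>r. f' r *\<^sub>R E) (\<lambda>r. f'' r *\<^sub>R E)"
    unfolding C2_on_def
    using d by (auto intro!: continuous_on_scaleR cf c continuous_on_const
        bounded_linear.has_vector_derivative[OF bounded_linear_scaleR_left]
        simp: has_real_derivative_iff_has_vector_derivative)
  show "admissible s t (\<lambda>r. W r + f r *\<^sub>R E) (\<lambda>r. W' r + f' r *\<^sub>R E)"
    by (rule add_C2(1)[OF W V st])
  have m: "sqrt (B (f r *\<^sub>R E) (f r *\<^sub>R E)) \<le> m" if "r \<in> {s..t}" for r
  proof -
    have "sqrt (B (f r *\<^sub>R E) (f r *\<^sub>R E)) = \<bar>f r\<bar> * sqrt (B E E)"
      by (simp add: scaleR_left scaleR_right real_sqrt_mult flip: mult.assoc)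
    then show ?thesis unfolding m_def using f[OF that] nonneg by (simp add: mult_right_mono)
  qed
  have cW: "continuous_on {s..t} W" using W by (simp add: admissible_def)
  have "\<bar>cross s t W (\<lambda>r. f r *\<^sub>R E) (\<lambda>r. f' r *\<^sub>R E) (\<lambda>r. f'' r *\<^sub>R E)\<bar> \<le> cross_constant * (w * m)"
    unfolding m_def by (rule cross_bound[OF cW st bd cf(1) c f])
  moreover have "\<bar>cross s t (\<lambda>r. f r *\<^sub>R E) (\<lambda>r. f r *\<^sub>R E) (\<lambda>r. f' r *\<^sub>R E) (\<lambda>r. f'' r *\<^sub>R E)\<bar> \<le> cross_constant * (m * m)"
    unfolding m_def
    by (rule cross_bound[OF continuous_on_scaleR[OF cf(1) continuous_on_const] st m[unfolded m_def] cf(1) c f])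
  ultimately show "energy s t (\<lambda>r. W r + f r *\<^sub>R E) (\<lambda>r. W' r + f' r *\<^sub>R E) \<le> energy s t W W' + cross_constant * (2 * (w * m) + m * m)"
    unfolding add_C2(2)[OF W V st] by (simp add: algebra_simps)
  fix r assume r: "r \<in> {s..t}"
  have "sqrt (B (x + y) (x + y)) \<le> sqrt (B x x) + sqrt (B y y)" for x y
  proof (rule real_le_lsqrt)
    have "B (x + y) (x + y) = B x x + 2 * B x y + B y y" by (simp add: add_left add_right sym[of y x])
    also have "\<dots> \<le> (sqrt (B x x) + sqrt (B y y))\<^sup>2"
      using abs_le[of x y] by (simp add: power2_sum nonneg)
    finally show "B (x + y) (x + y) \<le> (sqrt (B x x) + sqrt (B y y))\<^sup>2" .
  qed (simp add: nonneg)
  from order_trans[OF this add_mono[OF bd[OF r] m[OF r]]]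
  show "sqrt (B (W r + f r *\<^sub>R E) (W r + f r *\<^sub>R E)) \<le> w + m" .
qed

lemma weak_norm_bounded:
  fixes s t :: real
  assumes "continuous_on {s..t} W"
  shows "\<exists>w\<ge>0. \<forall>r\<in>{s..t}. sqrt (B (W r) (W r)) \<le> w"
proof -
  have "compact ((\<lambda>r. sqrt (B (W r) (W r))) ` {s..t})"
    by (intro compact_continuous_image continuous_on_real_sqrt B_continuous assms compact_Icc)
  then obtain w where "\<forall>x\<in>(\<lambda>r. sqrt (B (W r) (W r))) ` {s..t}. norm x \<le> w"
    using compact_imp_bounded bounded_iff by metis
  then show ?thesis by (intro exI[of _ "\<bar>w\<bar>"]) (auto simp: abs_le_iff intro: order_trans)
qed

lemma cross_constant_nonneg: "0 \<le> cross_constant"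
  using b R_bound(1) by (simp add: cross_constant_def)

lemma energy_combine:
  assumes "admissible s t W W'" "0 \<le> s" "s \<le> m" "m \<le> t" "t \<le> b"
  shows "energy s m W W' + energy m t W W' = energy s t W W'"
  unfolding energy_def using assms energy_integrable[OF assms(1)]
  by (intro Henstock_Kurzweil_Integration.integral_combine) auto

text \<open>\<open>W m\<close> need not lie in the range of \<open>T m\<close>. A bump that vanishes
  at \<open>s\<close> and \<open>t\<close> moves it to a nearby \<open>T m Z\<close>; the boundary
  terms at \<open>m\<close> cancel when the two inequalities are added, and the cost tends to 0 with
  the weak distance.\<close>

lemma index_bound_compose:
  assumes 1: "index_bound s m" and 2: "index_bound m t"
    and st: "0 \<le> s" "s < m" "m < t" "t \<le> b"
    and dense: "\<And>X e. 0 < e \<Longrightarrow> \<exists>Y. sqrt (B (X - T m Y) (X - T m Y)) < e"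
  shows "index_bound s t"
  unfolding index_bound_def
proof (intro allI impI, elim conjE)
  fix W W' X Y assume W: "admissible s t W W'" "W s = T s X" "W t = T t Y"
  obtain w where w: "0 \<le> w" "\<And>r. r \<in> {s..t} \<Longrightarrow> sqrt (B (W r) (W r)) \<le> w"
    using weak_norm_bounded[of s t W] W(1) unfolding admissible_def by blast
  define c where "c = (m - s) * (t - m)"
  have c: "0 < c" using st by (simp add: c_def)
  \<comment> \<open>A parabola vanishing at \<open>s\<close> and \<open>t\<close>, normalised by
    \<open>c\<close> to have the value 1 at \<open>m\<close>.\<close>
  define f f' f'' where "f r = (r - s) * (t - r) / c" and "f' r = (s + t - 2 * r) / c" and "f'' r = - 2 / c"
    for r :: real
  define M where "M = (b * b + b + 2) / c"
  have der: "(f has_real_derivative f' r) (at r)" "(f' has_real_derivative f'' r) (at r)" for r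
    unfolding f_def f'_def f''_def using c
    by (auto intro!: derivative_eq_intros simp: field_simps)
  have fb: "\<bar>f r\<bar> \<le> M \<and> \<bar>f' r\<bar> \<le> M \<and> \<bar>f'' r\<bar> \<le> M" if r: "r \<in> {s..t}" for r
  proof -
    have "\<bar>(r - s) * (t - r)\<bar> \<le> b * b" unfolding abs_mult using r st by (intro mult_mono) auto
    moreover have "\<bar>s + t - 2 * r\<bar> \<le> b" using r st by auto
    moreover have "0 \<le> b * b" by simp
    ultimately have "\<bar>(r - s) * (t - r)\<bar> \<le> b * b + b + 2" "\<bar>s + t - 2 * r\<bar> \<le> b * b + b + 2"
        "2 \<le> b * b + b + 2" using b by linarith+
    then show ?thesis unfolding f_def f'_def f''_def M_def using c by (auto simp: divide_right_mono)
  qed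
  have M: "0 \<le> M" using fb[of s] st by auto
  have fm: "f s = 0" "f t = 0" "f m = 1" using c by (auto simp: f_def c_def)
  show "boundary t Y - boundary s X \<le> energy s t W W'"
  proof (rule field_le_epsilon)
    fix \<epsilon> :: real assume \<epsilon>: "0 < \<epsilon>"
    have "((\<lambda>e. cross_constant * (2 * (w * (M * e)) + (M * e) * (M * e))) \<longlongrightarrow> cross_constant * (2 * (w * (M * 0)) + (M * 0) * (M * 0))) (at_right 0)"
      by (intro tendsto_intros)
    then have "\<forall>\<^sub>F e in at_right 0. cross_constant * (2 * (w * (M * e)) + (M * e) * (M * e)) < \<epsilon>"
      using order_tendstoD(2) \<epsilon> by fastforce
    then obtain e0 where e0: "0 < e0" "\<And>e. 0 < e \<Longrightarrow> e < e0 \<Longrightarrow> cross_constant * (2 * (w * (M * e)) + (M * e) * (M * e)) < \<epsilon>"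
      unfolding eventually_at_right_field by blast
    define e where "e = e0 / 2"
    have e: "0 < e" "cross_constant * (2 * (w * (M * e)) + (M * e) * (M * e)) < \<epsilon>"
      using e0(1) e0(2)[of "e0 / 2"] unfolding e_def by auto
    obtain Z where Z: "sqrt (B (W m - T m Z) (W m - T m Z)) < e" using dense[OF e(1)] by blast
    define E where "E = T m Z - W m"
    have E: "sqrt (B E E) < e" using Z by (simp add: E_def diff_left diff_right algebra_simps)
    define W1 W1' where "W1 = (\<lambda>r. W r + f r *\<^sub>R E)" and "W1' = (\<lambda>r. W' r + f' r *\<^sub>R E)"
    have st': "s \<le> t" using st by simp
    note P = perturb[where E = E, OF W(1) st(1) st' st(4) w(2) _ der fb]
    have cf: "continuous_on {s..t} f''" by (simp add: f''_def)
    have adm: "admissible s t W1 W1'" unfolding W1_def W1'_def by (rule P(1)[OF _ cf])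
    have "energy s t W1 W1' \<le> energy s t W W' + cross_constant * (2 * (w * (M * sqrt (B E E))) + (M * sqrt (B E E)) * (M * sqrt (B E E)))"
      unfolding W1_def W1'_def by (rule P(2)[OF _ cf])
    also have "\<dots> \<le> energy s t W W' + cross_constant * (2 * (w * (M * e)) + (M * e) * (M * e))"
    proof -
      have k: "M * sqrt (B E E) \<le> M * e" using E M by (intro mult_left_mono) auto
      have "0 \<le> M * sqrt (B E E)" using M nonneg[of E] by simp
      then have "(M * sqrt (B E E)) * (M * sqrt (B E E)) \<le> (M * e) * (M * e)"
        by (intro mult_mono k order_trans[OF _ k])
      moreover have "w * (M * sqrt (B E E)) \<le> w * (M * e)" by (rule mult_left_mono[OF k w(1)])
      ultimately show ?thesis by (intro add_left_mono mult_left_mono cross_constant_nonneg) linarith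
    qed
    finally have le: "energy s t W1 W1' \<le> energy s t W W' + \<epsilon>" using e by simp
    have v: "W1 s = T s X" "W1 m = T m Z" "W1 t = T t Y" using W fm by (auto simp: W1_def E_def)
    have "boundary m Z - boundary s X \<le> energy s m W1 W1'"
      using 1 admissible_subset[OF adm, of s m] v st unfolding index_bound_def by auto
    moreover have "boundary t Y - boundary m Z \<le> energy m t W1 W1'"
      using 2 admissible_subset[OF adm, of m t] v st unfolding index_bound_def by auto
    ultimately show "boundary t Y - boundary s X \<le> energy s t W W' + \<epsilon>"
      using le energy_combine[OF adm, of m] st by auto
  qed
qed

text \<open>On \<open>{s + h..t - h}\<close> the end values of \<open>W\<close> are corrected to
  values of the flow at \<open>X\<close> and \<open>Y\<close> by affine multiples of the defects
  \<open>E1\<close> and \<open>E2\<close>. The defects tend to 0 with \<open>h\<close>, so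
  continuity of the flow at \<open>s\<close> and \<open>t\<close> is enough, whatever its kernel or
  range there.\<close>

lemma index_bound_closure:
  assumes st: "0 \<le> s" "s < t" "t \<le> b"
    and inner: "\<And>r1 r2. s < r1 \<Longrightarrow> r1 < r2 \<Longrightarrow> r2 < t \<Longrightarrow> index_bound r1 r2"
  shows "index_bound s t"
  unfolding index_bound_def
proof (intro allI impI, elim conjE)
  fix W W' X Y assume W: "admissible s t W W'" "W s = T s X" "W t = T t Y"
  have cW: "continuous_on {s..t} W" using W by (simp add: admissible_def)
  obtain w where w: "0 \<le> w" "\<And>r. r \<in> {s..t} \<Longrightarrow> sqrt (B (W r) (W r)) \<le> w"
    using weak_norm_bounded[OF cW] by blast
  \<comment> \<open>For \<open>h < (t - s) / 4\<close> the inner interval has length at least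
    \<open>(t - s) / 2\<close>, so \<open>2 / (t - s)\<close> bounds the slopes of the affine
    weights; the 1 bounds the weights themselves.\<close>
  define M where "M = 1 + 2 / (t - s)"
  have M: "0 \<le> M" using st by (simp add: M_def)
  define E1 E2 where "E1 r = T r X - W r" and "E2 r = T r Y - W r" for r
  define m1 m2 where "m1 h = M * sqrt (B (E1 (s + h)) (E1 (s + h)))"
    and "m2 h = M * sqrt (B (E2 (t - h)) (E2 (t - h)))" for h
  \<comment> \<open>The energy of \<open>W\<close> up to time \<open>r\<close>. It is continuous in
    \<open>r\<close>, and its increments are the energies on the inner intervals.\<close>
  define F where "F r = integral {s..r} (\<lambda>r. B (W' r) (W' r) - B (R r (W r)) (W r))" for r
  define rhs where "rhs h = F (t - h) - F (s + h) + cross_constant * (2 * (w * m1 h) + m1 h * m1 h)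
      + cross_constant * (2 * ((w + m1 h) * m2 h) + m2 h * m2 h)" for h
  have int: "(\<lambda>r. B (W' r) (W' r) - B (R r (W r)) (W r)) integrable_on {s..t}"
    using energy_integrable[OF W(1)] st by simp
  have main: "boundary (t - h) Y - boundary (s + h) X \<le> rhs h" if h: "0 < h" "h < (t - s) / 4" for h
  proof -
    define p q where "p = s + h" and "q = t - h"
    have pq: "s < p" "p < q" "q < t" "0 \<le> p" "p \<le> q" "q \<le> b" "(t - s) / 2 \<le> q - p"
      using h st by (auto simp: p_def q_def field_simps)
    have lt: "\<bar>1 / (q - p)\<bar> \<le> M"
    proof -
      have "1 / (q - p) \<le> 1 / ((t - s) / 2)" using pq st by (intro divide_left_mono) auto
      then show ?thesis using pq st by (simp add: M_def)
    qed
    have sub: "{p..q} \<subseteq> {s..t}" using pq by auto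
    define f g where "f r = (q - r) / (q - p)" and "g r = (r - p) / (q - p)" for r
    have df: "(f has_real_derivative - 1 / (q - p)) (at r)" "((\<lambda>r. - 1 / (q - p)) has_real_derivative 0) (at r)" for r
      unfolding f_def using pq by (auto intro!: derivative_eq_intros simp: divide_simps)
    have dg: "(g has_real_derivative 1 / (q - p)) (at r)" "((\<lambda>r. 1 / (q - p)) has_real_derivative 0) (at r)" for r
      unfolding g_def using pq by (auto intro!: derivative_eq_intros)
    have M1: "1 \<le> M" using st by (simp add: M_def)
    have bf: "\<bar>f r\<bar> \<le> M \<and> \<bar>- 1 / (q - p)\<bar> \<le> M \<and> \<bar>0::real\<bar> \<le> M"
      and bg: "\<bar>g r\<bar> \<le> M \<and> \<bar>1 / (q - p)\<bar> \<le> M \<and> \<bar>0::real\<bar> \<le> M" if "r \<in> {p..q}" for r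
    proof -
      have "\<bar>f r\<bar> \<le> 1" "\<bar>g r\<bar> \<le> 1" using that pq by (auto simp: f_def g_def)
      then show "\<bar>f r\<bar> \<le> M \<and> \<bar>- 1 / (q - p)\<bar> \<le> M \<and> \<bar>0::real\<bar> \<le> M"
        "\<bar>g r\<bar> \<le> M \<and> \<bar>1 / (q - p)\<bar> \<le> M \<and> \<bar>0::real\<bar> \<le> M"
        using lt M1 by auto
    qed
    have adm: "admissible p q W W'" using admissible_subset[OF W(1), of p q] pq by simp
    have w': "sqrt (B (W r) (W r)) \<le> w" if "r \<in> {p..q}" for r using w(2) that sub by blast
    note P1 = perturb[where E = "E1 p", OF adm pq(4-6) w' continuous_on_const df bf]
    have m1: "M * sqrt (B (E1 p) (E1 p)) = m1 h" by (simp add: m1_def p_def)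
    have m2: "M * sqrt (B (E2 q) (E2 q)) = m2 h" by (simp add: m2_def q_def)
    define W1 W1' where "W1 = (\<lambda>r. W r + f r *\<^sub>R E1 p)" and "W1' = (\<lambda>r. W' r + (- 1 / (q - p)) *\<^sub>R E1 p)"
    have adm1: "admissible p q W1 W1'" unfolding W1_def W1'_def by (rule P1(1))
    have e1: "energy p q W1 W1' \<le> energy p q W W' + cross_constant * (2 * (w * m1 h) + m1 h * m1 h)"
      unfolding W1_def W1'_def m1[symmetric] by (rule P1(2))
    have w1: "sqrt (B (W1 r) (W1 r)) \<le> w + m1 h" if "r \<in> {p..q}" for r
      unfolding W1_def m1[symmetric] by (rule P1(3)) (use that in simp_all)
    note P2 = perturb[where E = "E2 q", OF adm1 pq(4-6) w1 continuous_on_const dg bg]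
    define W2 W2' where "W2 = (\<lambda>r. W1 r + g r *\<^sub>R E2 q)" and "W2' = (\<lambda>r. W1' r + (1 / (q - p)) *\<^sub>R E2 q)"
    have adm2: "admissible p q W2 W2'" unfolding W2_def W2'_def by (rule P2(1))
    have e2: "energy p q W2 W2' \<le> energy p q W1 W1' + cross_constant * (2 * ((w + m1 h) * m2 h) + m2 h * m2 h)"
      unfolding W2_def W2'_def m2[symmetric] by (rule P2(2))
    have "f p = 1" "f q = 0" "g p = 0" "g q = 1" using pq by (auto simp: f_def g_def)
    then have "W2 p = T p X" "W2 q = T q Y" by (auto simp: W2_def W1_def E1_def E2_def)
    then have "boundary q Y - boundary p X \<le> energy p q W2 W2'"
      using inner[OF pq(1-3)] adm2 unfolding index_bound_def by blast
    moreover have "energy p q W W' = F q - F p"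
    proof -
      have "F p + energy p q W W' = F q" unfolding F_def energy_def
        using pq int by (intro Henstock_Kurzweil_Integration.integral_combine)
          (auto intro: integrable_on_subinterval)
      then show ?thesis by simp
    qed
    ultimately show ?thesis using e1 e2 unfolding rhs_def p_def q_def by linarith
  qed
  have sF: "continuous_on {s..t} F" unfolding F_def by (rule indefinite_integral_continuous_1[OF int])
  have cst: "{s..t} \<subseteq> {0..b}" using st by auto
  have L1: "((\<lambda>h. s + h) \<longlongrightarrow> s) (at_right 0)" "((\<lambda>h. t - h) \<longlongrightarrow> t) (at_right 0)"
    by (auto intro!: tendsto_eq_intros)
  have ev: "\<forall>\<^sub>F h in at_right 0. s + h \<in> {s..t}" "\<forall>\<^sub>F h in at_right 0. t - h \<in> {s..t}"
    using st unfolding eventually_at_right_field by (auto intro!: exI[of _ "t - s"])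
  have l: "((\<lambda>h. k (s + h)) \<longlongrightarrow> k s) (at_right 0)" "((\<lambda>h. k (t - h)) \<longlongrightarrow> k t) (at_right 0)"
    if "continuous_on {s..t} k" for k :: "real \<Rightarrow> real"
    using continuous_on_tendsto_compose[OF that L1(1) _ ev(1)] continuous_on_tendsto_compose[OF that L1(2) _ ev(2)] st
    by auto
  have cb: "continuous_on {s..t} (\<lambda>r. boundary r Z)" for Z
    unfolding boundary_def by (intro B_continuous continuous_on_subset[OF T_cont(1) cst] continuous_on_subset[OF T_cont(2) cst])
  have cE: "continuous_on {s..t} (\<lambda>r. M * sqrt (B (E1 r) (E1 r)))" "continuous_on {s..t} (\<lambda>r. M * sqrt (B (E2 r) (E2 r)))"
    unfolding E1_def E2_def
    by (intro continuous_on_mult continuous_on_const continuous_on_real_sqrt B_continuous continuous_on_diff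
        continuous_on_subset[OF T_cont(1) cst] cW)+
  have m: "(m1 \<longlongrightarrow> 0) (at_right 0)" "(m2 \<longlongrightarrow> 0) (at_right 0)"
    using l(1)[OF cE(1)] l(2)[OF cE(2)] W
    by (simp_all add: m1_def[abs_def] m2_def[abs_def] E1_def E2_def zero_left)
  have "(rhs \<longlongrightarrow> F t - F s + cross_constant * (2 * (w * 0) + 0 * 0) + cross_constant * (2 * ((w + 0) * 0) + 0 * 0)) (at_right 0)"
    unfolding rhs_def by (intro tendsto_intros l sF m)
  moreover have "((\<lambda>h. boundary (t - h) Y - boundary (s + h) X) \<longlongrightarrow> boundary t Y - boundary s X) (at_right 0)"
    by (intro tendsto_diff l cb)
  moreover have "\<forall>\<^sub>F h in at_right 0. boundary (t - h) Y - boundary (s + h) X \<le> rhs h"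
    using main st unfolding eventually_at_right_field by (intro exI[of _ "(t - s) / 4"]) auto
  ultimately have "boundary t Y - boundary s X \<le> F t - F s + cross_constant * (2 * (w * 0) + 0 * 0) + cross_constant * (2 * ((w + 0) * 0) + 0 * 0)"
    by (rule tendsto_le[OF trivial_limit_at_right_real])
  then show "boundary t Y - boundary s X \<le> energy s t W W'" by (simp add: F_def energy_def)
qed

text \<open>\<open>index_bound_closure\<close> leaves compact subintervals of
  \<open>{s<..<t}\<close>, on which bisection assembles the local inequalities; at each division
  point the flow is onto, so that \<open>index_bound_compose\<close> applies.\<close>

lemma index_bound_regular:
  assumes st: "0 \<le> s" "s < t" "t \<le> b" and bij: "\<And>r. r \<in> {s<..<t} \<Longrightarrow> bij (blinfun_apply (T r))"
  shows "index_bound s t"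
proof (rule index_bound_closure[OF st])
  fix r1 r2 assume r: "s < r1" "r1 < r2" "r2 < t"
  \<comment> \<open>The guard makes \<open>P\<close> vacuous on degenerate intervals and on those
    that leave \<open>{r1..r2}\<close>, so that bisection may be run over all pairs \<open>p\<close>
    and \<open>q\<close>.\<close>
  define P where "P p q \<longleftrightarrow> (r1 \<le> p \<and> p < q \<and> q \<le> r2 \<longrightarrow> index_bound p q)" for p q
  have "P r1 r2"
  proof (rule Bolzano)
    show "r1 \<le> r2" using r by simp
    fix x y z assume xyz: "P x y" "P y z" "x \<le> y" "y \<le> z"
    show "P x z" unfolding P_def
    proof (intro impI)
      assume a: "r1 \<le> x \<and> x < z \<and> z \<le> r2"
      show "index_bound x z"
      proof (cases "x = y \<or> y = z")
        case True then show ?thesis using xyz a by (auto simp: P_def)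
      next
        case False
        then have y: "x < y" "y < z" using xyz by auto
        have "surj (blinfun_apply (T y))" using bij[of y] a r y by (auto simp: bij_def)
        then have dn: "\<exists>Y. sqrt (B (X - T y Y) (X - T y Y)) < e" if "0 < e" for X e
        proof -
          obtain Y where "X = T y Y" using \<open>surj (blinfun_apply (T y))\<close> by (rule surjE)
          then show ?thesis using that by (intro exI[of _ Y]) (simp add: zero_left)
        qed
        show ?thesis
        proof (rule index_bound_compose[of x y z])
          show "index_bound x y" "index_bound y z" using xyz(1,2) a y unfolding P_def by auto
          show "\<exists>Y. sqrt (B (X - T y Y) (X - T y Y)) < e" if "0 < e" for X e by (rule dn[OF that])
        qed (use a y r st in auto)
      qed
    qed
  next
    fix x assume x: "r1 \<le> x" "x \<le> r2"
    then have "x \<in> {0<..<b}" "bij (blinfun_apply (T x))" using r st bij[of x] by auto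
    then obtain d where d: "0 < d" "\<And>p q. p \<le> x \<Longrightarrow> x \<le> q \<Longrightarrow> q - p < d \<Longrightarrow> 0 \<le> p \<Longrightarrow> q \<le> b \<Longrightarrow>
        bij (blinfun_apply (T p)) \<Longrightarrow> index_bound p q"
      using index_bound_local[of x] by blast
    have "P p q" if pq: "p \<le> x \<and> x \<le> q \<and> q - p < d" for p q
      unfolding P_def
    proof (intro impI)
      assume a: "r1 \<le> p \<and> p < q \<and> q \<le> r2"
      show "index_bound p q"
        by (rule d(2)) (use a pq r st in \<open>auto intro!: bij\<close>)
    qed
    then show "\<exists>d>0. \<forall>p q. p \<le> x \<and> x \<le> q \<and> q - p < d \<longrightarrow> P p q" using d(1) by blast
  qed
  then show "index_bound r1 r2" using r by (simp add: P_def)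
qed

text \<open>By finiteness every time \<open>x\<close> has a neighbourhood with no singular interior
  time except possibly \<open>x\<close> itself. Small intervals with \<open>x\<close> as an end
  point are then regular inside, and they are joined at \<open>x\<close> by surjectivity or by
  density of the range.\<close>

theorem index_bound_total:
  assumes inj: "\<And>t. t \<in> {0<..<b} \<Longrightarrow> inj (blinfun_apply (T t))"
    and fin: "finite {t \<in> {0<..<b}. \<not> surj (blinfun_apply (T t))}"
    and dense: "\<And>t X e. t \<in> {0<..<b} \<Longrightarrow> \<not> surj (blinfun_apply (T t)) \<Longrightarrow> 0 < e \<Longrightarrow>
      \<exists>Y. sqrt (B (X - T t Y) (X - T t Y)) < e"
  shows "index_bound 0 b"
proof -
  define P where "P p q \<longleftrightarrow> (0 \<le> p \<and> p < q \<and> q \<le> b \<longrightarrow> index_bound p q)" for p q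
  have compose: "P x z" if xyz: "P x y" "P y z" "x \<le> y" "y \<le> z" for x y z
    unfolding P_def
  proof (intro impI)
    assume a: "0 \<le> x \<and> x < z \<and> z \<le> b"
    show "index_bound x z"
    proof (cases "x = y \<or> y = z")
      case True then show ?thesis using xyz a by (auto simp: P_def)
    next
      case False
      then have y: "x < y" "y < z" "y \<in> {0<..<b}" using xyz a by auto
      have dn: "\<exists>Y. sqrt (B (X - T y Y) (X - T y Y)) < e" if "0 < e" for X e
      proof (cases "surj (blinfun_apply (T y))")
        case True
        then obtain Y where "X = T y Y" by (rule surjE)
        then show ?thesis using that by (intro exI[of _ Y]) (simp add: zero_left)
      next
        case False
        then show ?thesis using dense y that by blast
      qed
      show ?thesis
      proof (rule index_bound_compose[of x y z])
        show "index_bound x y" "index_bound y z" using xyz(1,2) a y unfolding P_def by auto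
        show "\<exists>Y. sqrt (B (X - T y Y) (X - T y Y)) < e" if "0 < e" for X e by (rule dn[OF that])
      qed (use a y in auto)
    qed
  qed
  have "P 0 b"
  proof (rule Bolzano[where P = P])
    show "0 \<le> b" using b by simp
    fix x assume x: "0 \<le> x" "x \<le> b"
    define S where "S = {t \<in> {0<..<b}. \<not> surj (blinfun_apply (T t))}"
    obtain d where d: "0 < d" "\<forall>y\<in>S. y \<noteq> x \<longrightarrow> d \<le> dist x y"
      using finite_set_avoid[of S x] fin unfolding S_def by blast
    have reg: "P p q" if pq: "p = x \<or> q = x" "q - p < d" for p q
      unfolding P_def
    proof (intro impI)
      assume a: "0 \<le> p \<and> p < q \<and> q \<le> b"
      show "index_bound p q"
      proof (rule index_bound_regular)
        fix r assume r: "r \<in> {p<..<q}"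
        then have "r \<noteq> x" "dist x r < d" "r \<in> {0<..<b}" using pq a by (auto simp: dist_real_def)
        then have "r \<notin> S" using d(2) by fastforce
        then show "bij (blinfun_apply (T r))" using \<open>r \<in> {0<..<b}\<close> inj unfolding S_def bij_def by simp
      qed (use a in auto)
    qed
    have "P p q" if pq: "p \<le> x \<and> x \<le> q \<and> q - p < d" for p q
      by (rule compose[of p x q]) (use pq reg in auto)
    then show "\<exists>d>0. \<forall>p q. p \<le> x \<and> x \<le> q \<and> q - p < d \<longrightarrow> P p q" using d(1) by blast
  qed (rule compose)
  then show ?thesis using b by (simp add: P_def)
qed

section \<open>Concatenation of admissible paths and subtraction of a Jacobi field\<close>

lemma admissible_combine:
  assumes 1: "admissible s m W W'" and 2: "admissible m t W W'" and st: "s \<le> m" "m \<le> t"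
  shows "admissible s t W W'"
proof -
  obtain S1 where S1: "finite S1" "\<forall>r\<in>{s<..<m} - S1. (W has_vector_derivative W' r) (at r)"
    using 1 unfolding admissible_def by blast
  obtain S2 where S2: "finite S2" "\<forall>r\<in>{m<..<t} - S2. (W has_vector_derivative W' r) (at r)"
    using 2 unfolding admissible_def by blast
  have un: "{s..t} = {s..m} \<union> {m..t}" using st by auto
  have "continuous_on {s..t} W" unfolding un
    using 1 2 unfolding admissible_def by (intro continuous_on_closed_Un) auto
  moreover have "(\<lambda>r. B (W' r) (W' r)) integrable_on {s..t}"
    using 1 2 unfolding admissible_def
    by (intro Henstock_Kurzweil_Integration.integrable_combine[OF st]) auto
  moreover have "finite (S1 \<union> S2 \<union> {m})" using S1 S2 by simp
  moreover have "(W has_vector_derivative W' r) (at r)" if "r \<in> {s<..<t} - (S1 \<union> S2 \<union> {m})" for r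
    using that S1(2) S2(2) by (cases "r < m") auto
  ultimately show ?thesis
    unfolding admissible_def by (intro conjI exI[of _ "S1 \<union> S2 \<union> {m}"] ballI)
qed

lemma C2_on_minus: "C2_on s t V V' V'' \<Longrightarrow> C2_on s t (\<lambda>r. - V r) (\<lambda>r. - V' r) (\<lambda>r. - V'' r)"
  unfolding C2_on_def by (auto intro!: continuous_on_minus has_vector_derivative_minus)

text \<open>The reduction to fields \<open>W = Z - J\<close> vanishing at \<open>b\<close>: \<open>J\<close> is orthogonal to \<open>W\<close> with respect to
  the index form up to a term at \<open>0\<close>.\<close>

lemma energy_minus_jacobi:
  assumes Z: "admissible 0 b Z Z'" and J: "C2_on 0 b J J' (\<lambda>r. - R r (J r))" and eq: "J b = Z b"
  shows "admissible 0 b (\<lambda>r. Z r - J r) (\<lambda>r. Z' r - J' r)"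
    and "energy 0 b Z Z' = energy 0 b (\<lambda>r. Z r - J r) (\<lambda>r. Z' r - J' r)
      - 2 * B (Z 0 - J 0) (J' 0) + energy 0 b J J'"
proof -
  have st: "0 \<le> (0::real)" "0 \<le> b" "b \<le> b" using b by auto
  show W: "admissible 0 b (\<lambda>r. Z r - J r) (\<lambda>r. Z' r - J' r)"
    using add_C2(1)[OF Z C2_on_minus[OF J] st] by simp
  have "cross 0 b (\<lambda>r. Z r - J r) J J' (\<lambda>r. - R r (J r)) = - B (Z 0 - J 0) (J' 0)"
    using eq by (simp add: cross_def zero_left zero_right)
  then show "energy 0 b Z Z' = energy 0 b (\<lambda>r. Z r - J r) (\<lambda>r. Z' r - J' r)
      - 2 * B (Z 0 - J 0) (J' 0) + energy 0 b J J'"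
    using add_C2(2)[OF W J st] energy_C2[OF J st] by simp
qed

end

section \<open>Weak Riemannian Hilbert manifolds and their curvature\<close>

lemma bounded_linear_if_continuous:
  fixes f :: "'a::real_normed_vector \<Rightarrow> 'b::real_normed_vector"
  assumes "linear f" "continuous_on UNIV f"
  shows "bounded_linear f"
proof -
  have "isCont f 0" using assms(2) by (simp add: continuous_on_eq_continuous_at)
  then have "\<exists>d>0. \<forall>x. dist x 0 < d \<longrightarrow> dist (f x) (f 0) < 1"
    unfolding continuous_at_eps_delta by (metis zero_less_one)
  then obtain d where d: "0 < d" "\<And>x. norm x < d \<Longrightarrow> norm (f x) < 1"
    using linear_0[OF assms(1)] by auto
  have "norm (f x) \<le> norm x * (2 / d)" for x
  proof (cases "x = 0")
    case True then show ?thesis using linear_0[OF assms(1)] by simp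
  next
    case False
    have "norm (f ((d / (2 * norm x)) *\<^sub>R x)) < 1" by (rule d(2)) (use False d in simp)
    then show ?thesis using False d by (simp add: linear_cmul[OF assms(1)] field_simps)
  qed
  then show ?thesis
    by (intro bounded_linear_intro[where K = "2 / d"] linear_add linear_cmul assms(1))
qed

lemma smooth_onD:
  assumes "smooth_on S f"
  shows "x \<in> S \<Longrightarrow> f differentiable (at x)" "continuous_on S f"
    "smooth_on S (\<lambda>x. frechet_derivative f (at x) v)"
    "continuous_on S (\<lambda>x. frechet_derivative f (at x) v)"
proof -
  have k: "k_smooth_on k S f" for k using assms by (simp add: smooth_on_def)
  show "x \<in> S \<Longrightarrow> f differentiable (at x)" using k[of 1] by simp
  show "continuous_on S f" using k[of 0] by simp
  show "smooth_on S (\<lambda>x. frechet_derivative f (at x) v)"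
    unfolding smooth_on_def using k[of "Suc _"] by simp
  show "continuous_on S (\<lambda>x. frechet_derivative f (at x) v)" using k[of 1] by simp
qed

lemma smooth_on_symmetric:
  fixes f :: "'a::real_normed_vector \<Rightarrow> 'b::real_inner"
  assumes "smooth_on S f" "open S" "x \<in> S"
  shows "frechet_derivative (\<lambda>y. frechet_derivative f (at y) a) (at x) b =
         frechet_derivative (\<lambda>y. frechet_derivative f (at y) b) (at x) a"
  by (rule second_derivative_symmetric[OF assms(2,3) smooth_onD(1)[OF assms(1)]])
     (auto intro: smooth_onD(1)[OF smooth_onD(3)[OF assms(1)] assms(3)])

locale weak_riemannian =
  fixes A :: "('m::t2_space, 'a::{real_inner, complete_space}) chart set"
    and g :: "'m \<Rightarrow> 'a \<Rightarrow> 'a \<Rightarrow> real"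
    and \<Gamma> :: "('m, 'a) chart \<Rightarrow> 'a \<Rightarrow> 'a \<Rightarrow> 'a \<Rightarrow> 'a"
  assumes manifold: "hilbert_manifold A"
    and metric: "weak_riemannian_metric A g"
    and lc: "levi_civita A g \<Gamma>"
begin

section \<open>Charts and changes of components\<close>

lemma chart: "C \<in> A \<Longrightarrow> is_chart C"
  using manifold by (simp add: hilbert_manifold_def)

lemma chart_inverse:
  assumes "C \<in> A"
  shows "p \<in> fst C \<Longrightarrow> chart_inv C (snd C p) = p"
    "x \<in> chart_image C \<Longrightarrow> snd C (chart_inv C x) = x"
    "x \<in> chart_image C \<Longrightarrow> chart_inv C x \<in> fst C"
    "p \<in> fst C \<Longrightarrow> snd C p \<in> chart_image C"
  using chart[OF assms] unfolding is_chart_def homeomorphism_def chart_image_def by auto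

lemma chart_open: "C \<in> A \<Longrightarrow> open (fst C)" "C \<in> A \<Longrightarrow> open (chart_image C)"
  using chart unfolding is_chart_def by auto

lemma chart_continuous:
  "C \<in> A \<Longrightarrow> continuous_on (fst C) (snd C)"
  "C \<in> A \<Longrightarrow> continuous_on (chart_image C) (chart_inv C)"
  using chart unfolding is_chart_def homeomorphism_def by auto

lemma overlap_open:
  assumes "C \<in> A" "open U" shows "open (snd C ` (fst C \<inter> U))"
proof -
  have "snd C ` (fst C \<inter> U) = chart_image C \<inter> chart_inv C -` U"
    using chart_inverse[OF assms(1)] by (force simp: image_iff)
  then show ?thesis
    using continuous_open_preimage[OF chart_continuous(2) chart_open(2) assms(2)] assms(1) by simp
qed

lemma chart_at: "chart_at A p \<in> A" "p \<in> fst (chart_at A p)"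
proof -
  have "\<exists>C. C \<in> A \<and> p \<in> fst C" using manifold unfolding hilbert_manifold_def by blast
  from someI_ex[OF this] show "chart_at A p \<in> A" "p \<in> fst (chart_at A p)"
    unfolding chart_at_def by auto
qed

lemma transition_smooth:
  "C \<in> A \<Longrightarrow> D \<in> A \<Longrightarrow> smooth_on (snd C ` (fst C \<inter> fst D)) (transition C D)"
  using manifold unfolding hilbert_manifold_def compatible_def by blast

lemma transition_apply: "C \<in> A \<Longrightarrow> p \<in> fst C \<Longrightarrow> transition C D (snd C p) = snd D p"
  by (simp add: transition_def chart_inverse)

lemma transition_derivative:
  assumes "C \<in> A" "D \<in> A" "p \<in> fst C" "p \<in> fst D"
  shows "(transition C D has_derivative change_components C D p) (at (snd C p))"
proof -
  have "transition C D differentiable (at (snd C p))"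
    using smooth_onD(1)[OF transition_smooth[OF assms(1,2)]] assms(3,4) by blast
  then show ?thesis unfolding frechet_derivative_works change_components_def .
qed

lemma change_components_linear:
  assumes "C \<in> A" "D \<in> A" "p \<in> fst C" "p \<in> fst D"
  shows "bounded_linear (change_components C D p)"
  using transition_derivative[OF assms] has_derivative_bounded_linear by blast

lemma change_components_compose:
  assumes "C \<in> A" "D \<in> A" "E \<in> A" "p \<in> fst C" "p \<in> fst D" "p \<in> fst E"
  shows "change_components D E p (change_components C D p u) = change_components C E p u"
proof -
  have 1: "(transition D E has_derivative change_components D E p) (at (transition C D (snd C p)))"
    using transition_derivative[of D E p] assms by (simp add: transition_apply)
  have 2: "((\<lambda>x. transition D E (transition C D x)) has_derivative
      (\<lambda>u. change_components D E p (change_components C D p u))) (at (snd C p))"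
    by (rule has_derivative_compose[OF transition_derivative[of C D p] 1]) (use assms in auto)
  have "(transition C E has_derivative
      (\<lambda>u. change_components D E p (change_components C D p u))) (at (snd C p))"
  proof (rule has_derivative_transform_within_open[OF 2])
    show "open (snd C ` (fst C \<inter> (fst D \<inter> fst E)))"
      by (rule overlap_open[OF assms(1) open_Int[OF chart_open(1)[OF assms(2)] chart_open(1)[OF assms(3)]]])
    show "snd C p \<in> snd C ` (fst C \<inter> (fst D \<inter> fst E))" using assms by auto
    fix x assume "x \<in> snd C ` (fst C \<inter> (fst D \<inter> fst E))"
    then show "transition D E (transition C D x) = transition C E x"
      using assms by (auto simp: transition_apply)
  qed
  then show ?thesis
    using has_derivative_unique[OF _ transition_derivative[of C E p]] assms by metis
qed

lemma change_components_id:
  assumes "C \<in> A" "p \<in> fst C"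
  shows "change_components C C p u = u"
proof -
  have "(transition C C has_derivative (\<lambda>u. u)) (at (snd C p))"
  proof (rule has_derivative_transform_within_open[OF has_derivative_ident])
    show "open (chart_image C)" "snd C p \<in> chart_image C"
      using assms chart_open chart_inverse by auto
    fix x assume "x \<in> chart_image C"
    then show "x = transition C C x" using assms by (simp add: transition_def chart_inverse)
  qed
  then show ?thesis
    using has_derivative_unique[OF _ transition_derivative[OF assms(1,1,2,2)]] by metis
qed

lemma coord_chart_at: "coord A (chart_at A p) p X = X"
  unfolding coord_def by (rule change_components_id[OF chart_at])

lemma coord_change:
  assumes "C \<in> A" "D \<in> A" "p \<in> fst C" "p \<in> fst D"
  shows "coord A D p X = change_components C D p (coord A C p X)"
  unfolding coord_def using change_components_compose[OF chart_at(1) assms(1,2) chart_at(2) assms(3,4)] by simp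

lemma coord_tangent:
  assumes "C \<in> A" "p \<in> fst C"
  shows "coord A C p (tangent_of_coord A C p u) = u" "tangent_of_coord A C p (coord A C p X) = X"
  unfolding coord_def tangent_of_coord_def
  using change_components_compose[OF assms(1) chart_at(1) assms(1) assms(2) chart_at(2) assms(2)]
    change_components_compose[OF chart_at(1) assms(1) chart_at(1) chart_at(2) assms(2) chart_at(2)]
    change_components_id assms chart_at by auto

lemma coord_linear:
  assumes "C \<in> A" "p \<in> fst C"
  shows "bounded_linear (coord A C p)" "bounded_linear (tangent_of_coord A C p)"
  using change_components_linear[OF chart_at(1) assms(1) chart_at(2) assms(2)]
    change_components_linear[OF assms(1) chart_at(1) assms(2) chart_at(2)]
  unfolding coord_def[abs_def] tangent_of_coord_def[abs_def] by auto

lemma metric_form: "weak_inner (g p)"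
  using metric unfolding weak_riemannian_metric_def weak_inner_def weak_inner_axioms_def by blast

lemma local_metric_apply:
  assumes "C \<in> A" "p \<in> fst C"
  shows "local_metric A g C (snd C p) (coord A C p X) (coord A C p Y) = g p X Y"
  using assms by (simp add: local_metric_def Let_def chart_inverse coord_tangent)

lemma local_metric_bilinear:
  assumes "C \<in> A" "x \<in> chart_image C"
  shows "bounded_bilinear (local_metric A g C x)"
proof -
  interpret weak_inner "g (chart_inv C x)" by (rule metric_form)
  have l: "bounded_linear (tangent_of_coord A C (chart_inv C x))"
    using coord_linear(2)[OF assms(1)] chart_inverse[OF assms(1)] assms(2) by blast
  show ?thesis unfolding local_metric_def[abs_def] Let_def by (rule comp[OF l l])
qed

lemma local_metric_smooth:
  "C \<in> A \<Longrightarrow> smooth_on (chart_image C \<times> UNIV) (\<lambda>(x, u, v). local_metric A g C x u v)"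
  using metric unfolding weak_riemannian_metric_def by blast

lemma \<Gamma>_smooth: "C \<in> A \<Longrightarrow> smooth_on (chart_image C \<times> UNIV) (\<lambda>(x, u, v). \<Gamma> C x u v)"
  and \<Gamma>_bilinear: "C \<in> A \<Longrightarrow> x \<in> chart_image C \<Longrightarrow> bounded_bilinear (\<Gamma> C x)"
  using lc unfolding levi_civita_def connection_def by blast+

lemma \<Gamma>_sym: "C \<in> A \<Longrightarrow> x \<in> chart_image C \<Longrightarrow> \<Gamma> C x u v = \<Gamma> C x v u"
  and metric_derivative: "C \<in> A \<Longrightarrow> x \<in> chart_image C \<Longrightarrow>
    frechet_derivative (\<lambda>y. local_metric A g C y u v) (at x) w =
          local_metric A g C x (\<Gamma> C x w u) v + local_metric A g C x u (\<Gamma> C x w v)"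
  using lc unfolding levi_civita_def by blast+

lemma product_open: "C \<in> A \<Longrightarrow> open (chart_image C \<times> (UNIV :: ('a \<times> 'a) set))"
  by (intro open_Times chart_open) auto

lemma \<Gamma>_differentiable:
  "C \<in> A \<Longrightarrow> x \<in> chart_image C \<Longrightarrow> (\<lambda>(x, u, v). \<Gamma> C x u v) differentiable (at (x, u, v))"
  using smooth_onD(1)[OF \<Gamma>_smooth] by blast

lemma local_metric_differentiable:
  "C \<in> A \<Longrightarrow> x \<in> chart_image C \<Longrightarrow> (\<lambda>(x, u, v). local_metric A g C x u v) differentiable (at (x, u, v))"
  using smooth_onD(1)[OF local_metric_smooth] by blast

lemma \<Gamma>_change:
  assumes "C \<in> A" "D \<in> A" "p \<in> fst C" "p \<in> fst D"
  shows "change_components C D p (\<Gamma> C (snd C p) u v) =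
    frechet_derivative (\<lambda>y. frechet_derivative (transition C D) (at y) v) (at (snd C p)) u +
    \<Gamma> D (snd D p) (change_components C D p u) (change_components C D p v)"
proof -
  have "snd C p \<in> snd C ` (fst C \<inter> fst D)" using assms by blast
  moreover have "\<forall>C\<in>A. \<forall>D\<in>A. \<forall>x\<in>snd C ` (fst C \<inter> fst D). \<forall>u v.
        (let h = transition C D; dh = (\<lambda>y. frechet_derivative h (at y)) in
           dh x (\<Gamma> C x u v) =
             frechet_derivative (\<lambda>y. dh y v) (at x) u + \<Gamma> D (h x) (dh x u) (dh x v))"
    using lc unfolding levi_civita_def connection_def by (elim conjE)
  ultimately show ?thesis
    using assms by (auto simp: Let_def change_components_def transition_apply)
qed

lemma eventually_in_chart:
  assumes "continuous (at t within J) c" "open U" "c t \<in> U"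
  shows "\<forall>\<^sub>F s in at t within J. c s \<in> U"
  using assms unfolding continuous_within by (rule topological_tendstoD)

lemma velocity_chart:
  assumes "continuous (at t within J) c" "C \<in> A" "D \<in> A" "c t \<in> fst C" "c t \<in> fst D"
    and "((\<lambda>s. snd C (c s)) has_vector_derivative x') (at t within J)"
  shows "((\<lambda>s. snd D (c s)) has_vector_derivative change_components C D (c t) x') (at t within J)"
proof -
  have "((\<lambda>s. transition C D (snd C (c s))) has_vector_derivative change_components C D (c t) x') (at t within J)"
    using has_derivative_compose_curve[OF _ assms(6), of "transition C D"]
      transition_derivative[OF assms(2-5)] differentiable_def
    unfolding change_components_def by blast
  moreover have "\<forall>\<^sub>F s in at t within J. transition C D (snd C (c s)) = snd D (c s)"
    using eventually_in_chart[OF assms(1) chart_open(1)[OF assms(2)] assms(4)]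
    by eventually_elim (simp add: transition_apply assms)
  moreover have "transition C D (snd C (c t)) = snd D (c t)" using assms by (simp add: transition_apply)
  ultimately show ?thesis
    unfolding has_vector_derivative_iff_quotient by (auto elim: Lim_transform_eventually elim!: eventually_mono)
qed

lemma has_velocity_chart:
  assumes "has_velocity A c X t J" "C \<in> A" "c t \<in> fst C"
  shows "((\<lambda>s. snd C (c s)) has_vector_derivative coord A C (c t) X) (at t within J)"
  using velocity_chart[of t J c "chart_at A (c t)" C X, OF _ chart_at(1) assms(2) chart_at(2) assms(3)] assms(1)
  unfolding has_velocity_def coord_def comp_def by blast

lemma has_velocityI:
  assumes "continuous (at t within J) c" "C \<in> A" "c t \<in> fst C"
    and "((\<lambda>s. snd C (c s)) has_vector_derivative x') (at t within J)"
  shows "has_velocity A c (tangent_of_coord A C (c t) x') t J"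
  using velocity_chart[of t J c C "chart_at A (c t)" x', OF assms(1,2) chart_at(1) assms(3) chart_at(2) assms(4)] assms(1)
  unfolding has_velocity_def tangent_of_coord_def comp_def by blast

text \<open>The expression of \<open>curvature\<close> in a prescribed chart.
  \<open>curvature\<close> itself uses \<open>chart_at A p\<close>, which may jump with
  \<open>p\<close>, so continuity along a curve is studied in this form.\<close>

definition chart_curvature where
  "chart_curvature C x X Y Z =
    frechet_derivative (\<lambda>y. \<Gamma> C y Y Z) (at x) X - frechet_derivative (\<lambda>y. \<Gamma> C y X Z) (at x) Y
        + \<Gamma> C x X (\<Gamma> C x Y Z) - \<Gamma> C x Y (\<Gamma> C x X Z)"

lemma curvature_eq: "curvature A \<Gamma> p X Y Z = chart_curvature (chart_at A p) (snd (chart_at A p) p) X Y Z"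
  by (simp add: curvature_def chart_curvature_def Let_def)

lemma line_derivative:
  fixes x w :: 'a
  shows "((\<lambda>s. x + s *\<^sub>R w) has_vector_derivative w) (at 0)"
  by (auto intro!: derivative_eq_intros simp: has_vector_derivative_def)

lemma line_eventually:
  fixes x w :: 'a
  assumes "open S" "x \<in> S" shows "\<forall>\<^sub>F s in at (0::real). x + s *\<^sub>R w \<in> S"
proof -
  have "((\<lambda>s. x + s *\<^sub>R w) \<longlongrightarrow> x + 0 *\<^sub>R w) (at 0)" by (intro tendsto_intros)
  then show ?thesis using topological_tendstoD[OF _ assms(1)] assms(2) by fastforce
qed

lemma \<Gamma>_partial_differentiable:
  "C \<in> A \<Longrightarrow> x \<in> chart_image C \<Longrightarrow> (\<lambda>y. \<Gamma> C y u v) differentiable (at x)"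
  by (rule trilinear_partial(1)[OF \<Gamma>_differentiable])

lemma \<Gamma>_line_derivative:
  assumes "C \<in> A" "x \<in> chart_image C"
  shows "((\<lambda>s. \<Gamma> C (x + s *\<^sub>R w) u v) has_vector_derivative frechet_derivative (\<lambda>y. \<Gamma> C y u v) (at x) w) (at 0)"
proof -
  have "(\<lambda>y. \<Gamma> C y u v) differentiable (at (x + 0 *\<^sub>R w))"
    using \<Gamma>_partial_differentiable[OF assms] by simp
  from has_derivative_compose_curve[where x = "\<lambda>s. x + s *\<^sub>R w", OF this line_derivative]
  show ?thesis by simp
qed

text \<open>The transformation law \<open>\<Gamma>_change\<close> differentiated in the base point
  in direction \<open>w\<close>. On the left the derivative of the change of charts acts on a moving
  vector and is differentiated only strongly, whence
  \<open>has_vector_derivative_apply_family\<close>.\<close>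

lemma \<Gamma>_change_derivative:
  assumes C: "C \<in> A" "p \<in> fst C" and D: "D \<in> A" "p \<in> fst D"
  defines "h \<equiv> transition C D" and "x \<equiv> snd C p"
  defines "dh \<equiv> change_components C D p"
  defines "d2 \<equiv> \<lambda>u v. frechet_derivative (\<lambda>y. frechet_derivative h (at y) v) (at x) u"
  shows "d2 w (\<Gamma> C x u v) + dh (frechet_derivative (\<lambda>y. \<Gamma> C y u v) (at x) w) =
    frechet_derivative (\<lambda>y. frechet_derivative (\<lambda>y. frechet_derivative h (at y) v) (at y) u) (at x) w +
    frechet_derivative (\<lambda>y. \<Gamma> D y (dh u) (dh v)) (at (snd D p)) (dh w) +
    \<Gamma> D (snd D p) (d2 w u) (dh v) + \<Gamma> D (snd D p) (dh u) (d2 w v)"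
proof -
  define O1 where "O1 = snd C ` (fst C \<inter> fst D)"
  have O1: "open O1" "x \<in> O1"
    unfolding O1_def x_def using overlap_open chart_open C D by auto
  have sub: "y \<in> chart_image C" "h y \<in> chart_image D" if "y \<in> O1" for y
    using that C D chart_inverse(4)[OF C(1)] chart_inverse(4)[OF D(1)]
    unfolding O1_def h_def by (auto simp: transition_apply)
  have hx: "h x = snd D p" unfolding h_def x_def by (rule transition_apply[OF C])
  note sm = transition_smooth[OF C(1) D(1), folded O1_def h_def]
  note sm1 = smooth_onD(3)[OF sm]
  have dhx: "dh = frechet_derivative h (at x)"
    unfolding dh_def x_def h_def change_components_def[abs_def] ..
  define L where "L s = x + s *\<^sub>R w" for s :: real
  have L: "(L has_vector_derivative w) (at 0)" unfolding L_def by (rule line_derivative)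
  have L0: "L 0 = x" by (simp add: L_def)
  have evL: "\<forall>\<^sub>F s in at 0. L s \<in> O1" unfolding L_def by (rule line_eventually[OF O1])
  have limL: "(L \<longlongrightarrow> x) (at 0)"
    using has_vector_derivative_continuous[OF L] L0 by (simp add: continuous_within)
  obtain \<delta> K where K: "0 < \<delta>" "ball x \<delta> \<subseteq> O1"
    "\<forall>y\<in>ball x \<delta>. \<forall>v. norm (frechet_derivative h (at y) v) \<le> K * norm v"
    using frechet_derivative_locally_bounded[OF O1 smooth_onD(1)[OF sm] smooth_onD(4)[OF sm]] by blast
  have "\<forall>\<^sub>F s in at 0. L s \<in> ball x \<delta>" using topological_tendstoD[OF limL open_ball] K by simp
  then have Kev: "\<forall>\<^sub>F s in at 0. linear (frechet_derivative h (at (L s))) \<and>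
      (\<forall>v. norm (frechet_derivative h (at (L s)) v) \<le> K * norm v)"
    by eventually_elim (use K smooth_onD(1)[OF sm] linear_frechet_derivative in blast)
  have lim: "((\<lambda>s. frechet_derivative h (at (L s)) v) \<longlongrightarrow> frechet_derivative h (at (L 0)) v) (at 0)" for v
    unfolding L0 by (rule frechet_derivative_jointly_tendsto[OF O1 smooth_onD(1)[OF sm] smooth_onD(4)[OF sm] limL tendsto_const])
  have dd: "((\<lambda>s. frechet_derivative h (at (L s)) v) has_vector_derivative d2 w v) (at 0)" for v
    using has_derivative_compose_curve[of "\<lambda>y. frechet_derivative h (at y) v" L 0 w UNIV]
      smooth_onD(1)[OF sm1] O1(2) L unfolding d2_def L0 by simp
  have G: "((\<lambda>s. \<Gamma> C (L s) u v) has_vector_derivative frechet_derivative (\<lambda>y. \<Gamma> C y u v) (at x) w) (at 0)"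
    unfolding L_def by (rule \<Gamma>_line_derivative[OF C(1) sub(1)[OF O1(2)]])
  have lhs: "((\<lambda>s. frechet_derivative h (at (L s)) (\<Gamma> C (L s) u v)) has_vector_derivative
      d2 w (\<Gamma> C (L 0) u v) + frechet_derivative h (at (L 0)) (frechet_derivative (\<lambda>y. \<Gamma> C y u v) (at x) w)) (at 0)"
    by (rule has_vector_derivative_apply_family[OF Kev lim dd G])
  have d3: "((\<lambda>s. frechet_derivative (\<lambda>y. frechet_derivative h (at y) v) (at (L s)) u) has_vector_derivative
      frechet_derivative (\<lambda>y. frechet_derivative (\<lambda>y. frechet_derivative h (at y) v) (at y) u) (at x) w) (at 0)"
    using has_derivative_compose_curve[of "\<lambda>y. frechet_derivative (\<lambda>y. frechet_derivative h (at y) v) (at y) u" L 0 w UNIV]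
      smooth_onD(1)[OF smooth_onD(3)[OF sm1]] O1(2) L unfolding L0 by simp
  have hL: "((\<lambda>s. h (L s)) has_vector_derivative frechet_derivative h (at x) w) (at 0)"
    using has_derivative_compose_curve[of h L 0 w UNIV] smooth_onD(1)[OF sm] O1(2) L unfolding L0 by simp
  have xD: "h (L 0) \<in> chart_image D" unfolding L0 by (rule sub(2)[OF O1(2)])
  have tri: "((\<lambda>s. \<Gamma> D (h (L s)) (frechet_derivative h (at (L s)) u) (frechet_derivative h (at (L s)) v)) has_vector_derivative
      frechet_derivative (\<lambda>y. \<Gamma> D y (frechet_derivative h (at (L 0)) u) (frechet_derivative h (at (L 0)) v)) (at (h (L 0)))
        (frechet_derivative h (at x) w) +
      \<Gamma> D (h (L 0)) (d2 w u) (frechet_derivative h (at (L 0)) v) +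
      \<Gamma> D (h (L 0)) (frechet_derivative h (at (L 0)) u) (d2 w v)) (at 0)"
    by (rule trilinear_curve[OF \<Gamma>_differentiable[OF D(1) xD] \<Gamma>_bilinear[OF D(1) xD] hL dd dd])
  have law: "frechet_derivative h (at y) (\<Gamma> C y u v) =
      frechet_derivative (\<lambda>y. frechet_derivative h (at y) v) (at y) u +
      \<Gamma> D (h y) (frechet_derivative h (at y) u) (frechet_derivative h (at y) v)" if y: "y \<in> O1" for y
  proof -
    obtain q where q: "q \<in> fst C" "q \<in> fst D" "y = snd C q" using y unfolding O1_def by blast
    show ?thesis
      using \<Gamma>_change[OF C(1) D(1) q(1,2), of u v] q(3) transition_apply[OF C(1) q(1), of D]
      unfolding change_components_def h_def by simp
  qed
  have "((\<lambda>s. frechet_derivative h (at (L s)) (\<Gamma> C (L s) u v)) has_vector_derivative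
      (frechet_derivative (\<lambda>y. frechet_derivative (\<lambda>y. frechet_derivative h (at y) v) (at y) u) (at x) w +
      (frechet_derivative (\<lambda>y. \<Gamma> D y (frechet_derivative h (at (L 0)) u) (frechet_derivative h (at (L 0)) v)) (at (h (L 0)))
        (frechet_derivative h (at x) w) +
      \<Gamma> D (h (L 0)) (d2 w u) (frechet_derivative h (at (L 0)) v) +
      \<Gamma> D (h (L 0)) (frechet_derivative h (at (L 0)) u) (d2 w v)))) (at 0)"
    using has_vector_derivative_add[OF d3 tri] unfolding has_vector_derivative_iff_quotient
    by (rule Lim_transform_eventually)
       (use evL in \<open>eventually_elim, simp add: L0 law law[OF O1(2)]\<close>)
  from vector_derivative_unique_at[OF lhs this]
  show ?thesis unfolding L0 hx dhx by (simp add: add.assoc)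
qed

text \<open>Tensoriality. Third derivatives of the change of charts are symmetric in
  \<open>w\<close> and \<open>u\<close> and drop out; the terms with one second derivative cancel by
  symmetry or against those that the transformation law produces from the quadratic terms in
  \<open>\<Gamma>\<close>.\<close>

lemma chart_curvature_change:
  assumes C: "C \<in> A" "p \<in> fst C" and D: "D \<in> A" "p \<in> fst D"
  shows "change_components C D p (chart_curvature C (snd C p) w u v) =
    chart_curvature D (snd D p) (change_components C D p w) (change_components C D p u) (change_components C D p v)"
proof -
  define O1 where "O1 = snd C ` (fst C \<inter> fst D)"
  have O1: "open O1" "snd C p \<in> O1"
    unfolding O1_def using overlap_open chart_open C D by auto
  note sm = transition_smooth[OF C(1) D(1), folded O1_def]
  interpret dh: bounded_linear "change_components C D p" by (rule change_components_linear[OF C(1) D(1) C(2) D(2)])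
  have xD: "snd D p \<in> chart_image D" using D chart_inverse by blast
  interpret GD: bounded_bilinear "\<Gamma> D (snd D p)" by (rule \<Gamma>_bilinear[OF D(1) xD])
  define d2 where "d2 u v = frechet_derivative (\<lambda>y. frechet_derivative (transition C D) (at y) v) (at (snd C p)) u" for u v
  have d2s: "d2 u w = d2 w u"
    unfolding d2_def by (rule smooth_on_symmetric[OF sm O1])
  have d3s: "frechet_derivative (\<lambda>y. frechet_derivative (\<lambda>y. frechet_derivative (transition C D) (at y) v) (at y) u) (at (snd C p)) w
      = frechet_derivative (\<lambda>y. frechet_derivative (\<lambda>y. frechet_derivative (transition C D) (at y) v) (at y) w) (at (snd C p)) u"
    by (rule smooth_on_symmetric[OF smooth_onD(3)[OF sm] O1])
  have law0: "change_components C D p (\<Gamma> C (snd C p) u v) =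
      d2 u v + \<Gamma> D (snd D p) (change_components C D p u) (change_components C D p v)" for u v
    unfolding d2_def by (rule \<Gamma>_change[OF C(1) D(1) C(2) D(2)])
  note e = \<Gamma>_change_derivative[OF C D, folded d2_def]
  have e1: "change_components C D p (frechet_derivative (\<lambda>y. \<Gamma> C y u v) (at (snd C p)) w) =
     frechet_derivative (\<lambda>y. frechet_derivative (\<lambda>y. frechet_derivative (transition C D) (at y) v) (at y) u) (at (snd C p)) w +
    frechet_derivative (\<lambda>y. \<Gamma> D y (change_components C D p u) (change_components C D p v)) (at (snd D p)) (change_components C D p w) +
    \<Gamma> D (snd D p) (d2 w u) (change_components C D p v) + \<Gamma> D (snd D p) (change_components C D p u) (d2 w v)
    - d2 w (\<Gamma> C (snd C p) u v)" for w u v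
    using e[of w u v] by (simp add: algebra_simps)
  show ?thesis
    unfolding chart_curvature_def dh.add dh.diff e1 law0 GD.add_right d2s d3s by simp
qed

lemma chart_curvature_bianchi:
  assumes "C \<in> A" "x \<in> chart_image C"
  shows "chart_curvature C x X Y Z + chart_curvature C x Y Z X + chart_curvature C x Z X Y = 0"
proof -
  have s: "frechet_derivative (\<lambda>y. \<Gamma> C y u v) (at x) = frechet_derivative (\<lambda>y. \<Gamma> C y v u) (at x)" for u v
  proof -
    have "((\<lambda>y. \<Gamma> C y u v) has_derivative frechet_derivative (\<lambda>y. \<Gamma> C y v u) (at x)) (at x)"
      by (rule has_derivative_transform_within_open[OF \<Gamma>_partial_differentiable[OF assms, of v u, unfolded frechet_derivative_works]
            chart_open(2)[OF assms(1)] assms(2)]) (rule \<Gamma>_sym[OF assms(1)])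
    then show ?thesis by (rule frechet_derivative_at[symmetric])
  qed
  show ?thesis
    unfolding chart_curvature_def
    using s[of X Y] s[of Y Z] s[of Z X] \<Gamma>_sym[OF assms, of X Y] \<Gamma>_sym[OF assms, of Y Z] \<Gamma>_sym[OF assms, of Z X]
    by simp
qed

lemma chart_curvature_skew: "chart_curvature C x X Y Z = - chart_curvature C x Y X Z"
  by (simp add: chart_curvature_def)

text \<open>Second derivatives of the components of the metric commute.\<close>

lemma chart_curvature_metric_skew:
  assumes C: "C \<in> A" "x \<in> chart_image C"
  shows "local_metric A g C x (chart_curvature C x a b u) v + local_metric A g C x u (chart_curvature C x a b v) = 0"
proof -
  let ?G = "local_metric A g C"
  interpret G: bounded_bilinear "?G x" by (rule local_metric_bilinear[OF C])
  define \<phi> where "\<phi> y = ?G y u v" for y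
  have dphi: "\<phi> differentiable (at y)" if "y \<in> chart_image C" for y
    unfolding \<phi>_def by (rule trilinear_partial(1)[OF local_metric_differentiable[OF C(1) that]])
  note gsm = local_metric_smooth[OF C(1)]
  have dd: "(\<lambda>y. frechet_derivative \<phi> (at y) w) differentiable (at x)" for w
  proof -
    define F where "F y u v = frechet_derivative (\<lambda>(x, u, v). ?G x u v) (at (y, u, v)) (w, 0, 0)" for y u v
    have "(\<lambda>p. frechet_derivative (\<lambda>(x, u, v). ?G x u v) (at p) (w, 0, 0)) = (\<lambda>(x, u, v). F x u v)"
      by (auto simp: F_def)
    then have "(\<lambda>(x, u, v). F x u v) differentiable (at (x, u, v))"
      using smooth_onD(1)[OF smooth_onD(3)[OF gsm, of "(w, 0, 0)"]] C(2) by auto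
    then have "(\<lambda>y. F y u v) differentiable (at x)" by (rule trilinear_partial(1))
    then have "((\<lambda>y. frechet_derivative \<phi> (at y) w) has_derivative frechet_derivative (\<lambda>y. F y u v) (at x)) (at x)"
      unfolding frechet_derivative_works
      by (rule has_derivative_transform_within_open[OF _ chart_open(2)[OF C(1)] C(2)])
         (use trilinear_partial(2)[OF local_metric_differentiable[OF C(1)]] in \<open>simp add: F_def \<phi>_def[abs_def]\<close>)
    then show ?thesis by (rule differentiableI)
  qed
  have second: "frechet_derivative (\<lambda>y. frechet_derivative \<phi> (at y) b) (at x) a =
      ?G x (\<Gamma> C x a (\<Gamma> C x b u)) v + ?G x (\<Gamma> C x b u) (\<Gamma> C x a v)
      + ?G x (frechet_derivative (\<lambda>y. \<Gamma> C y b u) (at x) a) v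
      + (?G x (\<Gamma> C x a u) (\<Gamma> C x b v) + ?G x u (\<Gamma> C x a (\<Gamma> C x b v))
      + ?G x u (frechet_derivative (\<lambda>y. \<Gamma> C y b v) (at x) a))" for a b
  proof -
    define L where "L s = x + s *\<^sub>R a" for s :: real
    have L: "(L has_vector_derivative a) (at 0)" unfolding L_def by (rule line_derivative)
    have L0: "L 0 = x" by (simp add: L_def)
    have evL: "\<forall>\<^sub>F s in at 0. L s \<in> chart_image C"
      unfolding L_def by (rule line_eventually[OF chart_open(2)[OF C(1)] C(2)])
    have lhs: "((\<lambda>s. frechet_derivative \<phi> (at (L s)) b) has_vector_derivative
        frechet_derivative (\<lambda>y. frechet_derivative \<phi> (at y) b) (at x) a) (at 0)"
      using has_derivative_compose_curve[of "\<lambda>y. frechet_derivative \<phi> (at y) b" L 0 a UNIV] dd L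
      unfolding L0 by simp
    have Gd: "((\<lambda>s. \<Gamma> C (L s) b w) has_vector_derivative frechet_derivative (\<lambda>y. \<Gamma> C y b w) (at x) a) (at 0)" for w
      unfolding L_def by (rule \<Gamma>_line_derivative[OF C])
    have cd: "((\<lambda>s. w) has_vector_derivative 0) (at 0)" for w by (rule has_vector_derivative_const)
    have x0: "L 0 \<in> chart_image C" using L0 C(2) by simp
    note tri = trilinear_curve[OF local_metric_differentiable[OF C(1) x0] local_metric_bilinear[OF C(1) x0] L]
    have "((\<lambda>s. ?G (L s) (\<Gamma> C (L s) b u) v + ?G (L s) u (\<Gamma> C (L s) b v)) has_vector_derivative
      ?G x (\<Gamma> C x a (\<Gamma> C x b u)) v + ?G x (\<Gamma> C x b u) (\<Gamma> C x a v)
      + ?G x (frechet_derivative (\<lambda>y. \<Gamma> C y b u) (at x) a) v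
      + (?G x (\<Gamma> C x a u) (\<Gamma> C x b v) + ?G x u (\<Gamma> C x a (\<Gamma> C x b v))
      + ?G x u (frechet_derivative (\<lambda>y. \<Gamma> C y b v) (at x) a))) (at 0)"
      using has_vector_derivative_add[OF tri[OF Gd cd, of u v] tri[OF cd Gd, of u v]]
      unfolding L0 metric_derivative[OF C] by (simp add: G.zero_right G.zero_left)
    then have "((\<lambda>s. frechet_derivative \<phi> (at (L s)) b) has_vector_derivative
      ?G x (\<Gamma> C x a (\<Gamma> C x b u)) v + ?G x (\<Gamma> C x b u) (\<Gamma> C x a v)
      + ?G x (frechet_derivative (\<lambda>y. \<Gamma> C y b u) (at x) a) v
      + (?G x (\<Gamma> C x a u) (\<Gamma> C x b v) + ?G x u (\<Gamma> C x a (\<Gamma> C x b v))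
      + ?G x u (frechet_derivative (\<lambda>y. \<Gamma> C y b v) (at x) a))) (at 0)"
      unfolding has_vector_derivative_iff_quotient
      by (rule Lim_transform_eventually)
         (use evL in \<open>eventually_elim, simp add: metric_derivative[OF C(1)] L0 C(2) \<phi>_def[abs_def]\<close>)
    from vector_derivative_unique_at[OF lhs this] show ?thesis .
  qed
  have "frechet_derivative (\<lambda>y. frechet_derivative \<phi> (at y) b) (at x) a =
      frechet_derivative (\<lambda>y. frechet_derivative \<phi> (at y) a) (at x) b"
    by (rule second_derivative_symmetric_real[OF chart_open(2)[OF C(1)] C(2) dphi dd dd])
  then show ?thesis unfolding second chart_curvature_def
    by (simp add: G.add_left G.add_right G.diff_left G.diff_right)
qed

text \<open>A case of pair symmetry: in the notation of the proof it reads
  \<open>r X v v Y = r Y v v X\<close>, a linear consequence of skewness in each pair and of the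
  Bianchi identity, whose instances are handed to linear arithmetic.\<close>

lemma curvature_symmetric: "g p (curvature A \<Gamma> p X v v) Y = g p X (curvature A \<Gamma> p Y v v)"
proof -
  let ?C = "chart_at A p"
  let ?x = "snd ?C p"
  have x: "?x \<in> chart_image ?C" using chart_at chart_inverse by blast
  interpret gp: weak_inner "g p" by (rule metric_form)
  have gx: "local_metric A g ?C ?x a b = g p a b" for a b
    using local_metric_apply[OF chart_at, of p a b] by (simp add: coord_chart_at)
  define r where "r a b c d = g p (chart_curvature ?C ?x a b c) d" for a b c d
  have 1: "r a b c d = - r b a c d" for a b c d
    unfolding r_def by (subst chart_curvature_skew) (simp add: gp.minus_left)
  have 2: "r a b c d = - r a b d c" for a b c d
    using chart_curvature_metric_skew[OF chart_at(1) x, of a b c d] unfolding gx r_def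
    by (simp add: gp.sym[of c])
  have 3: "r a b c d + r b c a d + r c a b d = 0" for a b c d
    using arg_cong[OF chart_curvature_bianchi[OF chart_at(1) x, of a b c], of "\<lambda>z. g p z d"] unfolding r_def
    by (simp add: gp.add_left gp.zero_left)
  have "r X v v Y = r Y v v X"
    using 3[of X v v Y] 3[of v v Y X] 3[of v Y X v] 3[of Y X v v]
      1[of X v v Y] 1[of v v X Y] 1[of v X v Y] 1[of v v Y X] 1[of v Y v X] 1[of Y v v X] 1[of v Y X v] 1[of Y X v v]
      1[of X v Y v] 1[of v X Y v]
      2[of X v v Y] 2[of v X v Y] 2[of v v X Y] 2[of Y v v X] 2[of v Y v X] 2[of v Y X v] 2[of Y X v v] 2[of X v Y v]
    by linarith
  then show ?thesis unfolding r_def curvature_eq by (simp add: gp.sym)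
qed

lemma \<Gamma>_arg_derivative_lin:
  assumes C: "C \<in> A" "x \<in> chart_image C"
  shows "frechet_derivative (\<lambda>y. \<Gamma> C y (k *\<^sub>R X + l *\<^sub>R Y) Z) (at x) v =
    k *\<^sub>R frechet_derivative (\<lambda>y. \<Gamma> C y X Z) (at x) v + l *\<^sub>R frechet_derivative (\<lambda>y. \<Gamma> C y Y Z) (at x) v"
proof -
  note d = \<Gamma>_partial_differentiable[OF C, unfolded frechet_derivative_works]
  have "((\<lambda>y. k *\<^sub>R \<Gamma> C y X Z + l *\<^sub>R \<Gamma> C y Y Z) has_derivative
      (\<lambda>v. k *\<^sub>R frechet_derivative (\<lambda>y. \<Gamma> C y X Z) (at x) v + l *\<^sub>R frechet_derivative (\<lambda>y. \<Gamma> C y Y Z) (at x) v)) (at x)"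
    by (intro has_derivative_add has_derivative_scaleR_right d)
  then have "((\<lambda>y. \<Gamma> C y (k *\<^sub>R X + l *\<^sub>R Y) Z) has_derivative
      (\<lambda>v. k *\<^sub>R frechet_derivative (\<lambda>y. \<Gamma> C y X Z) (at x) v + l *\<^sub>R frechet_derivative (\<lambda>y. \<Gamma> C y Y Z) (at x) v)) (at x)"
  proof (rule has_derivative_transform_within_open[OF _ chart_open(2)[OF C(1)] C(2)])
    fix y assume "y \<in> chart_image C"
    then interpret G: bounded_bilinear "\<Gamma> C y" by (rule \<Gamma>_bilinear[OF C(1)])
    show "k *\<^sub>R \<Gamma> C y X Z + l *\<^sub>R \<Gamma> C y Y Z = \<Gamma> C y (k *\<^sub>R X + l *\<^sub>R Y) Z"
      by (simp add: G.add_left G.scaleR_left)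
  qed
  from frechet_derivative_at[OF this] show ?thesis by (rule fun_cong[OF sym, THEN trans]) simp
qed

lemma curvature_lin:
  "curvature A \<Gamma> p (k *\<^sub>R X + l *\<^sub>R Y) v w = k *\<^sub>R curvature A \<Gamma> p X v w + l *\<^sub>R curvature A \<Gamma> p Y v w"
proof -
  let ?C = "chart_at A p"
  let ?x = "snd ?C p"
  have x: "?x \<in> chart_image ?C" using chart_at chart_inverse by blast
  interpret G: bounded_bilinear "\<Gamma> ?C ?x" by (rule \<Gamma>_bilinear[OF chart_at(1) x])
  have l: "linear (frechet_derivative (\<lambda>y. \<Gamma> ?C y v w) (at ?x))"
    by (rule linear_frechet_derivative[OF \<Gamma>_partial_differentiable[OF chart_at(1) x]])
  show ?thesis
    unfolding curvature_eq chart_curvature_def \<Gamma>_arg_derivative_lin[OF chart_at(1) x]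
    by (simp add: linear_add[OF l] linear_cmul[OF l] G.add_left G.scaleR_left G.add_right G.scaleR_right algebra_simps)
qed

lemma curvature_chart:
  assumes "C \<in> A" "p \<in> fst C"
  shows "coord A C p (curvature A \<Gamma> p X Y Z) =
    chart_curvature C (snd C p) (coord A C p X) (coord A C p Y) (coord A C p Z)"
  unfolding curvature_eq coord_def by (rule chart_curvature_change[OF chart_at assms])

text \<open>The vectors inside the differentiated function move with \<open>s\<close>. Rewriting the
  partial derivative of \<open>\<Gamma>\<close> as its full derivative at \<open>(x, u, v)\<close>
  in direction \<open>(w, 0, 0)\<close> turns the claim into joint continuity of one Frechet
  derivative in point and direction.\<close>

lemma chart_curvature_tendsto:
  assumes C: "C \<in> A" "x0 \<in> chart_image C"
    and lim: "(x \<longlongrightarrow> x0) F" "(X \<longlongrightarrow> X0) F" "(Y \<longlongrightarrow> Y0) F" "(Z \<longlongrightarrow> Z0) F"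
  shows "((\<lambda>s. chart_curvature C (x s) (X s) (Y s) (Z s)) \<longlongrightarrow> chart_curvature C x0 X0 Y0 Z0) F"
proof -
  have ev: "\<forall>\<^sub>F s in F. x s \<in> chart_image C"
    using topological_tendstoD[OF lim(1) chart_open(2)[OF C(1)] C(2)] .
  have mem: "(x0, a, b) \<in> chart_image C \<times> UNIV" for a b :: 'a using C by simp
  have d: "((\<lambda>s. frechet_derivative (\<lambda>y. \<Gamma> C y (U s) (V s)) (at (x s)) (W s)) \<longlongrightarrow>
      frechet_derivative (\<lambda>y. \<Gamma> C y U0 V0) (at x0) W0) F"
    if "(U \<longlongrightarrow> U0) F" "(V \<longlongrightarrow> V0) F" "(W \<longlongrightarrow> W0) F" for U V W U0 V0 W0
  proof -
    have "((\<lambda>s. frechet_derivative (\<lambda>(x, u, v). \<Gamma> C x u v) (at (x s, U s, V s)) (W s, 0, 0)) \<longlongrightarrow>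
        frechet_derivative (\<lambda>(x, u, v). \<Gamma> C x u v) (at (x0, U0, V0)) (W0, 0, 0)) F"
      by (rule frechet_derivative_jointly_tendsto[OF product_open[OF C(1)] mem
            smooth_onD(1)[OF \<Gamma>_smooth[OF C(1)]] smooth_onD(4)[OF \<Gamma>_smooth[OF C(1)]]])
         (assumption | intro tendsto_Pair lim that tendsto_const)+
    then show ?thesis
      unfolding trilinear_partial(2)[OF \<Gamma>_differentiable[OF C]]
      by (rule Lim_transform_eventually)
         (use ev in \<open>eventually_elim, simp add: trilinear_partial(2)[OF \<Gamma>_differentiable[OF C(1)]]\<close>)
  qed
  have G: "((\<lambda>s. \<Gamma> C (x s) (U s) (V s)) \<longlongrightarrow> \<Gamma> C x0 U0 V0) F"
    if "(U \<longlongrightarrow> U0) F" "(V \<longlongrightarrow> V0) F" for U V U0 V0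
  proof -
    have t: "((\<lambda>s. (x s, U s, V s)) \<longlongrightarrow> (x0, U0, V0)) F" by (intro tendsto_Pair lim that)
    have "\<forall>\<^sub>F s in F. (x s, U s, V s) \<in> chart_image C \<times> UNIV" using ev by simp
    from continuous_on_tendsto_compose[OF smooth_onD(2)[OF \<Gamma>_smooth[OF C(1)]] t mem this]
    show ?thesis by simp
  qed
  show ?thesis unfolding chart_curvature_def
    by (intro tendsto_diff tendsto_add d G lim)
qed

end

section \<open>Parallel transport along a geodesic\<close>

text \<open>Only a velocity is required here and not the geodesic equation, because the locale is
  used a second time for a short curve in \<open>N\<close>, in
  \<open>normal_covariant_derivative\<close>.\<close>

locale riemannian_curve = weak_riemannian A g \<Gamma>
  for A :: "('m::t2_space, 'a::{real_inner, complete_space}) chart set"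
    and g :: "'m \<Rightarrow> 'a \<Rightarrow> 'a \<Rightarrow> real"
    and \<Gamma> :: "('m, 'a) chart \<Rightarrow> 'a \<Rightarrow> 'a \<Rightarrow> 'a \<Rightarrow> 'a" +
  fixes c :: "real \<Rightarrow> 'm" and b :: real
  assumes b: "0 < b" and velocity_ex: "t \<in> {0..b} \<Longrightarrow> \<exists>X. has_velocity A c X t {0..b}"
begin

abbreviation dc where "dc \<equiv> velocity A c {0..b}"
abbreviation components where "components C \<equiv> components_along A C c"

lemma at_within_nontrivial: "t \<in> {0..b} \<Longrightarrow> at t within {0..b} \<noteq> bot"
  using b by (simp add: trivial_limit_within islimpt_Icc)

lemma has_velocity: "t \<in> {0..b} \<Longrightarrow> has_velocity A c (dc t) t {0..b}"
proof -
  assume t: "t \<in> {0..b}"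
  then obtain X where X: "has_velocity A c X t {0..b}" using velocity_ex by blast
  have "dc t = X" unfolding velocity_def
    by (rule vector_derivative_within[OF at_within_nontrivial[OF t]])
       (use X in \<open>simp add: has_velocity_def\<close>)
  then show ?thesis using X by simp
qed

lemma curve_continuous: "t \<in> {0..b} \<Longrightarrow> J \<subseteq> {0..b} \<Longrightarrow> continuous (at t within J) c"
  using has_velocity unfolding has_velocity_def by (meson continuous_within_subset)

lemma in_chart_eventually:
  assumes "t \<in> {0..b}" "J \<subseteq> {0..b}" "C \<in> A" "c t \<in> fst C"
  shows "\<forall>\<^sub>F s in at t within J. c s \<in> fst C"
  using eventually_in_chart[OF curve_continuous[OF assms(1,2)] chart_open(1)] assms by blast

lemma curve_chart:
  assumes "t \<in> {0..b}" "J \<subseteq> {0..b}" "C \<in> A" "c t \<in> fst C"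
  shows "((\<lambda>s. snd C (c s)) has_vector_derivative coord A C (c t) (dc t)) (at t within J)"
  using has_velocity_chart[OF has_velocity[OF assms(1)] assms(3,4)] assms(2)
  by (rule has_vector_derivative_within_subset)

lemma curve_chart_tendsto:
  assumes "t \<in> {0..b}" "J \<subseteq> {0..b}" "C \<in> A" "c t \<in> fst C"
  shows "((\<lambda>s. snd C (c s)) \<longlongrightarrow> snd C (c t)) (at t within J)"
  using has_vector_derivative_continuous[OF curve_chart[OF assms]] by (simp add: continuous_within)

lemma components_change_eventually:
  assumes "t \<in> {0..b}" "J \<subseteq> {0..b}" "C \<in> A" "D \<in> A" "c t \<in> fst C" "c t \<in> fst D"
  shows "\<forall>\<^sub>F s in at t within J. frechet_derivative (transition C D) (at (snd C (c s))) (components C Z s)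
    = components D Z s"
  using in_chart_eventually[OF assms(1,2,3,5)] in_chart_eventually[OF assms(1,2,4,6)]
proof eventually_elim
  case (elim s)
  then show ?case
    using coord_change[OF assms(3,4), of "c s" "Z s"] by (simp add: components_along_def change_components_def)
qed

lemma transition_along:
  assumes "t \<in> {0..b}" "J \<subseteq> {0..b}" "C \<in> A" "D \<in> A" "c t \<in> fst C" "c t \<in> fst D"
  shows "\<exists>K. \<forall>\<^sub>F s in at t within J. linear (frechet_derivative (transition C D) (at (snd C (c s)))) \<and>
      (\<forall>v. norm (frechet_derivative (transition C D) (at (snd C (c s))) v) \<le> K * norm v)"
    and "((\<lambda>s. frechet_derivative (transition C D) (at (snd C (c s))) v)
      \<longlongrightarrow> change_components C D (c t) v) (at t within J)"
proof -
  define O1 where "O1 = snd C ` (fst C \<inter> fst D)"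
  have O1: "open O1" "snd C (c t) \<in> O1"
    unfolding O1_def using overlap_open chart_open assms by auto
  note sm = transition_smooth[OF assms(3,4), folded O1_def]
  obtain \<delta> K where K: "0 < \<delta>" "ball (snd C (c t)) \<delta> \<subseteq> O1"
    "\<forall>y\<in>ball (snd C (c t)) \<delta>. \<forall>v. norm (frechet_derivative (transition C D) (at y) v) \<le> K * norm v"
    using frechet_derivative_locally_bounded[OF O1 smooth_onD(1)[OF sm] smooth_onD(4)[OF sm]] by blast
  have "\<forall>\<^sub>F s in at t within J. snd C (c s) \<in> ball (snd C (c t)) \<delta>"
    using topological_tendstoD[OF curve_chart_tendsto[OF assms(1,2,3,5)] open_ball] K by simp
  then have "\<forall>\<^sub>F s in at t within J. linear (frechet_derivative (transition C D) (at (snd C (c s)))) \<and>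
      (\<forall>v. norm (frechet_derivative (transition C D) (at (snd C (c s))) v) \<le> K * norm v)"
    by eventually_elim (use K smooth_onD(1)[OF sm] linear_frechet_derivative in blast)
  then show "\<exists>K. \<forall>\<^sub>F s in at t within J. linear (frechet_derivative (transition C D) (at (snd C (c s)))) \<and>
      (\<forall>v. norm (frechet_derivative (transition C D) (at (snd C (c s))) v) \<le> K * norm v)" by blast
  show "((\<lambda>s. frechet_derivative (transition C D) (at (snd C (c s))) v)
      \<longlongrightarrow> change_components C D (c t) v) (at t within J)"
    unfolding change_components_def
    by (rule frechet_derivative_jointly_tendsto[OF O1 smooth_onD(1)[OF sm] smooth_onD(4)[OF sm]
          curve_chart_tendsto[OF assms(1,2,3,5)] tendsto_const])
qed

text \<open>A relational covariant derivative within \<open>J\<close>, demanded in all charts around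
  \<open>c t\<close>. The velocity is always the one within \<open>{0..b}\<close>, so that the
  relation can be restricted to subintervals and glued.\<close>

definition has_cov_deriv :: "(real \<Rightarrow> 'a) \<Rightarrow> 'a \<Rightarrow> real \<Rightarrow> real set \<Rightarrow> bool" where
  "has_cov_deriv Z V t J \<longleftrightarrow> (\<forall>C\<in>A. c t \<in> fst C \<longrightarrow>
     (components C Z has_vector_derivative
       (coord A C (c t) V - \<Gamma> C (snd C (c t)) (coord A C (c t) (dc t)) (coord A C (c t) (Z t)))) (at t within J))"

text \<open>One chart suffices: the second derivatives of the change of charts are absorbed by the
  transformation law of the Christoffel symbols.\<close>

lemma has_cov_derivI:
  assumes t: "t \<in> {0..b}" "J \<subseteq> {0..b}" and C: "C \<in> A" "c t \<in> fst C"
    and d: "(components C Z has_vector_derivative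
       (coord A C (c t) V - \<Gamma> C (snd C (c t)) (coord A C (c t) (dc t)) (coord A C (c t) (Z t)))) (at t within J)"
  shows "has_cov_deriv Z V t J"
  unfolding has_cov_deriv_def
proof (intro ballI impI)
  fix D assume D: "D \<in> A" "c t \<in> fst D"
  let ?h = "transition C D"
  let ?x = "snd C (c t)"
  let ?x' = "coord A C (c t) (dc t)" and ?y = "coord A C (c t) (Z t)" and ?V = "coord A C (c t) V"
  let ?ch = "change_components C D (c t)"
  interpret ch: bounded_linear ?ch by (rule change_components_linear[OF C(1) D(1) C(2) D(2)])
  define A1 where "A1 s = frechet_derivative ?h (at (snd C (c s)))" for s
  obtain K where K: "\<forall>\<^sub>F s in at t within J. linear (A1 s) \<and> (\<forall>v. norm (A1 s v) \<le> K * norm v)"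
    using transition_along(1)[OF t C(1) D(1) C(2) D(2)] unfolding A1_def by blast
  have A1t: "A1 t = ?ch" by (simp add: A1_def change_components_def[abs_def])
  have lim: "((\<lambda>s. A1 s v) \<longlongrightarrow> A1 t v) (at t within J)" for v
    unfolding A1t unfolding A1_def by (rule transition_along(2)[OF t C(1) D(1) C(2) D(2)])
  have cy: "components C Z t = ?y" by (simp add: components_along_def)
  have "snd C (c t) \<in> snd C ` (fst C \<inter> fst D)" using C D by blast
  then have "(\<lambda>y. frechet_derivative ?h (at y) (components C Z t)) differentiable (at ?x)"
    using smooth_onD(1)[OF smooth_onD(3)[OF transition_smooth[OF C(1) D(1)]]] by blast
  from has_derivative_compose_curve[OF this curve_chart[OF t C]]
  have a: "((\<lambda>s. A1 s (components C Z t)) has_vector_derivative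
      frechet_derivative (\<lambda>y. frechet_derivative ?h (at y) ?y) (at ?x) ?x') (at t within J)"
    unfolding A1_def cy .
  have "((\<lambda>s. A1 s (components C Z s)) has_vector_derivative
      (frechet_derivative (\<lambda>y. frechet_derivative ?h (at y) ?y) (at ?x) ?x'
        + A1 t (?V - \<Gamma> C ?x ?x' ?y))) (at t within J)"
    by (rule has_vector_derivative_apply_family[OF K lim a d])
  moreover have "frechet_derivative (\<lambda>y. frechet_derivative ?h (at y) ?y) (at ?x) ?x'
        + A1 t (?V - \<Gamma> C ?x ?x' ?y) =
      coord A D (c t) V - \<Gamma> D (snd D (c t)) (coord A D (c t) (dc t)) (coord A D (c t) (Z t))"
    unfolding A1t ch.diff \<Gamma>_change[OF C(1) D(1) C(2) D(2)] coord_change[OF C(1) D(1) C(2) D(2)] by simp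
  ultimately have e: "((\<lambda>s. A1 s (components C Z s)) has_vector_derivative
      coord A D (c t) V - \<Gamma> D (snd D (c t)) (coord A D (c t) (dc t)) (coord A D (c t) (Z t))) (at t within J)"
    by simp
  have ev: "\<forall>\<^sub>F s in at t within J. A1 s (components C Z s) = components D Z s"
    unfolding A1_def by (rule components_change_eventually[OF t C(1) D(1) C(2) D(2)])
  have et: "A1 t (components C Z t) = components D Z t"
    unfolding A1t cy by (simp add: components_along_def coord_change[OF C(1) D(1) C(2) D(2)])
  show "(components D Z has_vector_derivative
      coord A D (c t) V - \<Gamma> D (snd D (c t)) (coord A D (c t) (dc t)) (coord A D (c t) (Z t))) (at t within J)"
    using e unfolding has_vector_derivative_iff_quotient et
    by (rule Lim_transform_eventually) (use ev in \<open>eventually_elim, simp\<close>)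
qed

lemma has_cov_deriv_cov_deriv:
  assumes "field_differentiable_at A c {0..b} Z t" "t \<in> {0..b}"
  shows "has_cov_deriv Z (cov_deriv A \<Gamma> c {0..b} Z t) t {0..b}"
proof (rule has_cov_derivI[OF assms(2) order_refl chart_at])
  show "(components (chart_at A (c t)) Z has_vector_derivative
      coord A (chart_at A (c t)) (c t) (cov_deriv A \<Gamma> c {0..b} Z t)
      - \<Gamma> (chart_at A (c t)) (snd (chart_at A (c t)) (c t)) (coord A (chart_at A (c t)) (c t) (dc t))
          (coord A (chart_at A (c t)) (c t) (Z t))) (at t within {0..b})"
    using assms(1) unfolding field_differentiable_at_def cov_deriv_def Let_def coord_chart_at
    by (simp add: vector_derivative_works)
qed

lemma cov_deriv_eq:
  assumes "has_cov_deriv Z V t {0..b}" "t \<in> {0..b}"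
  shows "field_differentiable_at A c {0..b} Z t" "cov_deriv A \<Gamma> c {0..b} Z t = V"
proof -
  have d: "(components (chart_at A (c t)) Z has_vector_derivative
      V - \<Gamma> (chart_at A (c t)) (snd (chart_at A (c t)) (c t)) (dc t) (Z t)) (at t within {0..b})"
    using assms(1) chart_at unfolding has_cov_deriv_def by (metis coord_chart_at)
  then show "field_differentiable_at A c {0..b} Z t"
    unfolding field_differentiable_at_def by (rule differentiableI_vector)
  show "cov_deriv A \<Gamma> c {0..b} Z t = V"
    unfolding cov_deriv_def Let_def using vector_derivative_within[OF at_within_nontrivial[OF assms(2)] d] by simp
qed

lemma has_cov_deriv_subset: "has_cov_deriv Z V t J \<Longrightarrow> J' \<subseteq> J \<Longrightarrow> has_cov_deriv Z V t J'"
  unfolding has_cov_deriv_def using has_vector_derivative_within_subset by blast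

lemma has_cov_deriv_lin:
  assumes "has_cov_deriv Y V t J" "has_cov_deriv Z W t J" "t \<in> {0..b}" "J \<subseteq> {0..b}"
  shows "has_cov_deriv (\<lambda>s. k *\<^sub>R Y s + l *\<^sub>R Z s) (k *\<^sub>R V + l *\<^sub>R W) t J"
proof (rule has_cov_derivI[OF assms(3,4) chart_at])
  let ?C = "chart_at A (c t)"
  interpret G: bounded_bilinear "\<Gamma> ?C (snd ?C (c t))"
    by (rule \<Gamma>_bilinear) (use chart_at chart_inverse in auto)
  have d: "(components ?C Y has_vector_derivative V - \<Gamma> ?C (snd ?C (c t)) (dc t) (Y t)) (at t within J)"
    "(components ?C Z has_vector_derivative W - \<Gamma> ?C (snd ?C (c t)) (dc t) (Z t)) (at t within J)"
    using assms(1,2) chart_at unfolding has_cov_deriv_def by (metis coord_chart_at)+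
  have "((\<lambda>s. k *\<^sub>R components ?C Y s + l *\<^sub>R components ?C Z s) has_vector_derivative
      k *\<^sub>R (V - \<Gamma> ?C (snd ?C (c t)) (dc t) (Y t)) + l *\<^sub>R (W - \<Gamma> ?C (snd ?C (c t)) (dc t) (Z t))) (at t within J)"
    by (intro has_vector_derivative_add bounded_linear.has_vector_derivative[OF bounded_linear_scaleR_right] d)
  then have e: "((\<lambda>s. k *\<^sub>R components ?C Y s + l *\<^sub>R components ?C Z s) has_vector_derivative
      (k *\<^sub>R V + l *\<^sub>R W) - \<Gamma> ?C (snd ?C (c t)) (dc t) (k *\<^sub>R Y t + l *\<^sub>R Z t)) (at t within J)"
    by (simp add: G.add_right G.scaleR_right algebra_simps)
  have eq: "k *\<^sub>R components ?C Y s + l *\<^sub>R components ?C Z s = components ?C (\<lambda>s. k *\<^sub>R Y s + l *\<^sub>R Z s) s"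
    if "c s \<in> fst ?C" for s
  proof -
    interpret co: bounded_linear "coord A ?C (c s)" by (rule coord_linear(1)[OF chart_at(1) that])
    show ?thesis by (simp add: components_along_def co.add co.scaleR)
  qed
  have ev: "\<forall>\<^sub>F s in at t within J. c s \<in> fst ?C"
    by (rule in_chart_eventually[OF assms(3,4) chart_at])
  show "(components ?C (\<lambda>s. k *\<^sub>R Y s + l *\<^sub>R Z s) has_vector_derivative
      coord A ?C (c t) (k *\<^sub>R V + l *\<^sub>R W)
      - \<Gamma> ?C (snd ?C (c t)) (coord A ?C (c t) (dc t)) (coord A ?C (c t) (k *\<^sub>R Y t + l *\<^sub>R Z t))) (at t within J)"
    using e unfolding has_vector_derivative_iff_quotient coord_chart_at eq[OF chart_at(2)]
    by (rule Lim_transform_eventually) (use ev in \<open>eventually_elim, simp add: eq\<close>)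
qed

text \<open>Metric compatibility: the Christoffel terms from differentiating the local metric cancel
  those in the derivatives of the components.\<close>

lemma metric_product_rule:
  assumes "has_cov_deriv Y V t J" "has_cov_deriv Z W t J" "t \<in> {0..b}" "J \<subseteq> {0..b}"
  shows "((\<lambda>s. g (c s) (Y s) (Z s)) has_vector_derivative (g (c t) V (Z t) + g (c t) (Y t) W)) (at t within J)"
proof -
  let ?C = "chart_at A (c t)"
  let ?x = "snd ?C (c t)"
  let ?g = "local_metric A g ?C"
  have x: "?x \<in> chart_image ?C" using chart_at chart_inverse by auto
  interpret gl: bounded_bilinear "?g ?x" by (rule local_metric_bilinear[OF chart_at(1) x])
  interpret gc: weak_inner "g (c t)" by (rule metric_form)
  have gx: "?g ?x X X' = g (c t) X X'" for X X'
    using local_metric_apply[OF chart_at, of "c t" X X'] by (simp add: coord_chart_at)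
  have d: "(components ?C Y has_vector_derivative V - \<Gamma> ?C ?x (dc t) (Y t)) (at t within J)"
    "(components ?C Z has_vector_derivative W - \<Gamma> ?C ?x (dc t) (Z t)) (at t within J)"
    using assms(1,2) chart_at unfolding has_cov_deriv_def by (metis coord_chart_at)+
  have cc: "components ?C Y t = Y t" "components ?C Z t = Z t" by (simp_all add: components_along_def coord_chart_at)
  have "((\<lambda>s. ?g (snd ?C (c s)) (components ?C Y s) (components ?C Z s)) has_vector_derivative
    (frechet_derivative (\<lambda>y. ?g y (components ?C Y t) (components ?C Z t)) (at ?x) (dc t)
     + ?g ?x (V - \<Gamma> ?C ?x (dc t) (Y t)) (components ?C Z t)
     + ?g ?x (components ?C Y t) (W - \<Gamma> ?C ?x (dc t) (Z t)))) (at t within J)"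
    by (rule trilinear_curve[OF local_metric_differentiable[OF chart_at(1) x] gl.bounded_bilinear_axioms
          curve_chart[OF assms(3,4) chart_at, unfolded coord_chart_at] d])
  then have e: "((\<lambda>s. ?g (snd ?C (c s)) (components ?C Y s) (components ?C Z s)) has_vector_derivative
    (g (c t) V (Z t) + g (c t) (Y t) W)) (at t within J)"
    unfolding cc metric_derivative[OF chart_at(1) x]
    by (simp add: gc.diff_left gc.diff_right gx)
  have eq: "?g (snd ?C (c s)) (components ?C Y s) (components ?C Z s) = g (c s) (Y s) (Z s)" if "c s \<in> fst ?C" for s
    unfolding components_along_def by (rule local_metric_apply[OF chart_at(1) that])
  have ev: "\<forall>\<^sub>F s in at t within J. c s \<in> fst ?C"
    by (rule in_chart_eventually[OF assms(3,4) chart_at])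
  show ?thesis
    using e unfolding has_vector_derivative_iff_quotient eq[OF chart_at(2)]
    by (rule Lim_transform_eventually) (use ev in \<open>eventually_elim, simp add: eq\<close>)
qed

end

lemma at_within_Icc_split:
  fixes s m t :: real
  assumes "s \<le> m" "m \<le> t"
  shows "at r within {s..t} = sup (at r within {s..m}) (at r within {m..t})"
  using assms by (simp add: at_within_union[symmetric] ivl_disj_un_two_touch(4))

lemma at_within_Icc_bot: "r \<notin> {s..t} \<Longrightarrow> at r within {s..t::real} = bot"
  by (metis closed_limpt closed_atLeastAtMost trivial_limit_within)

locale riemannian_geodesic = riemannian_curve A g \<Gamma> c b
  for A :: "('m::t2_space, 'a::{real_inner, complete_space}) chart set"
    and g :: "'m \<Rightarrow> 'a \<Rightarrow> 'a \<Rightarrow> real"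
    and \<Gamma> :: "('m, 'a) chart \<Rightarrow> 'a \<Rightarrow> 'a \<Rightarrow> 'a \<Rightarrow> 'a"
    and c :: "real \<Rightarrow> 'm" and b :: real +
  assumes geodesic: "geodesic A \<Gamma> c b"
begin

lemma velocity_parallel: "t \<in> {0..b} \<Longrightarrow> has_cov_deriv dc 0 t {0..b}"
  using has_cov_deriv_cov_deriv[of dc t] geodesic unfolding geodesic_def by auto

definition field_continuous :: "(real \<Rightarrow> 'a) \<Rightarrow> real \<Rightarrow> real set \<Rightarrow> bool" where
  "field_continuous Z t J \<longleftrightarrow> (\<forall>C\<in>A. c t \<in> fst C \<longrightarrow>
     (components C Z \<longlongrightarrow> coord A C (c t) (Z t)) (at t within J))"

lemma has_cov_deriv_continuous: "has_cov_deriv Z V t J \<Longrightarrow> field_continuous Z t J"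
  unfolding has_cov_deriv_def field_continuous_def
  using has_vector_derivative_continuous by (fastforce simp: continuous_within components_along_def)

lemma field_continuousI:
  assumes t: "t \<in> {0..b}" "J \<subseteq> {0..b}" and C: "C \<in> A" "c t \<in> fst C"
    and d: "(components C Z \<longlongrightarrow> coord A C (c t) (Z t)) (at t within J)"
  shows "field_continuous Z t J"
  unfolding field_continuous_def
proof (intro ballI impI)
  fix D assume D: "D \<in> A" "c t \<in> fst D"
  obtain K where K: "\<forall>\<^sub>F s in at t within J. linear (frechet_derivative (transition C D) (at (snd C (c s)))) \<and>
      (\<forall>v. norm (frechet_derivative (transition C D) (at (snd C (c s))) v) \<le> K * norm v)"
    using transition_along(1)[OF t C(1) D(1) C(2) D(2)] by blast
  have "((\<lambda>s. frechet_derivative (transition C D) (at (snd C (c s))) (components C Z s)) \<longlongrightarrow>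
      change_components C D (c t) (coord A C (c t) (Z t))) (at t within J)"
    by (rule tendsto_apply_family[OF K transition_along(2)[OF t C(1) D(1) C(2) D(2)] d])
  then show "(components D Z \<longlongrightarrow> coord A D (c t) (Z t)) (at t within J)"
    unfolding coord_change[OF C(1) D(1) C(2) D(2)]
    by (rule Lim_transform_eventually[OF _ components_change_eventually[OF t C(1) D(1) C(2) D(2)]])
qed

section \<open>Parallel fields: uniqueness, gluing and existence\<close>

definition parallel_on :: "real set \<Rightarrow> (real \<Rightarrow> 'a) \<Rightarrow> bool" where
  "parallel_on J Y \<longleftrightarrow> (\<forall>t\<in>J. has_cov_deriv Y 0 t J)"

lemma parallel_on_iff: "parallel_on {0..b} Y \<longleftrightarrow> parallel_field A \<Gamma> c b Y"
  unfolding parallel_on_def parallel_field_def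
  using has_cov_deriv_cov_deriv cov_deriv_eq by metis

lemma parallel_inner_constant:
  assumes "parallel_on {s..t} Y" "parallel_on {s..t} Z" "{s..t} \<subseteq> {0..b}" "r \<in> {s..t}" "q \<in> {s..t}"
  shows "g (c r) (Y r) (Z r) = g (c q) (Y q) (Z q)"
proof -
  have "((\<lambda>s. g (c s) (Y s) (Z s)) has_vector_derivative 0) (at u within {s..t})" if "u \<in> {s..t}" for u
  proof -
    interpret gu: weak_inner "g (c u)" by (rule metric_form)
    show ?thesis
      using metric_product_rule[of Y 0 u "{s..t}" Z 0] assms that unfolding parallel_on_def
      by (auto simp: gu.zero_left gu.zero_right)
  qed
  then show ?thesis
    using has_derivative_zero_unique[of "{s..t}" "\<lambda>s. g (c s) (Y s) (Z s)" r q] assms(4,5)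
    unfolding has_vector_derivative_def by auto
qed

lemma parallel_on_lin:
  assumes "parallel_on J Y" "parallel_on J Z" "J \<subseteq> {0..b}"
  shows "parallel_on J (\<lambda>s. k *\<^sub>R Y s + l *\<^sub>R Z s)"
  unfolding parallel_on_def
proof
  fix t assume t: "t \<in> J"
  show "has_cov_deriv (\<lambda>s. k *\<^sub>R Y s + l *\<^sub>R Z s) 0 t J"
    using has_cov_deriv_lin[of Y 0 t J Z 0 k l] assms t unfolding parallel_on_def by auto
qed

text \<open>The difference of two parallel fields is parallel and hence of constant weak norm;
  positive definiteness gives uniqueness without any estimate in the Hilbert norm.\<close>

lemma parallel_unique:
  assumes Y: "parallel_on {s..t} Y" and Z: "parallel_on {s..t} Z" and J: "{s..t} \<subseteq> {0..b}"
    and "r \<in> {s..t}" "q \<in> {s..t}" "Y r = Z r"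
  shows "Y q = Z q"
proof -
  interpret gq: weak_inner "g (c q)" by (rule metric_form)
  interpret gr: weak_inner "g (c r)" by (rule metric_form)
  have p: "parallel_on {s..t} (\<lambda>s. 1 *\<^sub>R Y s + (-1) *\<^sub>R Z s)" by (rule parallel_on_lin[OF Y Z J])
  have "g (c q) (Y q - Z q) (Y q - Z q) = g (c r) (Y r - Z r) (Y r - Z r)"
    using parallel_inner_constant[OF p p J assms(5,4)] by simp
  then have "g (c q) (Y q - Z q) (Y q - Z q) = 0" using assms(6) by (simp add: gr.zero_left)
  then show ?thesis using gq.eq_zero by fastforce
qed

lemma parallel_on_subset: "parallel_on J Y \<Longrightarrow> J' \<subseteq> J \<Longrightarrow> parallel_on J' Y"
  unfolding parallel_on_def using has_cov_deriv_subset by blast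

lemma has_cov_deriv_cong:
  assumes "has_cov_deriv Y V t J" "t \<in> J" "\<And>s. s \<in> J \<Longrightarrow> Y s = Z s"
  shows "has_cov_deriv Z V t J"
  unfolding has_cov_deriv_def
proof (intro ballI impI)
  fix C assume "C \<in> A" "c t \<in> fst C"
  then have "(components C Y has_vector_derivative coord A C (c t) V -
        \<Gamma> C (snd C (c t)) (coord A C (c t) (dc t)) (coord A C (c t) (Y t))) (at t within J)"
    using assms(1) unfolding has_cov_deriv_def by blast
  then have "(components C Z has_vector_derivative coord A C (c t) V -
        \<Gamma> C (snd C (c t)) (coord A C (c t) (dc t)) (coord A C (c t) (Y t))) (at t within J)"
    by (rule has_vector_derivative_transform[OF assms(2), rotated]) (simp add: components_along_def assms(3))
  then show "(components C Z has_vector_derivative coord A C (c t) V -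
        \<Gamma> C (snd C (c t)) (coord A C (c t) (dc t)) (coord A C (c t) (Z t))) (at t within J)"
    using assms(2,3) by simp
qed

text \<open>Outside a closed interval the filter is trivial. With this the gluing step can combine
  both sides at every time, also away from the junction.\<close>

lemma has_cov_deriv_bot: "at t within J = bot \<Longrightarrow> has_cov_deriv Y V t J"
  unfolding has_cov_deriv_def has_vector_derivative_iff_quotient by simp

lemma has_cov_deriv_sup:
  "at t within J = sup (at t within J1) (at t within J2) \<Longrightarrow> has_cov_deriv Y V t J1 \<Longrightarrow> has_cov_deriv Y V t J2
    \<Longrightarrow> has_cov_deriv Y V t J"
  unfolding has_cov_deriv_def has_vector_derivative_iff_quotient
  by (auto simp: filterlim_sup)

lemma parallel_glue:
  assumes "parallel_on {s..m} Y" "parallel_on {m..t} Z" "Y m = Z m" "s \<le> m" "m \<le> t"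
  shows "parallel_on {s..t} (\<lambda>r. if r \<le> m then Y r else Z r)" (is "parallel_on _ ?W")
  unfolding parallel_on_def
proof
  fix r assume r: "r \<in> {s..t}"
  have 1: "has_cov_deriv ?W 0 r {s..m}"
  proof (cases "r \<in> {s..m}")
    case True
    then show ?thesis
      by (rule has_cov_deriv_cong[of Y 0 r "{s..m}", rotated 1]) (use assms(1) True in \<open>auto simp: parallel_on_def\<close>)
  qed (simp add: has_cov_deriv_bot at_within_Icc_bot)
  have 2: "has_cov_deriv ?W 0 r {m..t}"
  proof (cases "r \<in> {m..t}")
    case True
    then show ?thesis
      by (rule has_cov_deriv_cong[of Z 0 r "{m..t}", rotated 1]) (use assms(2,3) True in \<open>auto simp: parallel_on_def\<close>)
  qed (simp add: has_cov_deriv_bot at_within_Icc_bot)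
  show "has_cov_deriv ?W 0 r {s..t}"
    by (rule has_cov_deriv_sup[OF at_within_Icc_split[OF assms(4,5)] 1 2])
qed

text \<open>Near \<open>t0\<close> the coefficient of the linear equation for parallel fields is
  bounded by \<open>K\<close> in the chart. The condition on \<open>\<delta>\<close> is the
  contraction requirement of \<open>linear_ode_exists\<close> for intervals of length up to
  \<open>2 * \<delta>\<close>.\<close>

lemma chart_neighbourhood:
  assumes t0: "t0 \<in> {0..b}" and C: "C \<in> A" "c t0 \<in> fst C"
  shows "\<exists>\<delta>>0. \<exists>K\<ge>0. K * (2 * \<delta>) \<le> 1 / 2 \<and> (\<forall>s\<in>{0..b}. \<bar>s - t0\<bar> < \<delta> \<longrightarrow> c s \<in> fst C \<and>
    (\<forall>v. norm (\<Gamma> C (snd C (c s)) (coord A C (c s) (dc s)) v) \<le> K * norm v))"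
proof -
  have x: "snd C (c t0) \<in> chart_image C" using C chart_inverse by blast
  have "\<exists>\<delta>>0. \<exists>K\<ge>0. ball (snd C (c t0)) \<delta> \<subseteq> chart_image C \<and>
      (\<forall>y\<in>ball (snd C (c t0)) \<delta>. \<forall>u v. norm (\<Gamma> C y u v) \<le> K * norm u * norm v)"
    by (rule trilinear_locally_bounded[OF smooth_onD(2)[OF \<Gamma>_smooth[OF C(1)]] \<Gamma>_bilinear[OF C(1)] chart_open(2)[OF C(1)] x])
  then obtain \<delta>1 K1 where K1: "0 < \<delta>1" "0 \<le> K1"
    "\<forall>y\<in>ball (snd C (c t0)) \<delta>1. \<forall>u v. norm (\<Gamma> C y u v) \<le> K1 * norm u * norm v"
    by blast
  \<comment> \<open>The 1 leaves room for the components of the velocity to vary within distance 1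
    of their value at \<open>t0\<close>.\<close>
  define k where "k = norm (coord A C (c t0) (dc t0)) + 1"
  have "(components C dc \<longlongrightarrow> coord A C (c t0) (dc t0)) (at t0 within {0..b})"
    using has_cov_deriv_continuous[OF velocity_parallel[OF t0]] C unfolding field_continuous_def by blast
  then have "\<forall>\<^sub>F s in at t0 within {0..b}. dist (components C dc s) (coord A C (c t0) (dc t0)) < 1"
    by (rule tendstoD) simp
  moreover have "\<forall>\<^sub>F s in at t0 within {0..b}. snd C (c s) \<in> ball (snd C (c t0)) \<delta>1"
    using topological_tendstoD[OF curve_chart_tendsto[OF t0 order_refl C] open_ball] K1 by simp
  moreover have "\<forall>\<^sub>F s in at t0 within {0..b}. c s \<in> fst C" by (rule in_chart_eventually[OF t0 order_refl C])
  ultimately have "\<forall>\<^sub>F s in at t0 within {0..b}. c s \<in> fst C \<and> snd C (c s) \<in> ball (snd C (c t0)) \<delta>1 \<and>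
      norm (components C dc s) \<le> k"
  proof eventually_elim
    case (elim s)
    then have "norm (components C dc s) \<le> k"
      using norm_triangle_sub[of "components C dc s" "coord A C (c t0) (dc t0)"] by (simp add: k_def dist_norm)
    then show ?case using elim by blast
  qed
  then obtain d where d: "0 < d" "\<And>s. s \<in> {0..b} \<Longrightarrow> s \<noteq> t0 \<Longrightarrow> \<bar>s - t0\<bar> < d \<Longrightarrow> c s \<in> fst C \<and>
      snd C (c s) \<in> ball (snd C (c t0)) \<delta>1 \<and> norm (components C dc s) \<le> k"
    unfolding eventually_at dist_real_def by blast
  have all: "c s \<in> fst C \<and> snd C (c s) \<in> ball (snd C (c t0)) \<delta>1 \<and> norm (coord A C (c s) (dc s)) \<le> k"
    if "s \<in> {0..b}" "\<bar>s - t0\<bar> < d" for s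
  proof (cases "s = t0")
    case True then show ?thesis using C K1 by (simp add: k_def)
  next
    case False then show ?thesis using d(2)[OF that(1) False that(2)] by (simp add: components_along_def)
  qed
  define K where "K = K1 * k"
  have k: "0 < k" unfolding k_def by (smt (verit) norm_ge_zero)
  have K: "0 \<le> K" using K1 k by (simp add: K_def)
  \<comment> \<open>Then \<open>K * 2 * \<delta>\<close> is at most
    \<open>K / (2 * (K + 1))\<close>, which is below \<open>1 / 2\<close>; the \<open>+ 1\<close>
    avoids a division by zero.\<close>
  define \<delta> where "\<delta> = min d (1 / (4 * (K + 1)))"
  have "0 < \<delta>" using d K by (simp add: \<delta>_def)
  moreover have "K * (2 * \<delta>) \<le> 1 / 2"
  proof -
    have "K * (2 * \<delta>) \<le> K * (2 * (1 / (4 * (K + 1))))" using K by (intro mult_left_mono) (auto simp: \<delta>_def)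
    also have "\<dots> \<le> 1/2" using K by (simp add: field_simps)
    finally show ?thesis .
  qed
  moreover have "norm (\<Gamma> C (snd C (c s)) (coord A C (c s) (dc s)) v) \<le> K * norm v"
    if "s \<in> {0..b}" "\<bar>s - t0\<bar> < \<delta>" for s v
  proof -
    have s: "snd C (c s) \<in> ball (snd C (c t0)) \<delta>1" "norm (coord A C (c s) (dc s)) \<le> k"
      using all[OF that(1)] that(2) by (auto simp: \<delta>_def)
    have "norm (\<Gamma> C (snd C (c s)) (coord A C (c s) (dc s)) v) \<le> K1 * norm (coord A C (c s) (dc s)) * norm v"
      using K1 s by blast
    also have "\<dots> \<le> K * norm v" unfolding K_def using s K1 by (intro mult_right_mono mult_left_mono) auto
    finally show ?thesis .
  qed
  ultimately show ?thesis using all K by (intro exI[of _ \<delta>] conjI exI[of _ K]) (auto simp: \<delta>_def)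
qed

lemma parallel_local_exists:
  assumes C: "C \<in> A" and J: "{s..t} \<subseteq> {0..b}" "r0 \<in> {s..t}"
    and inC: "\<And>r. r \<in> {s..t} \<Longrightarrow> c r \<in> fst C"
    and bd: "\<And>r v. r \<in> {s..t} \<Longrightarrow> norm (\<Gamma> C (snd C (c r)) (coord A C (c r) (dc r)) v) \<le> K * norm v"
    and K: "0 \<le> K" "K * (t - s) \<le> 1 / 2"
  shows "\<exists>Y. parallel_on {s..t} Y \<and> Y r0 = X"
proof -
  define a where "a r y = - \<Gamma> C (snd C (c r)) (coord A C (c r) (dc r)) y" for r y
  have bil: "bounded_bilinear (\<Gamma> C (snd C (c r)))" if "r \<in> {s..t}" for r
    using \<Gamma>_bilinear C chart_inverse inC[OF that] by blast
  have cx: "continuous_on {s..t} (\<lambda>r. snd C (c r))" unfolding continuous_on_def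
    using curve_chart_tendsto J(1) C inC by blast
  have cv: "continuous_on {s..t} (components C dc)" unfolding continuous_on_def
  proof
    fix r assume r: "r \<in> {s..t}"
    have "field_continuous dc r {s..t}"
      using has_cov_deriv_continuous[OF has_cov_deriv_subset[OF velocity_parallel J(1)]] r J by auto
    then show "(components C dc \<longlongrightarrow> components C dc r) (at r within {s..t})"
      using C inC[OF r] unfolding field_continuous_def by (simp add: components_along_def)
  qed
  have cont: "continuous_on ({s..t} \<times> UNIV) (\<lambda>(r, y). a r y)"
  proof -
    have "continuous_on ({s..t} \<times> UNIV) (\<lambda>p. (snd C (c (fst p)), components C dc (fst p), snd p))"
      by (intro continuous_on_Pair continuous_on_snd continuous_on_id
          continuous_on_compose2[OF cx continuous_on_fst[OF continuous_on_id]]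
          continuous_on_compose2[OF cv continuous_on_fst[OF continuous_on_id]]) auto
    from continuous_on_compose2[OF smooth_onD(2)[OF \<Gamma>_smooth[OF C]] this]
    have "continuous_on ({s..t} \<times> UNIV) (\<lambda>p. \<Gamma> C (snd C (c (fst p))) (components C dc (fst p)) (snd p))"
      using inC C chart_inverse(4) by (auto simp: image_subset_iff)
    from continuous_on_minus[OF this] show ?thesis
      by (simp add: a_def components_along_def case_prod_unfold)
  qed
  have lip: "norm (a r x - a r y) \<le> K * norm (x - y)" if "r \<in> {s..t}" for r x y
  proof -
    interpret G: bounded_bilinear "\<Gamma> C (snd C (c r))" by (rule bil[OF that])
    have "a r x - a r y = - \<Gamma> C (snd C (c r)) (coord A C (c r) (dc r)) (x - y)"
      by (simp add: a_def G.diff_right)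
    then show ?thesis using bd[OF that] by simp
  qed
  have st: "s \<le> t" using J(2) by auto
  obtain y where y: "y r0 = coord A C (c r0) X"
    "\<And>r. r \<in> {s..t} \<Longrightarrow> (y has_vector_derivative a r (y r)) (at r within {s..t})"
    using linear_ode_exists[OF st J(2) cont lip K] by blast
  define Y where "Y r = tangent_of_coord A C (c r) (y r)" for r
  have cY: "coord A C (c r) (Y r) = y r" if "r \<in> {s..t}" for r
    unfolding Y_def using coord_tangent(1)[OF C inC[OF that]] .
  have "has_cov_deriv Y 0 r {s..t}" if r: "r \<in> {s..t}" for r
  proof (rule has_cov_derivI[OF _ J(1) C inC[OF r]])
    interpret co: bounded_linear "coord A C (c r)" by (rule coord_linear(1)[OF C inC[OF r]])
    have "(components C Y has_vector_derivative a r (y r)) (at r within {s..t})"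
      by (rule has_vector_derivative_transform[OF r _ y(2)[OF r]]) (simp add: components_along_def cY)
    then show "(components C Y has_vector_derivative coord A C (c r) 0 -
        \<Gamma> C (snd C (c r)) (coord A C (c r) (dc r)) (coord A C (c r) (Y r))) (at r within {s..t})"
      by (simp add: cY[OF r] a_def co.zero)
  qed (use r J in auto)
  moreover have "Y r0 = X" using y(1) coord_tangent(2)[OF C inC[OF J(2)]] by (simp add: Y_def)
  ultimately show ?thesis unfolding parallel_on_def by blast
qed

text \<open>At a time \<open>m\<close> of maximal norm the mean value inequality bounds the
  deviation from the value at \<open>q\<close> by half the maximum; this takes the place of a
  Gronwall estimate.\<close>

lemma parallel_local_bound:
  assumes C: "C \<in> A" and J: "{s..t} \<subseteq> {0..b}"
    and inC: "\<And>r. r \<in> {s..t} \<Longrightarrow> c r \<in> fst C"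
    and bd: "\<And>r v. r \<in> {s..t} \<Longrightarrow> norm (\<Gamma> C (snd C (c r)) (coord A C (c r) (dc r)) v) \<le> K * norm v"
    and K: "0 \<le> K" "K * (t - s) \<le> 1 / 2"
    and Y: "parallel_on {s..t} Y" and r: "r \<in> {s..t}" "q \<in> {s..t}"
  shows "norm (components C Y r) \<le> 2 * norm (components C Y q)"
proof -
  let ?y = "components C Y"
  have d: "(?y has_vector_derivative - \<Gamma> C (snd C (c r)) (coord A C (c r) (dc r)) (?y r)) (at r within {s..t})"
    if "r \<in> {s..t}" for r
  proof -
    interpret co: bounded_linear "coord A C (c r)" by (rule coord_linear(1)[OF C inC[OF that]])
    have "has_cov_deriv Y 0 r {s..t}" using Y that unfolding parallel_on_def by blast
    then show ?thesis using C inC[OF that] unfolding has_cov_deriv_def by (auto simp: co.zero components_along_def)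
  qed
  have "continuous_on {s..t} ?y" by (rule continuous_on_vector_derivative[OF d])
  then have "continuous_on {s..t} (\<lambda>r. norm (?y r))" by (rule continuous_on_norm)
  then obtain m where m: "m \<in> {s..t}" "\<And>r. r \<in> {s..t} \<Longrightarrow> norm (?y r) \<le> norm (?y m)"
    using continuous_attains_sup[of "{s..t}" "\<lambda>r. norm (?y r)"] r(1) by (metis compact_Icc empty_iff)
  let ?M = "norm (?y m)"
  have "norm (?y m - ?y q) \<le> (K * ?M) * norm (m - q)"
  proof (rule differentiable_bound[of "{s..t}" ?y])
    show "(?y has_derivative (\<lambda>h. h *\<^sub>R (- \<Gamma> C (snd C (c x)) (coord A C (c x) (dc x)) (?y x)))) (at x within {s..t})"
      if "x \<in> {s..t}" for x using d[OF that] unfolding has_vector_derivative_def .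
    show "onorm (\<lambda>h. h *\<^sub>R (- \<Gamma> C (snd C (c x)) (coord A C (c x) (dc x)) (?y x))) \<le> K * ?M"
      if x: "x \<in> {s..t}" for x
    proof (rule onorm_le)
      fix h :: real
      have "norm (\<Gamma> C (snd C (c x)) (coord A C (c x) (dc x)) (?y x)) \<le> K * norm (?y x)" by (rule bd[OF x])
      also have "\<dots> \<le> K * ?M" using m(2)[OF x] K by (intro mult_left_mono) auto
      finally show "norm (h *\<^sub>R (- \<Gamma> C (snd C (c x)) (coord A C (c x) (dc x)) (?y x))) \<le> K * ?M * norm h"
        by (simp add: mult.commute mult_left_mono)
    qed
  qed (use m r in auto)
  also have "\<dots> \<le> (K * ?M) * (t - s)" using m r K by (intro mult_left_mono) auto
  also have "\<dots> = (K * (t - s)) * ?M" by simp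
  also have "\<dots> \<le> 1/2 * ?M" using K by (intro mult_right_mono) auto
  finally have "norm (?y m) \<le> 2 * norm (?y q)"
    using norm_triangle_sub[of "?y m" "?y q"] by simp
  then show ?thesis using m(2)[OF r(1)] by simp
qed

text \<open>Either end value can be prescribed, so that transport comes out bounded together with
  its inverse, and the property passes from adjacent intervals to their union.\<close>

definition transport_bounded :: "real \<Rightarrow> real \<Rightarrow> bool" where
  "transport_bounded s t \<longleftrightarrow> (\<exists>K\<ge>0. \<forall>X.
     (\<exists>Y. parallel_on {s..t} Y \<and> Y s = X \<and> norm (Y t) \<le> K * norm X) \<and>
     (\<exists>Y. parallel_on {s..t} Y \<and> Y t = X \<and> norm (Y s) \<le> K * norm X))"

lemma transport_bounded_compose:
  assumes "transport_bounded s m" "transport_bounded m t" "s \<le> m" "m \<le> t"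
  shows "transport_bounded s t"
proof -
  obtain K1 where K1: "0 \<le> K1" "\<And>X. \<exists>Y. parallel_on {s..m} Y \<and> Y s = X \<and> norm (Y m) \<le> K1 * norm X"
     "\<And>X. \<exists>Y. parallel_on {s..m} Y \<and> Y m = X \<and> norm (Y s) \<le> K1 * norm X"
    using assms(1) unfolding transport_bounded_def by blast
  obtain K2 where K2: "0 \<le> K2" "\<And>X. \<exists>Y. parallel_on {m..t} Y \<and> Y m = X \<and> norm (Y t) \<le> K2 * norm X"
     "\<And>X. \<exists>Y. parallel_on {m..t} Y \<and> Y t = X \<and> norm (Y m) \<le> K2 * norm X"
    using assms(2) unfolding transport_bounded_def by blast
  have "\<exists>Y. parallel_on {s..t} Y \<and> Y s = X \<and> norm (Y t) \<le> (K1 * K2) * norm X" for X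
  proof -
    obtain Y where Y: "parallel_on {s..m} Y" "Y s = X" "norm (Y m) \<le> K1 * norm X" using K1(2) by blast
    obtain Z where Z: "parallel_on {m..t} Z" "Z m = Y m" "norm (Z t) \<le> K2 * norm (Y m)" using K2(2) by blast
    have "norm (Z t) \<le> K2 * (K1 * norm X)" by (rule order_trans[OF Z(3) mult_left_mono[OF Y(3) K2(1)]])
    then show ?thesis
      using parallel_glue[OF Y(1) Z(1) Z(2)[symmetric] assms(3,4)] Y Z assms(3,4)
      by (intro exI[of _ "\<lambda>r. if r \<le> m then Y r else Z r"]) (auto simp: mult_ac)
  qed
  moreover have "\<exists>Y. parallel_on {s..t} Y \<and> Y t = X \<and> norm (Y s) \<le> (K1 * K2) * norm X" for X
  proof -
    obtain Z where Z: "parallel_on {m..t} Z" "Z t = X" "norm (Z m) \<le> K2 * norm X" using K2(3) by blast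
    obtain Y where Y: "parallel_on {s..m} Y" "Y m = Z m" "norm (Y s) \<le> K1 * norm (Z m)" using K1(3) by blast
    have "norm (Y s) \<le> K1 * (K2 * norm X)" by (rule order_trans[OF Y(3) mult_left_mono[OF Z(3) K1(1)]])
    then show ?thesis
      using parallel_glue[OF Y(1) Z(1) Y(2) assms(3,4)] Y Z assms(3,4)
      by (intro exI[of _ "\<lambda>r. if r \<le> m then Y r else Z r"]) (auto simp: mult_ac)
  qed
  moreover have "0 \<le> K1 * K2" using K1 K2 by simp
  ultimately show ?thesis unfolding transport_bounded_def by blast
qed

lemma transport_bounded_local:
  assumes x: "x \<in> {0..b}"
  shows "\<exists>\<delta>>0. \<forall>s t. s \<le> x \<and> x \<le> t \<and> t - s < \<delta> \<and> {s..t} \<subseteq> {0..b} \<longrightarrow> transport_bounded s t"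
proof -
  let ?C = "chart_at A (c x)"
  obtain \<delta> K where \<delta>: "0 < \<delta>" "0 \<le> K" "K * (2 * \<delta>) \<le> 1 / 2"
    "\<And>s. s \<in> {0..b} \<Longrightarrow> \<bar>s - x\<bar> < \<delta> \<Longrightarrow> c s \<in> fst ?C \<and>
      (\<forall>v. norm (\<Gamma> ?C (snd ?C (c s)) (coord A ?C (c s) (dc s)) v) \<le> K * norm v)"
    using chart_neighbourhood[OF x chart_at] by blast
  have "transport_bounded s t" if st: "s \<le> x" "x \<le> t" "t - s < \<delta>" and J: "{s..t} \<subseteq> {0..b}" for s t
  proof -
    have inC: "c r \<in> fst ?C"
      and bd: "norm (\<Gamma> ?C (snd ?C (c r)) (coord A ?C (c r) (dc r)) v) \<le> K * norm v" if "r \<in> {s..t}" for r v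
      using \<delta>(4)[of r] that J st by auto
    have K: "K * (t - s) \<le> 1 / 2"
    proof -
      have "K * (t - s) \<le> K * (2 * \<delta>)" using st \<delta> by (intro mult_left_mono) auto
      then show ?thesis using \<delta>(3) by linarith
    qed
    have inI: "s \<in> {s..t}" "t \<in> {s..t}" using st by auto
    \<comment> \<open>The chart components change by at most the factor 2. \<open>k1\<close> and
      \<open>k2\<close> bound the coordinate maps at \<open>r\<close> and \<open>q\<close> alone;
      since the charts \<open>chart_at\<close> are arbitrary, no bound uniform in the time is
      claimed.\<close>
    have bnd: "\<exists>k\<ge>0. \<forall>Y. parallel_on {s..t} Y \<longrightarrow> norm (Y q) \<le> k * norm (Y r)"
      if rq: "r \<in> {s..t}" "q \<in> {s..t}" for r q
    proof -
      obtain k1 where k1: "0 \<le> k1" "\<And>v. norm (coord A ?C (c r) v) \<le> norm v * k1"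
        using bounded_linear.nonneg_bounded[OF coord_linear(1)[OF chart_at(1) inC[OF rq(1)]]] by blast
      obtain k2 where k2: "0 \<le> k2" "\<And>v. norm (tangent_of_coord A ?C (c q) v) \<le> norm v * k2"
        using bounded_linear.nonneg_bounded[OF coord_linear(2)[OF chart_at(1) inC[OF rq(2)]]] by blast
      have "norm (Y q) \<le> (2 * k1 * k2) * norm (Y r)" if Y: "parallel_on {s..t} Y" for Y
      proof -
        have "norm (components ?C Y q) \<le> 2 * norm (components ?C Y r)"
          by (rule parallel_local_bound[OF chart_at(1) J inC bd \<delta>(2) K Y rq(2,1)])
        also have "\<dots> \<le> 2 * (norm (Y r) * k1)" using k1(2) by (simp add: components_along_def)
        finally have 1: "norm (components ?C Y q) \<le> 2 * (norm (Y r) * k1)" .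
        have "Y q = tangent_of_coord A ?C (c q) (components ?C Y q)"
          unfolding components_along_def by (rule coord_tangent(2)[OF chart_at(1) inC[OF rq(2)], symmetric])
        then have "norm (Y q) \<le> norm (components ?C Y q) * k2" using k2(2) by metis
        also have "\<dots> \<le> 2 * (norm (Y r) * k1) * k2" by (rule mult_right_mono[OF 1 k2(1)])
        finally show ?thesis by (simp add: mult_ac)
      qed
      then show ?thesis using k1 k2 by (intro exI[of _ "2 * k1 * k2"]) auto
    qed
    obtain ka where ka: "0 \<le> ka" "\<And>Y. parallel_on {s..t} Y \<Longrightarrow> norm (Y t) \<le> ka * norm (Y s)"
      using bnd[OF inI] by blast
    obtain kb where kb: "0 \<le> kb" "\<And>Y. parallel_on {s..t} Y \<Longrightarrow> norm (Y s) \<le> kb * norm (Y t)"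
      using bnd[OF inI(2,1)] by blast
    have ex: "\<exists>Y. parallel_on {s..t} Y \<and> Y r = X" if "r \<in> {s..t}" for r X
      by (rule parallel_local_exists[OF chart_at(1) J that inC bd \<delta>(2) K])
    have "\<exists>Y. parallel_on {s..t} Y \<and> Y s = X \<and> norm (Y t) \<le> (ka + kb) * norm X" for X
    proof -
      obtain Y where "parallel_on {s..t} Y" "Y s = X" using ex[OF inI(1)] by blast
      moreover have "ka * norm X \<le> (ka + kb) * norm X" using kb by (intro mult_right_mono) auto
      ultimately show ?thesis using ka(2)[of Y] by (intro exI[of _ Y]) auto
    qed
    moreover have "\<exists>Y. parallel_on {s..t} Y \<and> Y t = X \<and> norm (Y s) \<le> (ka + kb) * norm X" for X
    proof -
      obtain Y where "parallel_on {s..t} Y" "Y t = X" using ex[OF inI(2)] by blast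
      moreover have "kb * norm X \<le> (ka + kb) * norm X" using ka by (intro mult_right_mono) auto
      ultimately show ?thesis using kb(2)[of Y] by (intro exI[of _ Y]) auto
    qed
    ultimately show ?thesis unfolding transport_bounded_def using ka kb by (intro exI[of _ "ka + kb"]) auto
  qed
  then show ?thesis using \<delta>(1) by blast
qed

lemma transport_bounded: "0 \<le> s \<Longrightarrow> s \<le> t \<Longrightarrow> t \<le> b \<Longrightarrow> transport_bounded s t"
proof -
  assume st: "0 \<le> s" "s \<le> t" "t \<le> b"
  define P where "P p q \<longleftrightarrow> (s \<le> p \<and> q \<le> t \<longrightarrow> transport_bounded p q)" for p q
  have "P s t"
  proof (rule Bolzano[where P = P, OF st(2)])
    fix x y z assume "P x y" "P y z" "x \<le> y" "y \<le> z"
    then show "P x z" unfolding P_def using transport_bounded_compose by auto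
  next
    fix x assume x: "s \<le> x" "x \<le> t"
    then obtain \<delta> where "0 < \<delta>" "\<forall>p q. p \<le> x \<and> x \<le> q \<and> q - p < \<delta> \<and> {p..q} \<subseteq> {0..b} \<longrightarrow> transport_bounded p q"
      using transport_bounded_local[of x] st by auto
    moreover have "{p..q} \<subseteq> {0..b}" if "s \<le> p" "q \<le> t" for p q using that st by auto
    ultimately show "\<exists>d>0. \<forall>p q. p \<le> x \<and> x \<le> q \<and> q - p < d \<longrightarrow> P p q"
      unfolding P_def by blast
  qed
  then show ?thesis by (simp add: P_def)
qed

lemma parallel_exists:
  assumes t: "t \<in> {0..b}"
  shows "\<exists>Y. parallel_on {0..b} Y \<and> Y t = X"
proof -
  have "transport_bounded 0 t" "transport_bounded t b" using t transport_bounded by auto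
  then obtain Y Z where Y: "parallel_on {0..t} Y" "Y t = X" and Z: "parallel_on {t..b} Z" "Z t = X"
    unfolding transport_bounded_def by blast
  have "Y t = Z t" using Y Z by simp
  from parallel_glue[OF Y(1) Z(1) this] show ?thesis
    using t Y by (intro exI[of _ "\<lambda>r. if r \<le> t then Y r else Z r"]) auto
qed

lemma parallel_norm_bound:
  assumes t: "t \<in> {0..b}"
  shows "\<exists>K\<ge>0. \<forall>Y. parallel_on {0..b} Y \<longrightarrow> norm (Y t) \<le> K * norm (Y 0) \<and> norm (Y 0) \<le> K * norm (Y t)"
proof -
  have "transport_bounded 0 t" using t transport_bounded by auto
  then obtain K where K: "0 \<le> K" "\<And>X. \<exists>Y. parallel_on {0..t} Y \<and> Y 0 = X \<and> norm (Y t) \<le> K * norm X"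
     "\<And>X. \<exists>Y. parallel_on {0..t} Y \<and> Y t = X \<and> norm (Y 0) \<le> K * norm X"
    unfolding transport_bounded_def by blast
  have J: "{0..t} \<subseteq> {0..b}" and m: "0 \<in> {0..t}" "t \<in> {0..t}" using t by auto
  have "norm (Y t) \<le> K * norm (Y 0) \<and> norm (Y 0) \<le> K * norm (Y t)" if Y: "parallel_on {0..b} Y" for Y
  proof -
    note Y' = parallel_on_subset[OF Y J]
    obtain Z where Z: "parallel_on {0..t} Z" "Z 0 = Y 0" "norm (Z t) \<le> K * norm (Y 0)" using K(2) by blast
    obtain W where W: "parallel_on {0..t} W" "W t = Y t" "norm (W 0) \<le> K * norm (Y t)" using K(3) by blast
    show ?thesis
      using parallel_unique[OF Z(1) Y' J m Z(2)] parallel_unique[OF W(1) Y' J m(2,1) W(2)] Z W by simp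
  qed
  then show ?thesis using K by blast
qed

lemma transport_eq:
  assumes Y: "parallel_on {0..b} Y" and t: "t \<in> {0..b}" "s \<in> {0..b}"
  shows "parallel_transport A \<Gamma> c b t s (Y t) = Y s"
  unfolding parallel_transport_def
proof (rule the_equality)
  show "\<exists>Z. parallel_field A \<Gamma> c b Z \<and> Z t = Y t \<and> Z s = Y s" using Y parallel_on_iff by blast
  fix V assume "\<exists>Z. parallel_field A \<Gamma> c b Z \<and> Z t = Y t \<and> Z s = V"
  then obtain Z where Z: "parallel_on {0..b} Z" "Z t = Y t" "Z s = V" using parallel_on_iff by blast
  show "V = Y s" using parallel_unique[OF Z(1) Y order_refl t Z(2)] Z(3) by simp
qed

section \<open>Transport to the start of the geodesic\<close>

definition from_start where "from_start t X = parallel_transport A \<Gamma> c b 0 t X"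
definition to_start where "to_start t V = parallel_transport A \<Gamma> c b t 0 V"

lemma zero_in: "0 \<in> {0..b}"
  using b by simp

lemma from_start_parallel: "parallel_on {0..b} (\<lambda>t. from_start t X)"
proof -
  obtain Y where Y: "parallel_on {0..b} Y" "Y 0 = X" using parallel_exists[OF zero_in] by blast
  have "from_start t X = Y t" if "t \<in> {0..b}" for t
    unfolding from_start_def using transport_eq[OF Y(1) zero_in that] Y(2) by simp
  then show ?thesis
    using Y(1) unfolding parallel_on_def by (metis has_cov_deriv_cong)
qed

lemma to_start_parallel: "parallel_on {0..b} Y \<Longrightarrow> t \<in> {0..b} \<Longrightarrow> to_start t (Y t) = Y 0"
  unfolding to_start_def by (rule transport_eq[OF _ _ zero_in])

lemma from_start_zero: "from_start 0 X = X"
proof -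
  obtain Y where Y: "parallel_on {0..b} Y" "Y 0 = X" using parallel_exists[OF zero_in] by blast
  then show ?thesis unfolding from_start_def using transport_eq[OF Y(1) zero_in zero_in] by simp
qed

lemma parallel_eq_from_start: "parallel_on {0..b} Y \<Longrightarrow> t \<in> {0..b} \<Longrightarrow> Y t = from_start t (Y 0)"
  unfolding from_start_def using transport_eq[OF _ zero_in] by metis

lemma to_from: "t \<in> {0..b} \<Longrightarrow> to_start t (from_start t X) = X"
  using to_start_parallel[OF from_start_parallel] from_start_zero by metis

lemma from_to: "t \<in> {0..b} \<Longrightarrow> from_start t (to_start t V) = V"
  using parallel_exists[of t V] to_start_parallel parallel_eq_from_start by metis

lemma to_start_zero: "to_start 0 V = V"
  using to_from[OF zero_in, of V] from_start_zero by simp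

lemma from_start_lin: "t \<in> {0..b} \<Longrightarrow> from_start t (k *\<^sub>R X + l *\<^sub>R Y) = k *\<^sub>R from_start t X + l *\<^sub>R from_start t Y"
  using parallel_eq_from_start[OF parallel_on_lin[OF from_start_parallel from_start_parallel order_refl], of t k X l Y]
    from_start_zero by simp

lemma to_start_lin: "t \<in> {0..b} \<Longrightarrow> to_start t (k *\<^sub>R X + l *\<^sub>R Y) = k *\<^sub>R to_start t X + l *\<^sub>R to_start t Y"
  using from_start_lin[of t k "to_start t X" l "to_start t Y"] by (metis from_to to_from)

lemma transport_linear:
  assumes t: "t \<in> {0..b}"
  shows "bounded_linear (from_start t)" "bounded_linear (to_start t)"
proof -
  obtain K where K: "0 \<le> K" "\<And>Y. parallel_on {0..b} Y \<Longrightarrow> norm (Y t) \<le> K * norm (Y 0) \<and> norm (Y 0) \<le> K * norm (Y t)"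
    using parallel_norm_bound[OF t] by blast
  have 1: "norm (from_start t X) \<le> K * norm X" for X
    using K(2)[OF from_start_parallel, of X] from_start_zero by simp
  have 2: "norm (to_start t V) \<le> K * norm V" for V
    using K(2)[OF from_start_parallel, of "to_start t V"] from_start_zero from_to[OF t] by simp
  show "bounded_linear (from_start t)"
    using from_start_lin[OF t, of 1 _ 1] from_start_lin[OF t, of _ _ 0] 1
    by (intro bounded_linear_intro[where K = K]) (auto simp: mult.commute)
  show "bounded_linear (to_start t)"
    using to_start_lin[OF t, of 1 _ 1] to_start_lin[OF t, of _ _ 0] 2
    by (intro bounded_linear_intro[where K = K]) (auto simp: mult.commute)
qed

lemma from_start_isometry: "t \<in> {0..b} \<Longrightarrow> g (c t) (from_start t X) (from_start t Y) = g (c 0) X Y"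
  using parallel_inner_constant[OF from_start_parallel from_start_parallel order_refl _ zero_in] from_start_zero by metis

lemma to_start_isometry: "t \<in> {0..b} \<Longrightarrow> g (c 0) (to_start t X) (to_start t Y) = g (c t) X Y"
  using from_start_isometry[of t "to_start t X" "to_start t Y"] from_to by simp

text \<open>\<open>\<Phi> s\<close> transports to the start the vector with given components in a
  fixed chart. On the components of a parallel field its value does not depend on \<open>s\<close>;
  boundedness, continuity and the derivative of \<open>\<Phi>\<close> are all extracted from this
  identity.\<close>

lemma to_start_chart:
  assumes t: "t \<in> {0..b}" and J: "J \<subseteq> {0..b}" and C: "C \<in> A" "c t \<in> fst C"
  defines "\<Phi> s q \<equiv> to_start s (tangent_of_coord A C (c s) q)"
  shows "\<exists>K. \<forall>\<^sub>F s in at t within J. linear (\<Phi> s) \<and> (\<forall>q. norm (\<Phi> s q) \<le> K * norm q)"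
    and "((\<lambda>s. \<Phi> s q) \<longlongrightarrow> \<Phi> t q) (at t within J)"
    and "((\<lambda>s. \<Phi> s q) has_vector_derivative \<Phi> t (\<Gamma> C (snd C (c t)) (coord A C (c t) (dc t)) q)) (at t within J)"
proof -
  have lin: "bounded_linear (\<Phi> s)" if "s \<in> {0..b}" "c s \<in> fst C" for s
    unfolding \<Phi>_def using bounded_linear_compose[OF transport_linear(2)[OF that(1)] coord_linear(2)[OF C(1) that(2)]] .
  obtain \<delta> K where \<delta>: "0 < \<delta>" "0 \<le> K" "K * (2 * \<delta>) \<le> 1 / 2"
    "\<And>s. s \<in> {0..b} \<Longrightarrow> \<bar>s - t\<bar> < \<delta> \<Longrightarrow> c s \<in> fst C \<and>
      (\<forall>v. norm (\<Gamma> C (snd C (c s)) (coord A C (c s) (dc s)) v) \<le> K * norm v)"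
    using chart_neighbourhood[OF t C] by blast
  obtain k where k: "0 \<le> k" "\<And>q. norm (\<Phi> t q) \<le> norm q * k"
    using bounded_linear.nonneg_bounded[OF lin[OF t C(2)]] by blast
  have par: "to_start s (Y s) = \<Phi> t (components C Y t)" if "parallel_on {0..b} Y" "s \<in> {0..b}" for Y s
    unfolding \<Phi>_def components_along_def coord_tangent(2)[OF C]
    using to_start_parallel[OF that] to_start_parallel[OF that(1) t] by simp
  have bd: "norm (\<Phi> s q) \<le> (2 * k) * norm q" if s: "s \<in> {0..b}" "\<bar>s - t\<bar> < \<delta>" for s q
  proof -
    have Cs: "c s \<in> fst C" using \<delta>(4)[OF s] by blast
    define Y where "Y r = from_start r (\<Phi> s q)" for r
    have Y: "parallel_on {0..b} Y" unfolding Y_def by (rule from_start_parallel)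
    have Ys: "Y s = tangent_of_coord A C (c s) q" unfolding Y_def \<Phi>_def by (rule from_to[OF s(1)])
    have cs: "components C Y s = q" unfolding components_along_def Ys by (rule coord_tangent(1)[OF C(1) Cs])
    \<comment> \<open>\<open>s\<close> may lie on either side of \<open>t\<close>.\<close>
    define p p' where "p = min s t" and "p' = max s t"
    have pp: "{p..p'} \<subseteq> {0..b}" "s \<in> {p..p'}" "t \<in> {p..p'}" using s t by (auto simp: p_def p'_def)
    have near: "c r \<in> fst C \<and> (\<forall>v. norm (\<Gamma> C (snd C (c r)) (coord A C (c r) (dc r)) v) \<le> K * norm v)"
      if "r \<in> {p..p'}" for r
      using that s pp(1) by (intro \<delta>(4)) (auto simp: p_def p'_def)
    have "K * (p' - p) \<le> K * (2 * \<delta>)" using s \<delta> by (intro mult_left_mono) (auto simp: p_def p'_def)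
    then have Kp: "K * (p' - p) \<le> 1 / 2" using \<delta>(3) by linarith
    have "norm (components C Y t) \<le> 2 * norm (components C Y s)"
      by (rule parallel_local_bound[OF C(1) pp(1) _ _ \<delta>(2) Kp parallel_on_subset[OF Y pp(1)] pp(3,2)])
         (use near in blast)+
    then have "norm (components C Y t) * k \<le> 2 * norm q * k" unfolding cs using k by (intro mult_right_mono)
    moreover have "\<Phi> s q = \<Phi> t (components C Y t)"
      using par[OF Y s(1)] unfolding Ys \<Phi>_def .
    ultimately show ?thesis using k(2)[of "components C Y t"] by (simp add: mult_ac)
  qed
  have "\<forall>\<^sub>F s in at t within J. s \<in> J \<and> \<bar>s - t\<bar> < \<delta>"
    using \<delta>(1) unfolding eventually_at dist_real_def by (intro exI[of _ \<delta>]) auto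
  then have ev: "\<forall>\<^sub>F s in at t within J. linear (\<Phi> s) \<and> (\<forall>q. norm (\<Phi> s q) \<le> (2 * k) * norm q)"
  proof eventually_elim
    case (elim s)
    then have "s \<in> {0..b}" using J by auto
    then show ?case using bd \<delta>(4) lin elim bounded_linear.linear by blast
  qed
  then show "\<exists>K. \<forall>\<^sub>F s in at t within J. linear (\<Phi> s) \<and> (\<forall>q. norm (\<Phi> s q) \<le> K * norm q)" by blast
  interpret co: bounded_linear "coord A C (c t)" by (rule coord_linear(1)[OF C])
  \<comment> \<open>\<open>y\<close> consists of the components of the parallel field with
    components \<open>q\<close> at \<open>t\<close>. Since
    \<open>\<Phi> s (y s) = \<Phi> t q\<close>, linearity expresses \<open>\<Phi> s q\<close>
    through the vector \<open>q - y s\<close>, which tends to 0 and has the Christoffel term as its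
    derivative at \<open>t\<close>.\<close>
  have par_q: "\<exists>y. (y has_vector_derivative - \<Gamma> C (snd C (c t)) (coord A C (c t) (dc t)) q) (at t within J) \<and>
      y t = q \<and> (\<forall>\<^sub>F s in at t within J. \<Phi> t q + \<Phi> s (q - y s) = \<Phi> s q)" for q
  proof -
    define Y where "Y r = from_start r (\<Phi> t q)" for r
    have Y: "parallel_on {0..b} Y" unfolding Y_def by (rule from_start_parallel)
    have "Y t = tangent_of_coord A C (c t) q" unfolding Y_def \<Phi>_def by (rule from_to[OF t])
    then have ct: "components C Y t = q" unfolding components_along_def by (simp add: coord_tangent(1)[OF C])
    have "has_cov_deriv Y 0 t J" using Y t J has_cov_deriv_subset unfolding parallel_on_def by blast
    then have "(components C Y has_vector_derivative - \<Gamma> C (snd C (c t)) (coord A C (c t) (dc t)) q) (at t within J)"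
      using C ct unfolding has_cov_deriv_def by (auto simp: co.zero components_along_def)
    moreover have "\<forall>\<^sub>F s in at t within J. \<Phi> t q + \<Phi> s (q - components C Y s) = \<Phi> s q"
      using ev in_chart_eventually[OF t J C] \<open>\<forall>\<^sub>F s in at t within J. s \<in> J \<and> \<bar>s - t\<bar> < \<delta>\<close>
    proof eventually_elim
      case (elim s)
      have s: "s \<in> {0..b}" using elim J by auto
      have "\<Phi> s (components C Y s) = \<Phi> t q"
        using par[OF Y s] unfolding ct by (simp add: \<Phi>_def components_along_def coord_tangent(2)[OF C(1) elim(2)])
      moreover have "linear (\<Phi> s)" using elim by blast
      ultimately show ?case by (simp add: linear_diff)
    qed
    ultimately show ?thesis using ct by blast
  qed
  \<comment> \<open>Strong convergence is first needed at the vector 0 only, because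
    \<open>tendsto_apply_family\<close> is then applied to \<open>q - y s\<close>, which tends to
    0.\<close>
  have z0: "((\<lambda>s. \<Phi> s 0) \<longlongrightarrow> 0) (at t within J)"
    by (rule Lim_transform_eventually[OF tendsto_const]) (use ev in \<open>eventually_elim, simp add: linear_0\<close>)
  have lim: "((\<lambda>s. \<Phi> s q) \<longlongrightarrow> \<Phi> t q) (at t within J)" for q
  proof -
    obtain y where y: "(y has_vector_derivative - \<Gamma> C (snd C (c t)) (coord A C (c t) (dc t)) q) (at t within J)"
      "y t = q" "\<forall>\<^sub>F s in at t within J. \<Phi> t q + \<Phi> s (q - y s) = \<Phi> s q" using par_q by blast
    have "((\<lambda>s. q - y s) \<longlongrightarrow> 0) (at t within J)"
      using tendsto_diff[OF tendsto_const has_vector_derivative_continuous[OF y(1), unfolded continuous_within], of q] y(2)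
      by simp
    from tendsto_add[OF tendsto_const tendsto_apply_family[OF ev z0 this], of "\<Phi> t q"]
    show ?thesis using Lim_transform_eventually[OF _ y(3)] by simp
  qed
  then show "((\<lambda>s. \<Phi> s q) \<longlongrightarrow> \<Phi> t q) (at t within J)" .
  obtain y where y: "(y has_vector_derivative - \<Gamma> C (snd C (c t)) (coord A C (c t) (dc t)) q) (at t within J)"
    "y t = q" "\<forall>\<^sub>F s in at t within J. \<Phi> t q + \<Phi> s (q - y s) = \<Phi> s q" using par_q by blast
  have q': "((\<lambda>s. (q - y s) /\<^sub>R (s - t)) \<longlongrightarrow> \<Gamma> C (snd C (c t)) (coord A C (c t) (dc t)) q) (at t within J)"
    using has_vector_derivative_diff[OF has_vector_derivative_const y(1), of q]
    unfolding has_vector_derivative_iff_quotient by (simp add: y(2))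
  show "((\<lambda>s. \<Phi> s q) has_vector_derivative \<Phi> t (\<Gamma> C (snd C (c t)) (coord A C (c t) (dc t)) q)) (at t within J)"
    unfolding has_vector_derivative_iff_quotient
  proof (rule Lim_transform_eventually[OF tendsto_apply_family[OF ev lim q']])
    show "\<forall>\<^sub>F s in at t within J. \<Phi> s ((q - y s) /\<^sub>R (s - t)) = (\<Phi> s q - \<Phi> t q) /\<^sub>R (s - t)"
      using ev y(3)
    proof eventually_elim
      case (elim s)
      have l: "linear (\<Phi> s)" using elim by blast
      show ?case using elim(2) unfolding linear_cmul[OF l] by (metis add_diff_cancel_left')
    qed
  qed
qed

lemma to_start_tendsto:
  assumes Z: "field_continuous Z t J" and t: "t \<in> {0..b}" and J: "J \<subseteq> {0..b}"
  shows "((\<lambda>s. to_start s (Z s)) \<longlongrightarrow> to_start t (Z t)) (at t within J)"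
proof -
  let ?C = "chart_at A (c t)"
  obtain K where K: "\<forall>\<^sub>F s in at t within J. linear (\<lambda>q. to_start s (tangent_of_coord A ?C (c s) q)) \<and>
      (\<forall>q. norm (to_start s (tangent_of_coord A ?C (c s) q)) \<le> K * norm q)"
    using to_start_chart(1)[OF t J chart_at] by blast
  have y: "(components ?C Z \<longlongrightarrow> coord A ?C (c t) (Z t)) (at t within J)"
    using Z chart_at unfolding field_continuous_def by blast
  have "((\<lambda>s. to_start s (tangent_of_coord A ?C (c s) (components ?C Z s))) \<longlongrightarrow>
      to_start t (tangent_of_coord A ?C (c t) (coord A ?C (c t) (Z t)))) (at t within J)"
    by (rule tendsto_apply_family[OF K to_start_chart(2)[OF t J chart_at] y])
  then show ?thesis unfolding coord_tangent(2)[OF chart_at]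
    by (rule Lim_transform_eventually)
       (use in_chart_eventually[OF t J chart_at] in \<open>eventually_elim, simp add: components_along_def coord_tangent(2) chart_at\<close>)
qed

text \<open>The Christoffel term in the derivative of the transported chart cancels the one in the
  derivative of the components, so transport turns covariant into ordinary derivatives.\<close>

lemma to_start_derivative:
  assumes Z: "has_cov_deriv Z V t J" and t: "t \<in> {0..b}" and J: "J \<subseteq> {0..b}"
  shows "((\<lambda>s. to_start s (Z s)) has_vector_derivative to_start t V) (at t within J)"
proof -
  let ?C = "chart_at A (c t)"
  let ?P = "\<lambda>s q. to_start s (tangent_of_coord A ?C (c s) q)"
  let ?G = "\<Gamma> ?C (snd ?C (c t)) (coord A ?C (c t) (dc t))"
  obtain K where K: "\<forall>\<^sub>F s in at t within J. linear (?P s) \<and> (\<forall>q. norm (?P s q) \<le> K * norm q)"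
    using to_start_chart(1)[OF t J chart_at] by blast
  have d: "(components ?C Z has_vector_derivative coord A ?C (c t) V - ?G (coord A ?C (c t) (Z t))) (at t within J)"
    using Z chart_at unfolding has_cov_deriv_def by blast
  have e: "((\<lambda>s. ?P s (components ?C Z s)) has_vector_derivative
      ?P t (?G (components ?C Z t)) + ?P t (coord A ?C (c t) V - ?G (coord A ?C (c t) (Z t)))) (at t within J)"
    by (rule has_vector_derivative_apply_family[OF K to_start_chart(2)[OF t J chart_at]
          to_start_chart(3)[OF t J chart_at] d])
  interpret P: bounded_linear "?P t"
    using bounded_linear_compose[OF transport_linear(2)[OF t] coord_linear(2)[OF chart_at]] .
  have "((\<lambda>s. ?P s (components ?C Z s)) has_vector_derivative to_start t V) (at t within J)"
    using e by (simp add: P.diff components_along_def coord_tangent(2)[OF chart_at])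
  then show ?thesis
    unfolding has_vector_derivative_iff_quotient components_along_def coord_tangent(2)[OF chart_at]
    by (rule Lim_transform_eventually)
       (use in_chart_eventually[OF t J chart_at] in \<open>eventually_elim, simp add: coord_tangent(2) chart_at\<close>)
qed

end

locale curvature_geodesic = riemannian_geodesic +
  assumes curvature_cont: "curvature_continuous A \<Gamma>"
begin

lemma curvature_bounded_linear: "bounded_linear (\<lambda>X. curvature A \<Gamma> p X v w)"
proof (rule bounded_linear_if_continuous)
  show "linear (\<lambda>X. curvature A \<Gamma> p X v w)"
    using curvature_lin[of p 1 _ 1] curvature_lin[of p _ _ 0] by (intro linearI) auto
  have "continuous_on UNIV (\<lambda>(X, Y, Z). curvature A \<Gamma> p X Y Z)"
    using curvature_cont unfolding curvature_continuous_def by blast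
  from continuous_on_compose2[OF this, of UNIV "\<lambda>X. (X, v, w)"]
  show "continuous_on UNIV (\<lambda>X. curvature A \<Gamma> p X v w)" by (simp add: continuous_intros)
qed

text \<open>\<open>curvature_cont\<close> concerns one point of the manifold at a time. The
  dependence on the base point is controlled through the smooth Christoffel symbols in a fixed
  chart.\<close>

lemma curvature_field_continuous:
  assumes W: "field_continuous W t J" and t: "t \<in> {0..b}" "J \<subseteq> {0..b}"
  shows "field_continuous (\<lambda>s. curvature A \<Gamma> (c s) (W s) (dc s) (dc s)) t J"
proof (rule field_continuousI[OF t chart_at])
  let ?C = "chart_at A (c t)"
  have x: "snd ?C (c t) \<in> chart_image ?C" using chart_at chart_inverse by blast
  have v: "(components ?C dc \<longlongrightarrow> coord A ?C (c t) (dc t)) (at t within J)"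
    using has_cov_deriv_continuous[OF has_cov_deriv_subset[OF velocity_parallel[OF t(1)] t(2)]] chart_at
    unfolding field_continuous_def by blast
  have w: "(components ?C W \<longlongrightarrow> coord A ?C (c t) (W t)) (at t within J)"
    using W chart_at unfolding field_continuous_def by blast
  have "((\<lambda>s. chart_curvature ?C (snd ?C (c s)) (components ?C W s) (components ?C dc s) (components ?C dc s)) \<longlongrightarrow>
      chart_curvature ?C (snd ?C (c t)) (coord A ?C (c t) (W t)) (coord A ?C (c t) (dc t)) (coord A ?C (c t) (dc t))) (at t within J)"
    by (rule chart_curvature_tendsto[OF chart_at(1) x curve_chart_tendsto[OF t chart_at] w v v])
  then show "(components ?C (\<lambda>s. curvature A \<Gamma> (c s) (W s) (dc s) (dc s)) \<longlongrightarrow>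
      coord A ?C (c t) (curvature A \<Gamma> (c t) (W t) (dc t) (dc t))) (at t within J)"
    unfolding curvature_chart[OF chart_at]
    by (rule Lim_transform_eventually)
       (use in_chart_eventually[OF t chart_at] in \<open>eventually_elim, simp add: components_along_def curvature_chart chart_at\<close>)
qed

section \<open>Curvature operators and fields after transport\<close>

abbreviation R where "R \<equiv> jacobi_operator A \<Gamma> c b"

lemma R_def: "R t X = to_start t (curvature A \<Gamma> (c t) (from_start t X) (dc t) (dc t))"
  by (simp add: jacobi_operator_def to_start_def from_start_def)

lemma R_bounded_linear: "t \<in> {0..b} \<Longrightarrow> bounded_linear (R t)"
  unfolding R_def[abs_def]
  by (intro bounded_linear_compose[OF transport_linear(2)] bounded_linear_compose[OF curvature_bounded_linear] transport_linear(1))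

lemma R_symmetric: "t \<in> {0..b} \<Longrightarrow> g (c 0) (R t X) Y = g (c 0) X (R t Y)"
proof -
  assume t: "t \<in> {0..b}"
  have "g (c 0) (R t X) Y = g (c t) (curvature A \<Gamma> (c t) (from_start t X) (dc t) (dc t)) (from_start t Y)"
    using to_start_isometry[OF t, of _ "from_start t Y"] to_from[OF t] by (simp add: R_def)
  also have "\<dots> = g (c t) (from_start t X) (curvature A \<Gamma> (c t) (from_start t Y) (dc t) (dc t))"
    by (rule curvature_symmetric)
  also have "\<dots> = g (c 0) X (R t Y)"
    using to_start_isometry[OF t, of "from_start t X"] to_from[OF t] by (simp add: R_def)
  finally show ?thesis .
qed

lemma R_strongly_continuous: "continuous_on {0..b} (\<lambda>t. R t X)"
  unfolding continuous_on_def
proof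
  fix t assume t: "t \<in> {0..b}"
  have "field_continuous (\<lambda>t. from_start t X) t {0..b}"
    using from_start_parallel[of X] t has_cov_deriv_continuous unfolding parallel_on_def by blast
  then have "field_continuous (\<lambda>s. curvature A \<Gamma> (c s) (from_start s X) (dc s) (dc s)) t {0..b}"
    by (rule curvature_field_continuous[OF _ t order_refl])
  then show "((\<lambda>t. R t X) \<longlongrightarrow> R t X) (at t within {0..b})"
    unfolding R_def by (rule to_start_tendsto[OF _ t order_refl])
qed

lemma field_energy_density:
  assumes "t \<in> {0..b}"
  shows "g (c t) V V - g (c t) (curvature A \<Gamma> (c t) Y (dc t) (dc t)) Y =
    g (c 0) (to_start t V) (to_start t V) - g (c 0) (R t (to_start t Y)) (to_start t Y)"
  using assms by (simp add: R_def from_to to_start_isometry)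

lemma jacobi_field_transport:
  assumes J: "jacobi_field A \<Gamma> c b J" and t: "t \<in> {0..b}"
  defines "DJ \<equiv> cov_deriv A \<Gamma> c {0..b} J"
  shows "((\<lambda>s. to_start s (J s)) has_vector_derivative to_start t (DJ t)) (at t within {0..b})"
    and "((\<lambda>s. to_start s (DJ s)) has_vector_derivative - R t (to_start t (J t))) (at t within {0..b})"
proof -
  have j: "field_differentiable_at A c {0..b} J t" "field_differentiable_at A c {0..b} DJ t"
    "cov_deriv A \<Gamma> c {0..b} DJ t + curvature A \<Gamma> (c t) (J t) (dc t) (dc t) = 0"
    using J t unfolding jacobi_field_def DJ_def Let_def by auto
  show "((\<lambda>s. to_start s (J s)) has_vector_derivative to_start t (DJ t)) (at t within {0..b})"
    unfolding DJ_def by (rule to_start_derivative[OF has_cov_deriv_cov_deriv[OF j(1) t] t order_refl])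
  interpret ts: bounded_linear "to_start t" by (rule transport_linear(2)[OF t])
  have "cov_deriv A \<Gamma> c {0..b} DJ t = - curvature A \<Gamma> (c t) (J t) (dc t) (dc t)"
    using j(3) by (simp add: eq_neg_iff_add_eq_0)
  then have "to_start t (cov_deriv A \<Gamma> c {0..b} DJ t) = - R t (to_start t (J t))"
    by (simp add: R_def from_to[OF t] linear_neg[OF ts.linear_axioms])
  then show "((\<lambda>s. to_start s (DJ s)) has_vector_derivative - R t (to_start t (J t))) (at t within {0..b})"
    using to_start_derivative[OF has_cov_deriv_cov_deriv[OF j(2) t] t order_refl] by simp
qed

text \<open>The index form takes covariant derivatives within \<open>{0..b}\<close>, the regularity
  of a piece is stated within \<open>{s..t}\<close>. The two agree in the interior, while at a break
  point the former may be an arbitrary value.\<close>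

lemma C1_field_transport:
  assumes Z: "C1_field_along A c {s..t} Z" and st: "0 \<le> s" "s < t" "t \<le> b"
  shows "continuous_on {s..t} (\<lambda>r. to_start r (Z r))"
    and "r \<in> {s<..<t} \<Longrightarrow> ((\<lambda>r. to_start r (Z r)) has_vector_derivative
      to_start r (cov_deriv A \<Gamma> c {0..b} Z r)) (at r)"
    and "(\<lambda>r. g (c 0) (to_start r (cov_deriv A \<Gamma> c {0..b} Z r)) (to_start r (cov_deriv A \<Gamma> c {0..b} Z r)))
      integrable_on {s..t}"
proof -
  have J: "{s..t} \<subseteq> {0..b}" using st by auto
  obtain D where D: "\<And>C. C \<in> A \<Longrightarrow> continuous_on ({s..t} \<inter> c -` fst C) (D C)"
    "\<And>C r. C \<in> A \<Longrightarrow> r \<in> {s..t} \<Longrightarrow> c r \<in> fst C \<Longrightarrow> (components C Z has_vector_derivative D C r) (at r within {s..t})"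
  proof -
    have "\<forall>C\<in>A. \<exists>D. continuous_on ({s..t} \<inter> c -` fst C) D \<and>
        (\<forall>r\<in>{s..t} \<inter> c -` fst C. (components C Z has_vector_derivative D r) (at r within {s..t}))"
      using Z unfolding C1_field_along_def .
    from bchoice[OF this] obtain D where D: "\<forall>C\<in>A. continuous_on ({s..t} \<inter> c -` fst C) (D C) \<and>
        (\<forall>r\<in>{s..t} \<inter> c -` fst C. (components C Z has_vector_derivative D C r) (at r within {s..t}))"
      by blast
    show thesis by (rule that[of D]) (use D in blast)+
  qed
  \<comment> \<open>\<open>V\<close> is the covariant derivative built from the derivatives
    \<open>D\<close> within the piece; it is continuous up to the end points, where
    \<open>cov_deriv\<close> may differ from it.\<close>
  define V where "V r = D (chart_at A (c r)) r + \<Gamma> (chart_at A (c r)) (snd (chart_at A (c r)) (c r)) (dc r) (Z r)" for r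
  have cov: "has_cov_deriv Z (V r) r {s..t}" if r: "r \<in> {s..t}" for r
  proof (rule has_cov_derivI[OF _ J chart_at])
    show "r \<in> {0..b}" using r J by blast
    show "(components (chart_at A (c r)) Z has_vector_derivative
        coord A (chart_at A (c r)) (c r) (V r) - \<Gamma> (chart_at A (c r)) (snd (chart_at A (c r)) (c r))
          (coord A (chart_at A (c r)) (c r) (dc r)) (coord A (chart_at A (c r)) (c r) (Z r))) (at r within {s..t})"
      using D(2)[OF chart_at(1) r chart_at(2)] unfolding coord_chart_at V_def by simp
  qed
  have nontriv: "at r within {s..t} \<noteq> bot" if "r \<in> {s..t}" for r
    using that st by (simp add: trivial_limit_within islimpt_Icc)
  have coordV: "coord A C (c r) (V r) = D C r + \<Gamma> C (snd C (c r)) (coord A C (c r) (dc r)) (coord A C (c r) (Z r))"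
    if "C \<in> A" "c r \<in> fst C" "r \<in> {s..t}" for C r
    using vector_derivative_unique_within[OF nontriv[OF that(3)] D(2)[OF that(1,3,2)]]
      cov[OF that(3)] that unfolding has_cov_deriv_def by (auto simp: algebra_simps)
  have Vc: "field_continuous V r {s..t}" if r: "r \<in> {s..t}" for r
  proof (rule field_continuousI[OF _ J chart_at])
    show rb: "r \<in> {0..b}" using r J by blast
    let ?C = "chart_at A (c r)"
    have ev: "\<forall>\<^sub>F q in at r within {s..t}. c q \<in> fst ?C" by (rule in_chart_eventually[OF rb J chart_at])
    have evS: "\<forall>\<^sub>F q in at r within {s..t}. q \<in> {s..t}" by (simp add: eventually_at_filter)
    have "\<forall>\<^sub>F q in at r within {s..t}. q \<in> {s..t} \<inter> c -` fst ?C" using ev evS by eventually_elim simp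
    \<comment> \<open>Near \<open>r\<close> the piece stays in the chart, so the continuity of
      \<open>D\<close>, known only on the preimage of the chart domain, becomes a limit within
      \<open>{s..t}\<close>.\<close>
    then have eq: "at r within {s..t} = at r within ({s..t} \<inter> c -` fst ?C)"
    proof -
      have "\<exists>U. open U \<and> r \<in> U \<and> (\<forall>q\<in>U. q \<noteq> r \<longrightarrow> q \<in> {s..t} \<longrightarrow> c q \<in> fst ?C)"
        using ev unfolding eventually_at_topological by blast
      then obtain U where U: "open U" "r \<in> U" "\<forall>q\<in>U. q \<noteq> r \<longrightarrow> q \<in> {s..t} \<longrightarrow> c q \<in> fst ?C" by blast
      show ?thesis by (rule at_within_nhd[OF U(2,1)]) (use U(3) in auto)
    qed
    have dD: "(D ?C \<longlongrightarrow> D ?C r) (at r within {s..t})"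
      using D(1)[OF chart_at(1)] r chart_at(2) unfolding eq continuous_on_def by blast
    have x: "snd ?C (c r) \<in> chart_image ?C" using chart_at chart_inverse by blast
    have t3: "((\<lambda>q. (snd ?C (c q), components ?C dc q, components ?C Z q)) \<longlongrightarrow>
        (snd ?C (c r), coord A ?C (c r) (dc r), coord A ?C (c r) (Z r))) (at r within {s..t})"
      using has_cov_deriv_continuous[OF has_cov_deriv_subset[OF velocity_parallel[OF rb] J]]
        has_cov_deriv_continuous[OF cov[OF r]] chart_at unfolding field_continuous_def
      by (intro tendsto_Pair curve_chart_tendsto[OF rb J chart_at]) blast+
    have "((\<lambda>q. (\<lambda>(x, u, v). \<Gamma> ?C x u v) (snd ?C (c q), components ?C dc q, components ?C Z q)) \<longlongrightarrow>
        (\<lambda>(x, u, v). \<Gamma> ?C x u v) (snd ?C (c r), coord A ?C (c r) (dc r), coord A ?C (c r) (Z r))) (at r within {s..t})"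
      by (rule continuous_on_tendsto_compose[OF smooth_onD(2)[OF \<Gamma>_smooth[OF chart_at(1)]] t3])
         (use x ev in \<open>auto elim!: eventually_mono simp: chart_inverse(4) chart_at\<close>)
    from tendsto_add[OF dD this]
    have "((\<lambda>q. D ?C q + \<Gamma> ?C (snd ?C (c q)) (components ?C dc q) (components ?C Z q)) \<longlongrightarrow>
        coord A ?C (c r) (V r)) (at r within {s..t})"
      using coordV[OF chart_at r] by simp
    then show "(components ?C V \<longlongrightarrow> coord A ?C (c r) (V r)) (at r within {s..t})"
      by (rule Lim_transform_eventually)
         (use ev evS in \<open>eventually_elim, simp add: components_along_def coordV chart_at\<close>)
  qed
  have rb: "r \<in> {0..b}" if "r \<in> {s..t}" for r using that J by blast
  show "continuous_on {s..t} (\<lambda>r. to_start r (Z r))"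
    by (rule continuous_on_vector_derivative[OF to_start_derivative[OF cov rb J]])
  have eqV: "cov_deriv A \<Gamma> c {0..b} Z r = V r" and interior: "has_cov_deriv Z (V r) r {0..b}"
    if r: "r \<in> {s<..<t}" for r
  proof -
    have "at r within {0..b} = at r within {s..t}"
      using r st at_within_Icc_at[of s r t] at_within_Icc_at[of 0 r b] by auto
    then show "has_cov_deriv Z (V r) r {0..b}"
      using cov[of r] r unfolding has_cov_deriv_def by auto
    then show "cov_deriv A \<Gamma> c {0..b} Z r = V r" using cov_deriv_eq(2)[OF _ rb] r by auto
  qed
  show "((\<lambda>r. to_start r (Z r)) has_vector_derivative to_start r (cov_deriv A \<Gamma> c {0..b} Z r)) (at r)"
    if r: "r \<in> {s<..<t}" for r
  proof -
    have "at r within {s..t} = at r" using r by (intro at_within_Icc_at) auto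
    then show ?thesis using to_start_derivative[OF cov rb J, of r] eqV[OF r] r by auto
  qed
  interpret g0: weak_inner "g (c 0)" by (rule metric_form)
  have "continuous_on {s..t} (\<lambda>r. to_start r (V r))"
    unfolding continuous_on_def using to_start_tendsto[OF Vc rb J] by blast
  then have "(\<lambda>r. g (c 0) (to_start r (V r)) (to_start r (V r))) integrable_on {s..t}"
    by (intro integrable_continuous_real g0.continuous_on)
  \<comment> \<open>The two integrands differ at most at \<open>s\<close> and
    \<open>t\<close>.\<close>
  then show "(\<lambda>r. g (c 0) (to_start r (cov_deriv A \<Gamma> c {0..b} Z r)) (to_start r (cov_deriv A \<Gamma> c {0..b} Z r)))
      integrable_on {s..t}"
    by (rule integrable_spike_finite[of "{s, t}", rotated 2]) (use eqV in auto)
qed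

end

section \<open>Symmetry of the Weingarten operator\<close>

context weak_riemannian
begin

section \<open>Tangent and normal spaces of a submanifold\<close>

lemma submanifold_chart:
  assumes "submanifold A N" "p \<in> N"
  obtains C F where "C \<in> A" "p \<in> fst C" "subspace F" "closed F" "snd C ` (fst C \<inter> N) = chart_image C \<inter> F"
  using assms unfolding submanifold_def by blast

lemma chart_inv_in_submanifold:
  assumes C: "C \<in> A" and F: "snd C ` (fst C \<inter> N) = chart_image C \<inter> F" and x: "x \<in> chart_image C" "x \<in> F"
  shows "chart_inv C x \<in> N"
proof -
  have "x \<in> snd C ` (fst C \<inter> N)" using F x by blast
  then show ?thesis using chart_inverse(1)[OF C] by auto
qed

lemma chart_inv_line_continuous:
  assumes C: "C \<in> A" and x: "x + t *\<^sub>R u \<in> chart_image C"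
  shows "continuous (at t within J) (\<lambda>s. chart_inv C (x + s *\<^sub>R u))"
proof -
  have "isCont (chart_inv C) (x + t *\<^sub>R u)"
    using chart_continuous(2)[OF C] chart_open(2)[OF C] x continuous_on_eq_continuous_at by blast
  moreover have "isCont (\<lambda>s. x + s *\<^sub>R u) t" by (intro continuous_intros)
  ultimately have "isCont (\<lambda>s. chart_inv C (x + s *\<^sub>R u)) t" by (rule isCont_o2[rotated])
  then show ?thesis by (rule continuous_at_imp_continuous_at_within)
qed

text \<open>Difference quotients of a curve in \<open>N\<close> stay in the closed subspace
  \<open>F\<close>; conversely, every vector of \<open>F\<close> is the velocity of a straight line
  in the chart.\<close>

lemma tangent_sub_chart:
  assumes C: "C \<in> A" "p \<in> fst C" and F: "subspace F" "closed F" "snd C ` (fst C \<inter> N) = chart_image C \<inter> F"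
    and p: "p \<in> N"
  shows "tangent_sub A N p = {X. coord A C p X \<in> F}"
proof (intro set_eqI iffI)
  fix X assume "X \<in> tangent_sub A N p"
  then obtain \<gamma> where \<gamma>: "\<And>t::real. \<gamma> t \<in> N" "\<gamma> 0 = p" "has_velocity A \<gamma> X 0 UNIV"
    unfolding tangent_sub_def by blast
  have inF: "snd C q \<in> F" if "q \<in> fst C" "q \<in> N" for q using F(3) that by blast
  have "((\<lambda>s. snd C (\<gamma> s)) has_vector_derivative coord A C (\<gamma> 0) X) (at 0)"
    using has_velocity_chart[OF \<gamma>(3) C(1)] C(2) \<gamma>(2) by simp
  then have lim: "((\<lambda>s. (snd C (\<gamma> s) - snd C (\<gamma> 0)) /\<^sub>R (s - 0)) \<longlongrightarrow> coord A C p X) (at 0)"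
    unfolding has_vector_derivative_iff_quotient \<gamma>(2) .
  have "\<forall>\<^sub>F s in at 0. \<gamma> s \<in> fst C"
    using eventually_in_chart[of 0 UNIV \<gamma> "fst C"] \<gamma>(2,3) chart_open(1)[OF C(1)] C(2)
    unfolding has_velocity_def by auto
  then have "\<forall>\<^sub>F s in at 0. (snd C (\<gamma> s) - snd C (\<gamma> 0)) /\<^sub>R (s - 0) \<in> F"
    by eventually_elim (use inF \<gamma>(1,2) C(2) p in \<open>auto intro!: subspace_scale subspace_diff F(1)\<close>)
  then have "coord A C p X \<in> F"
    by (rule Lim_in_closed_set[OF F(2) _ _ lim]) simp
  then show "X \<in> {X. coord A C p X \<in> F}" by simp
next
  fix X assume "X \<in> {X. coord A C p X \<in> F}"
  then have u: "coord A C p X \<in> F" by simp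
  define u where "u = coord A C p X"
  define x where "x = snd C p"
  \<comment> \<open>\<open>tangent_sub\<close> demands a curve in \<open>N\<close> defined on the
    whole line, so the line is replaced by the constant \<open>p\<close> at parameters where it lies
    outside the chart.\<close>
  define \<gamma> where "\<gamma> s = (if x + s *\<^sub>R u \<in> chart_image C then chart_inv C (x + s *\<^sub>R u) else p)" for s :: real
  have x: "x \<in> chart_image C" "x \<in> F" using chart_inverse(4)[OF C(1)] F(3) C p by (auto simp: x_def)
  have "\<gamma> s \<in> N" for s
    using chart_inv_in_submanifold[OF C(1) F(3), of "x + s *\<^sub>R u"] u x(2) F(1) p
    unfolding \<gamma>_def u_def by (auto intro!: subspace_add subspace_scale)
  moreover have g0: "\<gamma> 0 = p" using x(1) chart_inverse(1)[OF C] by (simp add: \<gamma>_def x_def)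
  moreover have "has_velocity A \<gamma> X 0 UNIV"
  proof -
    have ev: "\<forall>\<^sub>F s in at 0. x + s *\<^sub>R u \<in> chart_image C" by (rule line_eventually[OF chart_open(2)[OF C(1)] x(1)])
    have x0: "x + 0 *\<^sub>R u \<in> chart_image C" using x by simp
    have "((\<lambda>s. chart_inv C (x + s *\<^sub>R u)) \<longlongrightarrow> \<gamma> 0) (at 0)"
      using chart_inv_line_continuous[OF C(1) x0, of UNIV] x0 unfolding continuous_within by (simp add: \<gamma>_def)
    then have "(\<gamma> \<longlongrightarrow> \<gamma> 0) (at 0)"
      by (rule Lim_transform_eventually) (use ev in \<open>eventually_elim, simp add: \<gamma>_def\<close>)
    then have 1: "continuous (at 0) \<gamma>" by (simp add: continuous_within)
    have "((\<lambda>s. snd C (\<gamma> s)) has_vector_derivative u) (at 0)"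
      using line_derivative[of x u] unfolding has_vector_derivative_iff_quotient
      by (rule Lim_transform_eventually)
         (use ev in \<open>eventually_elim, simp add: \<gamma>_def x(1) chart_inverse(2)[OF C(1)]\<close>)
    from has_velocityI[OF 1 C(1) _ this] show ?thesis
      using coord_tangent(2)[OF C] C(2) by (simp add: g0 u_def)
  qed
  ultimately show "X \<in> tangent_sub A N p" unfolding tangent_sub_def by blast
qed

lemma tangent_sub_subspace:
  assumes "submanifold A N" "p \<in> N"
  shows "subspace (tangent_sub A N p)"
proof -
  obtain C F where C: "C \<in> A" "p \<in> fst C" and F: "subspace F" "closed F" "snd C ` (fst C \<inter> N) = chart_image C \<inter> F"
    by (rule submanifold_chart[OF assms])
  interpret co: bounded_linear "coord A C p" by (rule coord_linear(1)[OF C])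
  show ?thesis unfolding tangent_sub_chart[OF C F assms(2)]
    using F(1) by (auto simp: subspace_def co.zero co.add co.scaleR)
qed

lemma normal_sub_subspace: "subspace (normal_sub A g N p)"
proof -
  interpret gp: weak_inner "g p" by (rule metric_form)
  show ?thesis unfolding normal_sub_def
    by (auto simp: subspace_def gp.zero_right gp.add_right gp.scaleR_right)
qed

text \<open>Differentiating \<open>g(V, \<nu>) = 0\<close> along a curve in \<open>N\<close>, with \<open>V\<close> constant in a submanifold chart,
  expresses the shape operator by the Christoffel symbols alone.\<close>

lemma normal_covariant_derivative:
  assumes C: "C \<in> A" "p \<in> fst C" and F: "subspace F" "closed F" "snd C ` (fst C \<inter> N) = chart_image C \<inter> F"
    and p: "p \<in> N" and \<nu>: "normal_extension A g N p \<xi> \<nu>"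
    and v: "v \<in> tangent_sub A N p" and v': "v' \<in> tangent_sub A N p"
  shows "g p v' (covariant_derivative A \<Gamma> \<nu> p v) =
    - g p (tangent_of_coord A C p (\<Gamma> C (snd C p) (coord A C p v) (coord A C p v'))) \<xi>"
proof -
  obtain W where W: "open W" "p \<in> W" "smooth_vector_field_on A W \<nu>" "\<forall>q\<in>N \<inter> W. \<nu> q \<in> normal_sub A g N q"
    and \<nu>p: "\<nu> p = \<xi>" using \<nu> unfolding normal_extension_def by blast
  define x u u' where "x = snd C p" and "u = coord A C p v" and "u' = coord A C p v'"
  have u: "u \<in> F" "u' \<in> F" using v v' unfolding tangent_sub_chart[OF C F p] u_def u'_def by auto
  have x: "x \<in> chart_image C" "x \<in> F" using chart_inverse(4)[OF C(1)] F(3) C p by (auto simp: x_def)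
  define O1 where "O1 = snd C ` (fst C \<inter> W)"
  have O1: "open O1" "x \<in> O1" using overlap_open[OF C(1) W(1)] C W by (auto simp: O1_def x_def)
  have "\<forall>\<^sub>F s in at 0. x + s *\<^sub>R u \<in> O1" by (rule line_eventually[OF O1])
  then obtain d where d: "0 < d" "\<And>s. s \<noteq> 0 \<Longrightarrow> \<bar>s\<bar> < d \<Longrightarrow> x + s *\<^sub>R u \<in> O1"
    unfolding eventually_at dist_real_def by auto
  \<comment> \<open>Half of \<open>d\<close> gives a closed interval \<open>{0..e}\<close> on which
    \<open>riemannian_curve\<close> can be instantiated; derivatives at 0 are then
    one-sided.\<close>
  define e where "e = d / 2"
  have e: "0 < e" using d by (simp add: e_def)
  have onO: "x + s *\<^sub>R u \<in> O1" if "s \<in> {0..e}" for s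
    using d(2)[of s] that O1(2) e by (cases "s = 0") (auto simp: e_def)
  have Oim: "y \<in> chart_image C" "chart_inv C y \<in> W" if "y \<in> O1" for y
    using that chart_inverse(1,4)[OF C(1)] unfolding O1_def by auto
  define \<gamma> where "\<gamma> s = chart_inv C (x + s *\<^sub>R u)" for s
  have \<gamma>N: "\<gamma> s \<in> N" "\<gamma> s \<in> W" "\<gamma> s \<in> fst C" "snd C (\<gamma> s) = x + s *\<^sub>R u" if "s \<in> {0..e}" for s
  proof -
    have "x + s *\<^sub>R u \<in> F" using x(2) u(1) F(1) by (auto intro!: subspace_add subspace_scale)
    then show "\<gamma> s \<in> N" unfolding \<gamma>_def using chart_inv_in_submanifold[OF C(1) F(3)] Oim(1)[OF onO[OF that]] by blast
    show "\<gamma> s \<in> W" "\<gamma> s \<in> fst C" "snd C (\<gamma> s) = x + s *\<^sub>R u"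
      unfolding \<gamma>_def using Oim onO[OF that] chart_inverse[OF C(1)] by auto
  qed
  have z: "0 \<in> {0..e}" using e by simp
  have \<gamma>0: "\<gamma> 0 = p" using chart_inverse(1)[OF C] by (simp add: \<gamma>_def x_def)
  have vel: "has_velocity A \<gamma> (tangent_of_coord A C (\<gamma> t) u) t {0..e}" if t: "t \<in> {0..e}" for t
  proof (rule has_velocityI[of t "{0..e}" \<gamma> C u, OF _ C(1) \<gamma>N(3)[OF t]])
    show "continuous (at t within {0..e}) \<gamma>" unfolding \<gamma>_def[abs_def]
      by (rule chart_inv_line_continuous[OF C(1) Oim(1)[OF onO[OF t]]])
    have "((\<lambda>s. x + s *\<^sub>R u) has_vector_derivative u) (at t within {0..e})"
      by (auto intro!: derivative_eq_intros simp: has_vector_derivative_def)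
    then show "((\<lambda>s. snd C (\<gamma> s)) has_vector_derivative u) (at t within {0..e})"
      by (rule has_vector_derivative_transform[OF t, rotated]) (simp add: \<gamma>N(4))
  qed
  interpret L: riemannian_curve A g \<Gamma> \<gamma> e
    by unfold_locales (use e vel in blast)+
  have dc0: "velocity A \<gamma> {0..e} 0 = v"
  proof -
    have "has_velocity A \<gamma> v 0 {0..e}" using vel[OF z] coord_tangent(2)[OF C] by (simp add: \<gamma>0 u_def)
    then show ?thesis unfolding velocity_def
      using vector_derivative_within[OF L.at_within_nontrivial[OF z]] unfolding has_velocity_def by blast
  qed
  let ?D = "chart_at A p"
  let ?n = "\<lambda>y. coord A ?D (chart_inv ?D y) (\<nu> (chart_inv ?D y))"
  have cov\<nu>: "L.has_cov_deriv (\<lambda>s. \<nu> (\<gamma> s)) (covariant_derivative A \<Gamma> \<nu> p v) 0 {0..e}"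
  proof (rule L.has_cov_derivI[OF z order_refl chart_at(1)[of p]])
    show D0: "\<gamma> 0 \<in> fst ?D" using chart_at \<gamma>0 by simp
    have "?n differentiable (at (snd ?D (\<gamma> 0)))"
      using W(2,3) smooth_onD(1) chart_at unfolding smooth_vector_field_on_def \<gamma>0 by blast
    from has_derivative_compose_curve[OF this L.curve_chart[OF z order_refl chart_at(1) D0]]
    have "((\<lambda>s. ?n (snd ?D (\<gamma> s))) has_vector_derivative
        frechet_derivative ?n (at (snd ?D p)) v) (at 0 within {0..e})"
      unfolding dc0 by (simp add: \<gamma>0 coord_chart_at)
    moreover have "\<forall>\<^sub>F s in at 0 within {0..e}. ?n (snd ?D (\<gamma> s)) = components_along A ?D \<gamma> (\<lambda>s. \<nu> (\<gamma> s)) s"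
      using L.in_chart_eventually[OF z order_refl chart_at(1) D0]
      by eventually_elim (simp add: components_along_def chart_inverse(1)[OF chart_at(1)])
    moreover have "?n (snd ?D (\<gamma> 0)) = components_along A ?D \<gamma> (\<lambda>s. \<nu> (\<gamma> s)) 0"
      using D0 by (simp add: components_along_def chart_inverse(1)[OF chart_at(1)])
    ultimately have "(components_along A ?D \<gamma> (\<lambda>s. \<nu> (\<gamma> s)) has_vector_derivative
        frechet_derivative ?n (at (snd ?D p)) v) (at 0 within {0..e})"
      unfolding has_vector_derivative_iff_quotient
      by (auto elim: Lim_transform_eventually elim!: eventually_mono)
    then show "(components_along A ?D \<gamma> (\<lambda>s. \<nu> (\<gamma> s)) has_vector_derivative
        coord A ?D (\<gamma> 0) (covariant_derivative A \<Gamma> \<nu> p v) -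
        \<Gamma> ?D (snd ?D (\<gamma> 0)) (coord A ?D (\<gamma> 0) (velocity A \<gamma> {0..e} 0)) (coord A ?D (\<gamma> 0) (\<nu> (\<gamma> 0)))) (at 0 within {0..e})"
      unfolding dc0 by (simp add: \<gamma>0 coord_chart_at covariant_derivative_def Let_def)
  qed
  define V where "V s = tangent_of_coord A C (\<gamma> s) u'" for s
  define V' where "V' = tangent_of_coord A C p (\<Gamma> C x u u')"
  have covV: "L.has_cov_deriv V V' 0 {0..e}"
  proof (rule L.has_cov_derivI[OF z order_refl C(1)])
    show "\<gamma> 0 \<in> fst C" using C(2) \<gamma>0 by simp
    have "(components_along A C \<gamma> V has_vector_derivative 0) (at 0 within {0..e})"
      by (rule has_vector_derivative_transform[OF z _ has_vector_derivative_const[of u']])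
         (simp add: components_along_def V_def coord_tangent(1)[OF C(1)] \<gamma>N(3))
    then show "(components_along A C \<gamma> V has_vector_derivative
        coord A C (\<gamma> 0) V' - \<Gamma> C (snd C (\<gamma> 0)) (coord A C (\<gamma> 0) (velocity A \<gamma> {0..e} 0)) (coord A C (\<gamma> 0) (V 0)))
        (at 0 within {0..e})"
      unfolding dc0 using coord_tangent(1)[OF C] by (simp add: \<gamma>0 V'_def V_def x_def u_def)
  qed
  have zero: "g (\<gamma> s) (V s) (\<nu> (\<gamma> s)) = 0" if s: "s \<in> {0..e}" for s
  proof -
    have "V s \<in> tangent_sub A N (\<gamma> s)"
      unfolding tangent_sub_chart[OF C(1) \<gamma>N(3)[OF s] F \<gamma>N(1)[OF s]]
      using u coord_tangent(1)[OF C(1) \<gamma>N(3)[OF s]] by (simp add: V_def)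
    moreover have "\<nu> (\<gamma> s) \<in> normal_sub A g N (\<gamma> s)" using W(4) \<gamma>N[OF s] by blast
    ultimately show ?thesis unfolding normal_sub_def by blast
  qed
  have "((\<lambda>s. g (\<gamma> s) (V s) (\<nu> (\<gamma> s))) has_vector_derivative
      g (\<gamma> 0) V' (\<nu> (\<gamma> 0)) + g (\<gamma> 0) (V 0) (covariant_derivative A \<Gamma> \<nu> p v)) (at 0 within {0..e})"
    by (rule L.metric_product_rule[OF covV cov\<nu> z order_refl])
  moreover have "((\<lambda>s. g (\<gamma> s) (V s) (\<nu> (\<gamma> s))) has_vector_derivative 0) (at 0 within {0..e})"
    by (rule has_vector_derivative_transform[OF z _ has_vector_derivative_const[of 0]]) (simp add: zero)
  ultimately have "g (\<gamma> 0) V' (\<nu> (\<gamma> 0)) + g (\<gamma> 0) (V 0) (covariant_derivative A \<Gamma> \<nu> p v) = 0"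
    using vector_derivative_unique_within[OF L.at_within_nontrivial[OF z]] by blast
  moreover have "V 0 = v'" using coord_tangent(2)[OF C] by (simp add: V_def \<gamma>0 u'_def)
  ultimately show ?thesis by (simp add: \<gamma>0 \<nu>p V'_def x_def u_def u'_def)
qed

text \<open>Paired with a tangent vector, the shape operator equals \<open>h\<close>. This value
  does not depend on the extension, so the description by \<open>THE\<close> is meaningful, and it
  is symmetric because the Christoffel symbols are.\<close>

lemma weingarten_symmetric:
  assumes N: "submanifold A N" "p \<in> N" and ex: "\<exists>\<nu>. normal_extension A g N p \<xi> \<nu>"
    and int: "tangent_sub A N p \<inter> normal_sub A g N p = {0}"
    and sum: "{v + w | v w. v \<in> tangent_sub A N p \<and> w \<in> normal_sub A g N p} = UNIV"
    and v: "v \<in> tangent_sub A N p" and v': "v' \<in> tangent_sub A N p"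
  shows "g p (weingarten A g \<Gamma> N p \<xi> v) v' = g p v (weingarten A g \<Gamma> N p \<xi> v')"
proof -
  let ?T = "tangent_sub A N p" and ?N = "normal_sub A g N p"
  interpret gp: weak_inner "g p" by (rule metric_form)
  obtain C F where C: "C \<in> A" "p \<in> fst C" and F: "subspace F" "closed F" "snd C ` (fst C \<inter> N) = chart_image C \<inter> F"
    by (rule submanifold_chart[OF N])
  have sT: "subspace ?T" by (rule tangent_sub_subspace[OF N])
  have sN: "subspace ?N" by (rule normal_sub_subspace)
  have proj: "tangent_proj A g N p X \<in> ?T \<and> X - tangent_proj A g N p X \<in> ?N" for X
    unfolding tangent_proj_def
  proof (rule theI')
    have "X \<in> {v + w | v w. v \<in> ?T \<and> w \<in> ?N}" unfolding sum by simp
    then obtain v w where vw: "X = v + w" "v \<in> ?T" "w \<in> ?N" by blast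
    show "\<exists>!v. v \<in> ?T \<and> X - v \<in> ?N"
    proof (rule ex1I[of _ v])
      fix y assume y: "y \<in> ?T \<and> X - y \<in> ?N"
      have "y - v \<in> ?T" using y vw by (intro subspace_diff[OF sT]) auto
      moreover have "w - (X - y) \<in> ?N" by (rule subspace_diff[OF sN]) (use y vw in auto)
      then have "y - v \<in> ?N" using vw(1) by simp
      ultimately have "y - v \<in> {0}" using int by blast
      then show "y = v" by simp
    qed (use vw in auto)
  qed
  define h where "h v v' = g p (tangent_of_coord A C p (\<Gamma> C (snd C p) (coord A C p v) (coord A C p v'))) \<xi>" for v v'
  have val: "g p (- tangent_proj A g N p (covariant_derivative A \<Gamma> \<nu> p v)) v' = h v v'"
    if "normal_extension A g N p \<xi> \<nu>" "v \<in> ?T" "v' \<in> ?T" for \<nu> v v'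
  proof -
    let ?X = "covariant_derivative A \<Gamma> \<nu> p v"
    have "g p v' (?X - tangent_proj A g N p ?X) = 0" using proj[of ?X] that(3) unfolding normal_sub_def by blast
    then have "g p v' (tangent_proj A g N p ?X) = g p v' ?X" by (simp add: gp.diff_right)
    then show ?thesis
      using normal_covariant_derivative[OF C F N(2) that]
      by (simp add: h_def gp.minus_left gp.minus_right gp.sym[of _ v'])
  qed
  have wein: "g p (weingarten A g \<Gamma> N p \<xi> v) v' = h v v'" if v: "v \<in> ?T" and v': "v' \<in> ?T" for v v'
  proof -
    have "\<exists>!V. \<exists>\<nu>. normal_extension A g N p \<xi> \<nu> \<and> V = - tangent_proj A g N p (covariant_derivative A \<Gamma> \<nu> p v)"
    proof (rule ex_ex1I)
      show "\<exists>V \<nu>. normal_extension A g N p \<xi> \<nu> \<and> V = - tangent_proj A g N p (covariant_derivative A \<Gamma> \<nu> p v)"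
        using ex by blast
    next
      fix V V' assume V: "\<exists>\<nu>. normal_extension A g N p \<xi> \<nu> \<and> V = - tangent_proj A g N p (covariant_derivative A \<Gamma> \<nu> p v)"
        and V': "\<exists>\<nu>. normal_extension A g N p \<xi> \<nu> \<and> V' = - tangent_proj A g N p (covariant_derivative A \<Gamma> \<nu> p v)"
      have T: "V \<in> ?T" "V' \<in> ?T" using V V' proj subspace_neg[OF sT] by blast+
      then have d: "V - V' \<in> ?T" by (rule subspace_diff[OF sT])
      have "g p V (V - V') = h v (V - V')" "g p V' (V - V') = h v (V - V')" using V V' val[OF _ v d] by blast+
      then have "g p (V - V') (V - V') = 0" by (simp add: gp.diff_left)
      then show "V = V'" using gp.eq_zero by fastforce
    qed
    from theI'[OF this] obtain \<nu> where "normal_extension A g N p \<xi> \<nu>"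
      "weingarten A g \<Gamma> N p \<xi> v = - tangent_proj A g N p (covariant_derivative A \<Gamma> \<nu> p v)"
      unfolding weingarten_def by blast
    then show ?thesis using val[OF _ v v'] by simp
  qed
  have "h v v' = h v' v"
    unfolding h_def using \<Gamma>_sym[OF C(1) chart_inverse(4)[OF C]] by simp
  then show ?thesis using wein[OF v v'] wein[OF v' v] gp.sym by metis
qed

end

section \<open>The focal index lemma\<close>

theorem lemma3p3:
  fixes A :: "('m::t2_space, 'a::{real_inner, complete_space}) chart set"
    and g :: "'m \<Rightarrow> 'a \<Rightarrow> 'a \<Rightarrow> real"
    and \<Gamma> :: "('m, 'a) chart \<Rightarrow> 'a \<Rightarrow> 'a \<Rightarrow> 'a \<Rightarrow> 'a"
    and N :: "'m set" and c :: "real \<Rightarrow> 'm" and b :: real and p :: 'm and \<xi> :: 'a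
    and T :: "real \<Rightarrow> 'a \<Rightarrow>\<^sub>L 'a" and Z J :: "real \<Rightarrow> 'a"
  assumes "hilbert_manifold A"
    and "weak_riemannian_metric A g"
    and "levi_civita A g \<Gamma>"
    and "curvature_continuous A \<Gamma>"
    and "submanifold A N"
    and "0 < b" and "geodesic A \<Gamma> c b"
    and "c 0 = p" and "p \<in> N"
    and "\<xi> = velocity A c {0..b} 0" and "\<xi> \<in> normal_sub A g N p"
    and "closed (tangent_sub A N p)"
    and "tangent_sub A N p \<inter> normal_sub A g N p = {0}"
    and "{v + w | v w. v \<in> tangent_sub A N p \<and> w \<in> normal_sub A g N p} = UNIV"
    and "\<exists>\<nu>. normal_extension A g N p \<xi> \<nu>"
    and "jacobi_flow A g \<Gamma> N c b T"
    and no_monofocal: "\<forall>t\<in>{0<..<b}. \<not> monofocal T t"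
    and finite_pathological: "finite {t \<in> {0<..<b}. pathological T t}"
    and dense_range: "\<forall>t\<in>{0<..<b}. pathological T t \<longrightarrow>
          (\<forall>X. \<forall>e>0. \<exists>Y. sqrt (g p (X - blinfun_apply (T t) Y) (X - blinfun_apply (T t) Y)) < e)"
    and "piecewise_differentiable_field A c b Z"
    and "Z 0 \<in> tangent_sub A N p"
    and "N_jacobi_field A g \<Gamma> N c b J" and "J b = Z b"
  shows "index_form A g \<Gamma> N c b Z \<ge> index_form A g \<Gamma> N c b J"
proof -
  let ?wein = "weingarten A g \<Gamma> N p \<xi>"
  let ?TN = "tangent_sub A N p" and ?NN = "normal_sub A g N p"
  interpret weak_riemannian A g \<Gamma>
    by unfold_locales (fact assms)+
  interpret curvature_geodesic A g \<Gamma> c b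
    by unfold_locales (use assms(4,6,7) in \<open>auto simp: geodesic_def\<close>)
  have xi: "\<xi> = dc 0" and c0: "c 0 = p" using assms(8,10) by auto
  have wein_sym: "g p (?wein v) v' = g p v (?wein v')" if "v \<in> ?TN" "v' \<in> ?TN" for v v'
    by (rule weingarten_symmetric[OF assms(5,9,15,13,14) that])
  have sT: "subspace ?TN" by (rule tangent_sub_subspace[OF assms(5,9)])
  have sN: "subspace ?NN" by (rule normal_sub_subspace)
  interpret gp: weak_inner "g p" by (rule metric_form)
  have orth: "g p v w = 0" "g p w v = 0" if "v \<in> ?TN" "w \<in> ?NN" for v w
    using that gp.sym[of w v] unfolding normal_sub_def by auto
  obtain T' T'' where flow: "\<And>t. t \<in> {0..b} \<Longrightarrow> (T has_vector_derivative T' t) (at t within {0..b})"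
    "\<And>t. t \<in> {0..b} \<Longrightarrow> (T' has_vector_derivative T'' t) (at t within {0..b})"
    "\<And>t X. t \<in> {0..b} \<Longrightarrow> blinfun_apply (T'' t) X + R t (blinfun_apply (T t) X) = 0"
    and initial: "\<And>v w. v \<in> ?TN \<Longrightarrow> w \<in> ?NN \<Longrightarrow> blinfun_apply (T 0) (v + w) = v"
    "\<And>v w. v \<in> ?TN \<Longrightarrow> w \<in> ?NN \<Longrightarrow> blinfun_apply (T' 0) (v + w) = - ?wein v + w"
    using assms(16) unfolding jacobi_flow_def c0 xi by blast
  have init: "blinfun_apply (T 0) v = v" "blinfun_apply (T' 0) v = - ?wein v" if "v \<in> ?TN" for v
    using initial[OF that subspace_0[OF sN]] by auto
  \<comment> \<open>Additivity is not visible from the definition of \<open>weingarten\<close>; it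
    is read off from the linear operator \<open>T' 0\<close>, which is the negative of
    \<open>?wein\<close> on the tangent space.\<close>
  have wein_add: "?wein (v + v') = ?wein v + ?wein v'" if "v \<in> ?TN" "v' \<in> ?TN" for v v'
  proof -
    have "- ?wein (v + v') = - ?wein v + - ?wein v'"
      unfolding init(2)[OF subspace_add[OF sT that], symmetric] init(2)[OF that(1), symmetric]
        init(2)[OF that(2), symmetric] by (rule blinfun.add_right)
    then have "- (- ?wein (v + v')) = - (- ?wein v + - ?wein v')" by (rule arg_cong)
    then show ?thesis by (simp add: add.commute)
  qed
  \<comment> \<open>After splitting into tangent and normal parts the mixed products vanish, and
    what is left is the symmetry of \<open>?wein\<close>.\<close>
  have initial_sym: "g p (blinfun_apply (T' 0) X) (blinfun_apply (T 0) Y) =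
      g p (blinfun_apply (T 0) X) (blinfun_apply (T' 0) Y)" for X Y
  proof -
    have "X \<in> {v + w | v w. v \<in> ?TN \<and> w \<in> ?NN}" "Y \<in> {v + w | v w. v \<in> ?TN \<and> w \<in> ?NN}"
      unfolding assms(14) by auto
    then obtain v w v' w' where d: "X = v + w" "v \<in> ?TN" "w \<in> ?NN" "Y = v' + w'" "v' \<in> ?TN" "w' \<in> ?NN"
      by blast
    show ?thesis unfolding d(1,4) initial[OF d(2,3)] initial[OF d(5,6)]
      using wein_sym[OF d(2,5)] orth[OF d(5,3)] orth[OF d(2,6)]
      by (simp add: gp.add_left gp.add_right gp.diff_left gp.diff_right gp.minus_left gp.minus_right)
  qed
  interpret JS: jacobi_system "g p" R b T T' T''
  proof (intro jacobi_system.intro jacobi_system_axioms.intro)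
    show "weak_inner (g p)" by (rule metric_form)
    show "bounded_linear (R t)" if "t \<in> {0..b}" for t by (rule R_bounded_linear[OF that])
    show "g p (R t x) y = g p x (R t y)" if "t \<in> {0..b}" for t x y
      using R_symmetric[OF that] unfolding c0 .
    show "continuous_on {0..b} (\<lambda>t. R t x)" for x by (rule R_strongly_continuous)
    show "blinfun_apply (T'' t) X = - R t (blinfun_apply (T t) X)" if "t \<in> {0..b}" for t X
      using flow(3)[OF that] by (simp add: eq_neg_iff_add_eq_0)
  qed (use b flow initial_sym in auto)
  have patho: "pathological T t \<longleftrightarrow> \<not> surj (blinfun_apply (T t))" if "t \<in> {0<..<b}" for t
    using no_monofocal that unfolding pathological_def epifocal_def by blast
  have bound: "JS.index_bound 0 b"
  proof (rule JS.index_bound_total)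
    show "inj (blinfun_apply (T t))" if "t \<in> {0<..<b}" for t
      using no_monofocal that unfolding monofocal_def by blast
    have "{t \<in> {0<..<b}. \<not> surj (blinfun_apply (T t))} = {t \<in> {0<..<b}. pathological T t}"
      using patho by blast
    then show "finite {t \<in> {0<..<b}. \<not> surj (blinfun_apply (T t))}" using finite_pathological by simp
    show "\<exists>Y. sqrt (g p (X - blinfun_apply (T t) Y) (X - blinfun_apply (T t) Y)) < e"
      if "t \<in> {0<..<b}" "\<not> surj (blinfun_apply (T t))" "0 < e" for t X e
      using dense_range patho that by blast
  qed
  define D where "D = cov_deriv A \<Gamma> c {0..b}"
  define z z' where "z t = to_start t (Z t)" and "z' t = to_start t (D Z t)" for t
  define j j' where "j t = to_start t (J t)" and "j' t = to_start t (D J t)" for t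
  have jac: "jacobi_field A \<Gamma> c b J" and J0: "J 0 \<in> ?TN" and NJ: "D J 0 + ?wein (J 0) \<in> ?NN"
    using assms(22) unfolding N_jacobi_field_def D_def c0 xi by auto
  have jd: "(j has_vector_derivative j' t) (at t within {0..b})"
    "(j' has_vector_derivative - R t (j t)) (at t within {0..b})" if "t \<in> {0..b}" for t
    using jacobi_field_transport[OF jac that] unfolding j_def[abs_def] j'_def[abs_def] D_def by auto
  have j: "JS.C2_on 0 b j j' (\<lambda>t. - R t (j t))"
  proof -
    have c: "continuous_on {0..b} j" "continuous_on {0..b} j'"
      by (rule continuous_on_vector_derivative, erule jd)+
    have "continuous_on {0..b} (\<lambda>t. - R t (j t))"
      by (intro continuous_on_minus JS.R_continuous c) simp
    moreover have "(j has_vector_derivative j' t) (at t) \<and> (j' has_vector_derivative - R t (j t)) (at t)"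
      if t: "t \<in> {0<..<b}" for t
    proof -
      have "at t within {0..b} = at t" using t by (intro at_within_Icc_at) auto
      then show ?thesis using jd[of t] t by auto
    qed
    ultimately show ?thesis using c unfolding JS.C2_on_def by blast
  qed
  have z: "JS.admissible 0 b z z'"
  proof -
    obtain n :: nat and s where s: "s 0 = 0" "s n = b" "\<And>i. i < n \<Longrightarrow> s i < s (Suc i)"
      "\<And>i. i < n \<Longrightarrow> C1_field_along A c {s i..s (Suc i)} Z"
      using assms(20) unfolding piecewise_differentiable_field_def by blast
    have mono: "s i \<le> s k" if "i \<le> k" "k \<le> n" for i k
      using that
    proof (induction k rule: dec_induct)
      case (step k)
      then show ?case using s(3)[of k] by auto
    qed simp
    have piece: "JS.admissible (s i) (s (Suc i)) z z'" if i: "i < n" for i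
    proof -
      have st: "0 \<le> s i" "s i < s (Suc i)" "s (Suc i) \<le> b"
        using mono[of 0 i] mono[of "Suc i" n] s(1,2) s(3)[OF i] i by auto
      show ?thesis unfolding JS.admissible_def
        using C1_field_transport[OF s(4)[OF i] st]
        by (auto simp: z_def[abs_def] z'_def[abs_def] D_def c0 intro!: exI[of _ "{}"])
    qed
    have "JS.admissible 0 (s i) z z'" if "i \<le> n" for i
      using that
    proof (induction i)
      case 0
      have "(\<lambda>r. g p (z' r) (z' r)) integrable_on {0::real}"
        using integrable_on_refl[of _ "0::real"] by simp
      then show ?case unfolding JS.admissible_def s(1) by (auto intro!: exI[of _ "{}"])
    next
      case (Suc i)
      then have i: "i < n" by simp
      show ?case
        by (rule JS.admissible_combine[OF _ piece[OF i]])
           (use Suc i mono[of 0 i] s(1) s(3)[OF i] in auto)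
    qed
    from this[of n] show ?thesis using s(2) by simp
  qed
  \<comment> \<open>Transport is isometric and turns the curvature into \<open>R t\<close>, so the
    integrands agree at every time in \<open>{0..b}\<close>.\<close>
  have energy: "index_form A g \<Gamma> N c b Y =
      JS.energy 0 b (\<lambda>t. to_start t (Y t)) (\<lambda>t. to_start t (D Y t)) - g p (?wein (Y 0)) (Y 0)" for Y
    unfolding index_form_def JS.energy_def Let_def D_def c0 xi[symmetric]
    by (intro arg_cong2[where f = "(-)"] integral_cong refl field_energy_density[unfolded c0])
  define w where "w = Z 0 - J 0"
  have w: "w \<in> ?TN" unfolding w_def by (rule subspace_diff[OF sT assms(21) J0])
  have start: "z 0 = Z 0" "j 0 = J 0" "j' 0 = D J 0" by (simp_all add: z_def j_def j'_def to_start_zero)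
  have eqb: "j b = z b" using assms(23) by (simp add: j_def z_def)
  note red = JS.energy_minus_jacobi[OF z j eqb]
  \<comment> \<open>\<open>index_bound\<close> is applied with the vector \<open>w\<close> at 0,
    where \<open>T 0\<close> fixes tangent vectors, and with the vector 0 at \<open>b\<close>, where
    \<open>z - j\<close> vanishes.\<close>
  have "JS.boundary b 0 - JS.boundary 0 w \<le> JS.energy 0 b (\<lambda>t. z t - j t) (\<lambda>t. z' t - j' t)"
    using bound red(1) init(1)[OF w] eqb unfolding JS.index_bound_def by (simp add: start w_def blinfun.zero_right)
  then have main: "g p (?wein w) w \<le> JS.energy 0 b (\<lambda>t. z t - j t) (\<lambda>t. z' t - j' t)"
    using init[OF w] by (simp add: JS.boundary_def blinfun.zero_right gp.zero_left gp.minus_left)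
  \<comment> \<open>The initial condition of an \<open>N\<close>-Jacobi field, paired with the
    tangent vector \<open>w\<close>.\<close>
  have "g p w (D J 0) = - g p w (?wein (J 0))"
    using orth(1)[OF w NJ] by (simp add: gp.add_right)
  \<comment> \<open>Expansion at \<open>Z 0 = w + J 0\<close>; its mixed term cancels the one left
    over by \<open>energy_minus_jacobi\<close>.\<close>
  moreover have "g p (?wein (Z 0)) (Z 0) = g p (?wein w) w + 2 * g p w (?wein (J 0)) + g p (?wein (J 0)) (J 0)"
  proof -
    have Z0: "Z 0 = w + J 0" by (simp add: w_def)
    show ?thesis unfolding Z0 wein_add[OF w J0]
      using wein_sym[OF w J0] by (simp add: gp.add_left gp.add_right gp.sym[of "?wein (J 0)" w])
  qed
  ultimately show ?thesis
    using main red(2) unfolding energy z_def[symmetric] z'_def[symmetric] j_def[symmetric] j'_def[symmetric]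
    by (simp add: start w_def)
qed

end
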